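(* Let $m,n\ge 0$ be integers with $n\mid m/\gcd(2,m)$, and let $(A,B;D)$ be an amalgam of groups in the variety $(m,n)$. The amalgam is strongly embeddable in $(m,n)$ if and only if the following two conditions are satisfied: (a) $D\cap A^nA'\subseteq Z(B)$ and $D\cap B^nB'\subseteq Z(A)$. (b) For every integer $q>0$ with $q\mid n$, and all $a\in A$, $a'\in A^nA'$, $b\in B$, $b'\in B^nB'$ with $a^qa'\in D$ and $b^qb'\in D$, we have $[a^qa',b]=[a,b^qb']\in D$ (that is, the commutator $[a^qa',b]$ computed in $B$ and the commutator $[a,b^qb']$ computed in $A$ both lie in $D$ and are the same element of $D$).
   Context: Commutators are $[x,y]=x^{-1}y^{-1}xy$ and $[x,y,z]=[[x,y],z]$; $G'=[G,G]$; $Z(G)$ is the center. For $k>0$, $G^k$ is the subgroup generated by all $k$-th powers of elements of $G$, and $G^0=\{e\}$. Every integer divides $0$, and $0$ divides only $0$. For nonnegative integers $m,n$ with $n\mid m/\gcd(2,m)$, $(m,n)$ denotes the variety (class) of all groups satisfying the identities $x^m=[x_1,x_2]^n=[x_1,x_2,x_3]=e$. In particular $(0,0)=\mathcal N_2$ is the variety of all nilpotent groups of class at most two. An amalgam $(A,B;D)$ of groups in a class $\mathcal C$ consists of groups $A,B,D\in\mathcal C$ together with injective homomorphisms $D\to A$ and $D\to B$; $D$ is identified with its images, so it is regarded as a subgroup of both $A$ and $B$. It is weakly embeddable in $\mathcal C$ if there are $M\in\mathcal C$ and injective homomorphisms $\lambda_A\colon A\to M$, $\lambda_B\colon B\to M$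 which agree on $D$; it is strongly embeddable in $\mathcal C$ if they can be chosen so that moreover $\lambda_A(A)\cap\lambda_B(B)=\lambda_A(D)$. *)

theory Defs
  imports "HOL-Algebra.Generated_Groups"
begin

definition commutator :: "('a, 'x) monoid_scheme \<Rightarrow> 'a \<Rightarrow> 'a \<Rightarrow> 'a" where
  "commutator G x y = inv\<^bsub>G\<^esub> x \<otimes>\<^bsub>G\<^esub> inv\<^bsub>G\<^esub> y \<otimes>\<^bsub>G\<^esub> x \<otimes>\<^bsub>G\<^esub> y"

definition center :: "('a, 'x) monoid_scheme \<Rightarrow> 'a set" where
  "center G = {z \<in> carrier G. \<forall>x \<in> carrier G. z \<otimes>\<^bsub>G\<^esub> x = x \<otimes>\<^bsub>G\<^esub> z}"

definition power_subgroup :: "('a, 'x) monoid_scheme \<Rightarrow> nat \<Rightarrow> 'a set" where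
  "power_subgroup G k =
     (if k = 0 then {\<one>\<^bsub>G\<^esub>} else generate G ((\<lambda>x. x [^]\<^bsub>G\<^esub> k) ` carrier G))"

(* The subset G^k G'. The library's derived subgroup is generated by the elements
   x y x^-1 y^-1 = [x^-1, y^-1], hence is the usual G'. *)
definition power_derived :: "('a, 'x) monoid_scheme \<Rightarrow> nat \<Rightarrow> 'a set" where
  "power_derived G k = power_subgroup G k <#>\<^bsub>G\<^esub> derived G (carrier G)"

definition in_variety :: "nat \<Rightarrow> nat \<Rightarrow> ('a, 'x) monoid_scheme \<Rightarrow> bool" where
  "in_variety m n G \<longleftrightarrow> group G \<and>
     (\<forall>x \<in> carrier G. x [^]\<^bsub>G\<^esub> m = \<one>\<^bsub>G\<^esub>) \<and>
     (\<forall>x \<in> carrier G. \<forall>y \<in> carrier G. commutator G x y [^]\<^bsub>G\<^esub> n = \<one>\<^bsub>G\<^esub>) \<and>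
     (\<forall>x \<in> carrier G. \<forall>y \<in> carrier G. \<forall>z \<in> carrier G.
        commutator G (commutator G x y) z = \<one>\<^bsub>G\<^esub>)"

definition amalgam ::
  "nat \<Rightarrow> nat \<Rightarrow> ('a, 'x) monoid_scheme \<Rightarrow> ('b, 'y) monoid_scheme \<Rightarrow> ('d, 'z) monoid_scheme \<Rightarrow>
   ('d \<Rightarrow> 'a) \<Rightarrow> ('d \<Rightarrow> 'b) \<Rightarrow> bool" where
  "amalgam m n A B D \<iota>\<^sub>A \<iota>\<^sub>B \<longleftrightarrow>
     in_variety m n A \<and> in_variety m n B \<and> in_variety m n D \<and>
     \<iota>\<^sub>A \<in> mon D A \<and> \<iota>\<^sub>B \<in> mon D B"

definition strong_embedding ::
  "nat \<Rightarrow> nat \<Rightarrow> ('a, 'x) monoid_scheme \<Rightarrow> ('b, 'y) monoid_scheme \<Rightarrow> ('d, 'z) monoid_scheme \<Rightarrow>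
   ('d \<Rightarrow> 'a) \<Rightarrow> ('d \<Rightarrow> 'b) \<Rightarrow> ('c, 'w) monoid_scheme \<Rightarrow> ('a \<Rightarrow> 'c) \<Rightarrow> ('b \<Rightarrow> 'c) \<Rightarrow> bool" where
  "strong_embedding m n A B D \<iota>\<^sub>A \<iota>\<^sub>B M \<phi>\<^sub>A \<phi>\<^sub>B \<longleftrightarrow>
     in_variety m n M \<and> \<phi>\<^sub>A \<in> mon A M \<and> \<phi>\<^sub>B \<in> mon B M \<and>
     (\<forall>d \<in> carrier D. \<phi>\<^sub>A (\<iota>\<^sub>A d) = \<phi>\<^sub>B (\<iota>\<^sub>B d)) \<and>
     \<phi>\<^sub>A ` carrier A \<inter> \<phi>\<^sub>B ` carrier B = \<phi>\<^sub>A ` \<iota>\<^sub>A ` carrier D"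

(* HOL cannot quantify existentially over the type of M. Words in A and B name every element
   of the subgroup of M generated by the images of A and B, so the type of words is large
   enough; lemma strongly_embeddableI shows that an embedding into a group in the variety over
   any type whatsoever gives one over this type. *)
definition strongly_embeddable ::
  "nat \<Rightarrow> nat \<Rightarrow> ('a, 'x) monoid_scheme \<Rightarrow> ('b, 'y) monoid_scheme \<Rightarrow> ('d, 'z) monoid_scheme \<Rightarrow>
   ('d \<Rightarrow> 'a) \<Rightarrow> ('d \<Rightarrow> 'b) \<Rightarrow> bool" where
  "strongly_embeddable m n A B D \<iota>\<^sub>A \<iota>\<^sub>B \<longleftrightarrow>
     (\<exists>(M :: ('a + 'b) list monoid) \<phi>\<^sub>A \<phi>\<^sub>B. strong_embedding m n A B D \<iota>\<^sub>A \<iota>\<^sub>B M \<phi>\<^sub>A \<phi>\<^sub>B)"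

lemma in_variety_pullback:
  fixes G :: "('a, 'x) monoid_scheme" and H :: "('b, 'y) monoid_scheme"
  assumes G: "group G" and h: "h \<in> mon G H" and H: "in_variety m n H"
  shows "in_variety m n G"
proof -
  interpret G: group G by (rule G)
  interpret H: group H using H by (simp add: in_variety_def)
  have hom: "h \<in> hom G H" and inj: "inj_on h (carrier G)" using h by (auto simp: mon_def)
  interpret group_hom G H h
    using hom by (simp add: group_hom_def group_hom_axioms_def G.is_group H.is_group)
  have c: "commutator G x y \<in> carrier G" if "x \<in> carrier G" "y \<in> carrier G" for x y
    using that by (simp add: commutator_def)
  have hc: "h (commutator G x y) = commutator H (h x) (h y)"
    if "x \<in> carrier G" "y \<in> carrier G" for x y
    using that by (simp add: commutator_def)
  have one: "u = \<one>\<^bsub>G\<^esub>" if "u \<in> carrier G" "h u = \<one>\<^bsub>H\<^esub>" for u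
    using inj_onD[OF inj, of u "\<one>\<^bsub>G\<^esub>"] that by simp
  show ?thesis
    unfolding in_variety_def
  proof (intro conjI ballI)
    show "group G" by (rule G)
  next
    fix x assume "x \<in> carrier G"
    then show "x [^]\<^bsub>G\<^esub> m = \<one>\<^bsub>G\<^esub>"
      using H by (intro one) (auto simp: hom_nat_pow in_variety_def)
  next
    fix x y assume "x \<in> carrier G" "y \<in> carrier G"
    then show "commutator G x y [^]\<^bsub>G\<^esub> n = \<one>\<^bsub>G\<^esub>"
      using H by (intro one) (auto simp: hom_nat_pow in_variety_def c hc)
  next
    fix x y z assume "x \<in> carrier G" "y \<in> carrier G" "z \<in> carrier G"
    then show "commutator G (commutator G x y) z = \<one>\<^bsub>G\<^esub>"
      using H by (intro one) (auto simp: in_variety_def c hc)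
  qed
qed

lemma strongly_embeddableI:
  fixes A :: "('a, 'x) monoid_scheme" and B :: "('b, 'y) monoid_scheme"
    and D :: "('d, 'z) monoid_scheme" and M :: "('c, 'w) monoid_scheme"
  assumes am: "amalgam m n A B D \<iota>\<^sub>A \<iota>\<^sub>B"
    and emb: "strong_embedding m n A B D \<iota>\<^sub>A \<iota>\<^sub>B M \<phi>\<^sub>A \<phi>\<^sub>B"
  shows "strongly_embeddable m n A B D \<iota>\<^sub>A \<iota>\<^sub>B"
proof -
  have var: "in_variety m n M" and lA: "\<phi>\<^sub>A \<in> mon A M" and lB: "\<phi>\<^sub>B \<in> mon B M"
    and agree: "\<And>d. d \<in> carrier D \<Longrightarrow> \<phi>\<^sub>A (\<iota>\<^sub>A d) = \<phi>\<^sub>B (\<iota>\<^sub>B d)"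
    and int: "\<phi>\<^sub>A ` carrier A \<inter> \<phi>\<^sub>B ` carrier B = \<phi>\<^sub>A ` \<iota>\<^sub>A ` carrier D"
    using emb by (auto simp: strong_embedding_def)
  have iA: "\<iota>\<^sub>A d \<in> carrier A" if "d \<in> carrier D" for d
    using that am by (auto simp: amalgam_def mon_def hom_def)
  have grA: "group A" and grB: "group B"
    using am by (auto simp: amalgam_def in_variety_def)
  interpret M: group M using var by (simp add: in_variety_def)
  interpret A: group_hom A M \<phi>\<^sub>A
    using grA lA M.is_group by (auto simp: group_hom_def group_hom_axioms_def mon_def)
  interpret B: group_hom B M \<phi>\<^sub>B
    using grB lB M.is_group by (auto simp: group_hom_def group_hom_axioms_def mon_def)
  define W where "W = lists (carrier A <+> carrier B)"
  define s where "s = (\<lambda>u. case u of Inl a \<Rightarrow> \<phi>\<^sub>A a | Inr b \<Rightarrow> \<phi>\<^sub>B b)"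
  define f where "f = (\<lambda>w. foldr (\<lambda>u x. s u \<otimes>\<^bsub>M\<^esub> x) w \<one>\<^bsub>M\<^esub>)"
  have s: "s u \<in> carrier M" if "u \<in> carrier A <+> carrier B" for u
    using that by (auto simp: s_def)
  have f: "f w \<in> carrier M" if "w \<in> W" for w
    using that unfolding W_def by (induction w) (auto simp: f_def s)
  have fapp: "f (v @ w) = f v \<otimes>\<^bsub>M\<^esub> f w" if "v \<in> W" "w \<in> W" for v w
    using that(1) unfolding W_def
  proof (induction v)
    case Nil
    then show ?case using f[OF that(2)] by (simp add: f_def)
  next
    case (Cons u v)
    have e: "f (u # x) = s u \<otimes>\<^bsub>M\<^esub> f x" for x by (simp add: f_def)
    from Cons show ?case using s[of u] f[of v] f[OF that(2)]
      by (simp add: e M.m_assoc W_def)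
  qed
  have finv: "\<exists>v\<in>W. f v = inv\<^bsub>M\<^esub> f w" if "w \<in> W" for w
    using that unfolding W_def
  proof (induction w)
    case Nil
    show ?case by (rule bexI[of _ "[]"]) (auto simp: f_def)
  next
    case (Cons u w)
    then obtain v where v: "v \<in> W" "f v = inv\<^bsub>M\<^esub> f w" by (auto simp: W_def)
    obtain u' where u': "u' \<in> carrier A <+> carrier B" "s u' = inv\<^bsub>M\<^esub> s u"
    proof (cases u)
      case (Inl a)
      then have "a \<in> carrier A" using Cons by auto
      then show thesis using that[of "Inl (inv\<^bsub>A\<^esub> a)"] Inl by (auto simp: s_def)
    next
      case (Inr b)
      then have "b \<in> carrier B" using Cons by auto
      then show thesis using that[of "Inr (inv\<^bsub>B\<^esub> b)"] Inr by (auto simp: s_def)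
    qed
    have u'W: "[u'] \<in> W" using u' by (auto simp: W_def)
    have uw: "u \<in> carrier A <+> carrier B" "w \<in> W" using Cons by (auto simp: W_def)
    have "f (v @ [u']) = inv\<^bsub>M\<^esub> f w \<otimes>\<^bsub>M\<^esub> inv\<^bsub>M\<^esub> s u"
      using fapp[OF v(1) u'W] v u' s[OF u'(1)] s[OF uw(1)] by (simp add: f_def)
    also have "\<dots> = inv\<^bsub>M\<^esub> f (u # w)"
      using M.inv_mult_group[OF s[OF uw(1)] f[OF uw(2)]] by (simp add: f_def)
    finally show ?case using v(1) u'W by (intro bexI[of _ "v @ [u']"]) (auto simp: W_def)
  qed
  define H where "H = f ` W"
  have "subgroup H M"
  proof
    show "H \<subseteq> carrier M" using f by (auto simp: H_def)
    show "\<one>\<^bsub>M\<^esub> \<in> H" unfolding H_def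
      by (rule image_eqI[of _ _ "[]"]) (auto simp: f_def W_def)
  next
    fix x y assume "x \<in> H" "y \<in> H"
    then obtain v w where "v \<in> W" "w \<in> W" "x = f v" "y = f w" by (auto simp: H_def)
    then show "x \<otimes>\<^bsub>M\<^esub> y \<in> H" unfolding H_def
      by (intro image_eqI[of _ _ "v @ w"]) (auto simp: fapp W_def)
  next
    fix x assume "x \<in> H"
    then obtain w where w: "w \<in> W" "x = f w" by (auto simp: H_def)
    from finv[OF w(1)] obtain v where "v \<in> W" "f v = inv\<^bsub>M\<^esub> x" using w(2) by auto
    then show "inv\<^bsub>M\<^esub> x \<in> H" unfolding H_def by (metis imageI)
  qed
  define g where "g = inv_into W f"
  have fg: "f (g x) = x" if "x \<in> H" for x
    using that by (simp add: g_def H_def f_inv_into_f)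
  have ginj: "inj_on g H" by (rule inj_on_inverseI[of H f g]) (rule fg)
  define N :: "('a + 'b) list monoid" where
    "N = \<lparr>carrier = g ` H, mult = (\<lambda>x y. g (f x \<otimes>\<^bsub>M\<^esub> f y)), one = g \<one>\<^bsub>M\<^esub>\<rparr>"
  note sub = \<open>subgroup H M\<close>
  note HM = subgroup.mem_carrier[OF sub]
  have N: "group N"
  proof (rule groupI)
    fix x y assume "x \<in> carrier N" "y \<in> carrier N"
    then show "x \<otimes>\<^bsub>N\<^esub> y \<in> carrier N"
      by (auto simp: N_def fg subgroup.m_closed[OF sub])
  next
    show "\<one>\<^bsub>N\<^esub> \<in> carrier N" by (simp add: N_def subgroup.one_closed[OF sub])
  next
    fix x y z assume "x \<in> carrier N" "y \<in> carrier N" "z \<in> carrier N"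
    then show "x \<otimes>\<^bsub>N\<^esub> y \<otimes>\<^bsub>N\<^esub> z = x \<otimes>\<^bsub>N\<^esub> (y \<otimes>\<^bsub>N\<^esub> z)"
      by (auto simp: N_def fg subgroup.m_closed[OF sub] HM M.m_assoc)
  next
    fix x assume "x \<in> carrier N"
    then show "\<one>\<^bsub>N\<^esub> \<otimes>\<^bsub>N\<^esub> x = x"
      by (auto simp: N_def fg subgroup.one_closed[OF sub] HM)
  next
    fix x assume "x \<in> carrier N"
    then obtain h where h: "h \<in> H" "x = g h" by (auto simp: N_def)
    then show "\<exists>y\<in>carrier N. y \<otimes>\<^bsub>N\<^esub> x = \<one>\<^bsub>N\<^esub>"
      by (intro bexI[of _ "g (inv\<^bsub>M\<^esub> h)"])
        (auto simp: N_def fg subgroup.m_inv_closed[OF sub] HM)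
  qed
  have fmon: "f \<in> mon N M"
    by (auto simp: mon_def hom_def N_def fg subgroup.m_closed[OF sub] HM inj_on_def)
  have AH: "\<phi>\<^sub>A a \<in> H" if "a \<in> carrier A" for a
    unfolding H_def using that
    by (intro image_eqI[of _ _ "[Inl a]"]) (auto simp: f_def s_def W_def)
  have BH: "\<phi>\<^sub>B b \<in> H" if "b \<in> carrier B" for b
    unfolding H_def using that
    by (intro image_eqI[of _ _ "[Inr b]"]) (auto simp: f_def s_def W_def)
  have gA: "g \<circ> \<phi>\<^sub>A \<in> mon A N"
    using lA ginj by (auto simp: mon_def hom_def N_def AH fg inj_on_def)
  have gB: "g \<circ> \<phi>\<^sub>B \<in> mon B N"
    using lB ginj by (auto simp: mon_def hom_def N_def BH fg inj_on_def)
  have "(g \<circ> \<phi>\<^sub>A) ` carrier A \<inter> (g \<circ> \<phi>\<^sub>B) ` carrier B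
      = g ` (\<phi>\<^sub>A ` carrier A \<inter> \<phi>\<^sub>B ` carrier B)"
    using inj_on_image_Int[OF ginj, of "\<phi>\<^sub>A ` carrier A" "\<phi>\<^sub>B ` carrier B"] AH BH
    by (auto simp: image_comp)
  also have "\<dots> = (g \<circ> \<phi>\<^sub>A) ` \<iota>\<^sub>A ` carrier D" by (simp add: int image_comp)
  finally have "strong_embedding m n A B D \<iota>\<^sub>A \<iota>\<^sub>B N (g \<circ> \<phi>\<^sub>A) (g \<circ> \<phi>\<^sub>B)"
    using in_variety_pullback[OF N fmon var] gA gB agree
    by (simp add: strong_embedding_def)
  then show ?thesis unfolding strongly_embeddable_def by blast
qed

end

theory Submission
  imports Defs "HOL-Algebra.Free_Abelian_Groups" "HOL-Algebra.SndIsomorphismGrp"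
begin

text \<open>
  In a group \<open>M\<close> of the variety the commutator is bilinear and \<open>M\<^sup>n M'\<close> is central, which gives
  necessity: \<open>[a\<^sup>q a', b] = [a, b]\<^sup>q = [a, b\<^sup>q b']\<close>.

  For sufficiency put \<open>X = A/A\<^sup>n A'\<close>, \<open>Y = B/B\<^sup>n B'\<close>, and let \<open>W\<close> be the product of \<open>A\<^sup>n A'\<close> and
  \<open>B\<^sup>n B'\<close> amalgamated over \<open>D\<close>. Commutators with \<open>D\<close> give pairings \<open>X \<times> D \<rightarrow> W\<close> and
  \<open>D \<times> Y \<rightarrow> W\<close>, and a group containing \<open>A\<close> and \<open>B\<close> needs a bilinear map \<open>\<beta>\<close> on \<open>X \<times> Y\<close>, with
  values in some \<open>V\<close> containing \<open>W\<close>, that extends both. The universal \<open>V\<close> is a quotient of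
  \<open>W \<oplus> (X \<otimes> Y)\<close>, and \<open>W\<close> embeds in it unless some relation between elements \<open>x \<otimes> d\<close> and
  \<open>d \<otimes> y\<close> of \<open>X \<otimes> Y\<close> is violated in \<open>W\<close>. Such a relation is given by an integer matrix;
  diagonalising it reduces the claim to relations \<open>x\<^sup>q \<otimes> y = x \<otimes> y\<^sup>q\<close>, which is condition (b)
  for \<open>q \<noteq> 0\<close> and condition (a) for \<open>q = 0\<close>. Finally \<open>A \<times> B \<times> V\<close>, with \<open>\<beta>\<close> as cocycle, becomes the
  required group once \<open>A\<^sup>n A'\<close> and \<open>B\<^sup>n B'\<close> are identified with their images in \<open>V\<close>: the quotient
  of the two images of an element of \<open>D\<close> is then central, so that it can be factored out.
\<close>

section \<open>Products, cosets and bihomomorphisms\<close>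

lemma group_homI: "group G \<Longrightarrow> group H \<Longrightarrow> h \<in> hom G H \<Longrightarrow> group_hom G H h"
  by (simp add: group_hom_def group_hom_axioms_def)

lemma hom_finprod:
  assumes "comm_group G" "comm_group H" and h: "h \<in> hom G H" and f: "f \<in> I \<rightarrow> carrier G"
  shows "h (finprod G f I) = finprod H (\<lambda>i. h (f i)) I"
proof -
  interpret G: comm_group G by fact
  interpret H: comm_group H by fact
  interpret group_hom G H h by unfold_locales (rule h)
  show ?thesis
    using f by (induction I rule: infinite_finite_induct) (auto simp: Pi_iff)
qed

lemma (in comm_group) finprod_int_pow:
  assumes "f \<in> I \<rightarrow> carrier G"
  shows "finprod G f I [^] (k::int) = (\<Otimes>i\<in>I. f i [^] k)"
proof -
  have "(\<lambda>x. x [^] k) \<in> hom G G" by (auto simp: hom_def int_pow_distrib)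
  then show ?thesis using hom_finprod[of G G "\<lambda>x. x [^] k"] assms comm_group_axioms by blast
qed

lemma (in comm_group) finprod_inv:
  assumes "f \<in> I \<rightarrow> carrier G"
  shows "inv (finprod G f I) = (\<Otimes>i\<in>I. inv (f i))"
proof -
  have "(\<lambda>x. inv x) \<in> hom G G" by (auto simp: hom_def inv_mult)
  then show ?thesis using hom_finprod[of G G "\<lambda>x. inv x"] assms comm_group_axioms by blast
qed

lemma (in comm_group) finprod_int_pow_diff_mult:
  assumes "x \<in> I \<rightarrow> carrier G"
  shows "(\<Otimes>i\<in>I. x i [^] (k i - s * l i))
    = (\<Otimes>i\<in>I. x i [^] k i) \<otimes> (\<Otimes>i\<in>I. x i [^] l i) [^] (- s :: int)"
proof -
  have "(\<Otimes>i\<in>I. x i [^] (k i - s * l i)) = (\<Otimes>i\<in>I. x i [^] k i \<otimes> (x i [^] l i) [^] (- s))"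
    using assms by (intro finprod_cong')
      (auto simp: int_pow_pow mult.commute Pi_iff simp flip: int_pow_mult)
  also have "\<dots> = (\<Otimes>i\<in>I. x i [^] k i) \<otimes> (\<Otimes>i\<in>I. (x i [^] l i) [^] (- s))"
    using assms by (intro finprod_multf) auto
  also have "(\<Otimes>i\<in>I. (x i [^] l i) [^] (- s)) = (\<Otimes>i\<in>I. x i [^] l i) [^] (- s)"
    using assms by (intro finprod_int_pow[symmetric]) auto
  finally show ?thesis .
qed

lemma (in comm_monoid) finprod_remove:
  assumes "finite I" "i \<in> I" "f \<in> I \<rightarrow> carrier G"
  shows "finprod G f I = f i \<otimes> finprod G f (I - {i})"
  using finprod_insert[of "I - {i}" i f] assms by (auto simp: insert_absorb)

lemma (in comm_monoid) finprod_cong_pair: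
  assumes I: "finite I" "i \<in> I" "j \<in> I" "i \<noteq> j"
    and fg: "f \<in> I \<rightarrow> carrier G" "g \<in> I \<rightarrow> carrier G"
    and pair: "f i \<otimes> f j = g i \<otimes> g j" and rest: "\<And>k. k \<in> I - {i, j} \<Longrightarrow> f k = g k"
  shows "finprod G f I = finprod G g I"
proof -
  have split: "finprod G h I = h i \<otimes> h j \<otimes> finprod G h (I - {i} - {j})"
    if h: "h \<in> I \<rightarrow> carrier G" for h
  proof -
    have "finprod G h I = h i \<otimes> (h j \<otimes> finprod G h (I - {i} - {j}))"
      using I h by (simp only: finprod_remove[of I i h] finprod_remove[of "I - {i}" j h])
         (subst finprod_remove[of "I - {i}" j h], auto)
    moreover have "h i \<in> carrier G" "h j \<in> carrier G" "finprod G h (I - {i} - {j}) \<in> carrier G"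
      using I h by (auto intro!: finprod_closed)
    ultimately show ?thesis by (simp only: m_assoc)
  qed
  have "finprod G f (I - {i} - {j}) = finprod G g (I - {i} - {j})"
    using fg rest by (intro finprod_cong') auto
  then show ?thesis using fg pair by (simp only: split)
qed

lemma (in comm_monoid) gfinprod_eq_finprod_superset:
  assumes "finite S" "S \<subseteq> A" "\<And>i. i \<in> A - S \<Longrightarrow> f i = \<one>" "f \<in> A \<rightarrow> carrier G"
  shows "gfinprod G f A = finprod G f S"
proof -
  have "gfinprod G f A = gfinprod G f S"
    using assms by (intro gfinprod_mono_neutral_cong_right) auto
  also have "\<dots> = finprod G f S" using assms by (intro gfinprod_eq_finprod) auto
  finally show ?thesis .
qed

lemma (in comm_group) image_subset_hom_group_sum:
  assumes hom: "\<And>i. i \<in> I \<Longrightarrow> f i \<in> hom (A i) G" and grp: "\<And>i. i \<in> I \<Longrightarrow> group (A i)"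
    and i: "i \<in> I"
  shows "f i ` carrier (A i) \<subseteq> (\<lambda>x. gfinprod G (\<lambda>i. f i (x i)) I) ` carrier (sum_group I A)"
proof (rule image_subsetI)
  fix a assume a: "a \<in> carrier (A i)"
  define x where "x = (\<lambda>k\<in>I. if k = i then a else \<one>\<^bsub>A k\<^esub>)"
  have fin: "finite {k \<in> I. x k \<noteq> \<one>\<^bsub>A k\<^esub>}"
    by (rule finite_subset[of _ "{i}"]) (auto simp: x_def)
  have mem: "x k \<in> carrier (A k)" if "k \<in> I" for k
    using that a grp by (simp add: x_def group.is_monoid)
  then have x: "x \<in> carrier (sum_group I A)"
    using fin grp by (auto simp: carrier_sum_group x_def)
  have "gfinprod G (\<lambda>k. f k (x k)) I = gfinprod G (\<lambda>k. f k (x k)) {i}"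
  proof (rule gfinprod_mono_neutral_cong_right)
    show "(\<lambda>k. f k (x k)) \<in> I \<rightarrow> carrier G" using hom_in_carrier[OF hom mem] by blast
    show "f k (x k) = \<one>" if "k \<in> I - {i}" for k
      using that hom_one[OF hom grp is_group] by (simp add: x_def)
  qed (use i in auto)
  also have "\<dots> = f i a" using a i hom_in_carrier[OF hom[OF i]] by (simp add: x_def)
  finally show "f i a \<in> (\<lambda>x. gfinprod G (\<lambda>i. f i (x i)) I) ` carrier (sum_group I A)"
    using x by (intro image_eqI[of _ _ x]) simp_all
qed

lemma (in normal) coset_eq_self_iff:
  assumes "x \<in> carrier G"
  shows "H #> x = H \<longleftrightarrow> x \<in> H"
  using coset_join1[OF _ assms subgroup_axioms] coset_join2[OF assms subgroup_axioms] by metis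

lemma (in normal) coset_mult_absorb:
  assumes "h \<in> H" "x \<in> carrier G"
  shows "H #> (h \<otimes> x) = H #> x"
  using repr_independence[OF rcosI[OF assms(1) subset assms(2)] assms(2) subgroup_axioms] by simp

lemma comm_group_DirProd:
  assumes "comm_group G" "comm_group H"
  shows "comm_group (G \<times>\<times> H)"
proof -
  interpret G: comm_group G by fact
  interpret H: comm_group H by fact
  show ?thesis
    by (rule group.group_comm_groupI)
      (auto simp: DirProd_group G.is_group H.is_group G.m_comm H.m_comm)
qed

lemma comm_group_product_group:
  assumes "\<And>i. i \<in> I \<Longrightarrow> comm_group (G i)"
  shows "comm_group (product_group I G)"
proof (rule group.group_comm_groupI)
  show "group (product_group I G)" using assms by (simp add: comm_group.axioms)
  fix f g assume "f \<in> carrier (product_group I G)" "g \<in> carrier (product_group I G)"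
  then show "f \<otimes>\<^bsub>product_group I G\<^esub> g = g \<otimes>\<^bsub>product_group I G\<^esub> f"
    using assms by (auto simp: comm_groupE(4) PiE_iff intro!: restrict_ext)
qed

lemma pow_DirProd: "(g, h) [^]\<^bsub>G \<times>\<times> H\<^esub> (k::nat) = (g [^]\<^bsub>G\<^esub> k, h [^]\<^bsub>H\<^esub> k)"
  by (induction k) auto

lemma pow_product_group:
  "f [^]\<^bsub>product_group I G\<^esub> (k::nat) = (\<lambda>i\<in>I. f i [^]\<^bsub>G i\<^esub> k)"
  by (induction k) (auto intro!: restrict_ext)

locale bihom = G: group G + H: group H + V: comm_group V
  for G :: "('g, 'gs) monoid_scheme" and H :: "('h, 'hs) monoid_scheme"
    and V :: "('v, 'vs) monoid_scheme" +
  fixes \<beta> :: "'g \<Rightarrow> 'h \<Rightarrow> 'v"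
  assumes hom_left: "\<And>y. y \<in> carrier H \<Longrightarrow> (\<lambda>x. \<beta> x y) \<in> hom G V"
    and hom_right: "\<And>x. x \<in> carrier G \<Longrightarrow> \<beta> x \<in> hom H V"
begin

lemma group_hom_left: "y \<in> carrier H \<Longrightarrow> group_hom G V (\<lambda>x. \<beta> x y)"
  by unfold_locales (rule hom_left)

lemma group_hom_right: "x \<in> carrier G \<Longrightarrow> group_hom H V (\<beta> x)"
  by unfold_locales (rule hom_right)

lemma closed [simp]: "x \<in> carrier G \<Longrightarrow> y \<in> carrier H \<Longrightarrow> \<beta> x y \<in> carrier V"
  using hom_in_carrier[OF hom_right] .

lemma mult_left:
  "x \<in> carrier G \<Longrightarrow> x' \<in> carrier G \<Longrightarrow> y \<in> carrier H \<Longrightarrow> \<beta> (x \<otimes>\<^bsub>G\<^esub> x') y = \<beta> x y \<otimes>\<^bsub>V\<^esub> \<beta> x' y"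
  using hom_mult[OF hom_left] .

lemma mult_right:
  "x \<in> carrier G \<Longrightarrow> y \<in> carrier H \<Longrightarrow> y' \<in> carrier H \<Longrightarrow> \<beta> x (y \<otimes>\<^bsub>H\<^esub> y') = \<beta> x y \<otimes>\<^bsub>V\<^esub> \<beta> x y'"
  using hom_mult[OF hom_right] .

lemma one_left [simp]: "y \<in> carrier H \<Longrightarrow> \<beta> \<one>\<^bsub>G\<^esub> y = \<one>\<^bsub>V\<^esub>"
  using group_hom.hom_one[OF group_hom_left] .

lemma one_right [simp]: "x \<in> carrier G \<Longrightarrow> \<beta> x \<one>\<^bsub>H\<^esub> = \<one>\<^bsub>V\<^esub>"
  using group_hom.hom_one[OF group_hom_right] .

lemma inv_left: "x \<in> carrier G \<Longrightarrow> y \<in> carrier H \<Longrightarrow> \<beta> (inv\<^bsub>G\<^esub> x) y = inv\<^bsub>V\<^esub> \<beta> x y"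
  using group_hom.hom_inv[OF group_hom_left] .

lemma inv_right: "x \<in> carrier G \<Longrightarrow> y \<in> carrier H \<Longrightarrow> \<beta> x (inv\<^bsub>H\<^esub> y) = inv\<^bsub>V\<^esub> \<beta> x y"
  using group_hom.hom_inv[OF group_hom_right] .

lemma pow_left: "x \<in> carrier G \<Longrightarrow> y \<in> carrier H \<Longrightarrow> \<beta> (x [^]\<^bsub>G\<^esub> (k::nat)) y = \<beta> x y [^]\<^bsub>V\<^esub> k"
  using group_hom.hom_nat_pow[OF group_hom_left] .

lemma pow_right: "x \<in> carrier G \<Longrightarrow> y \<in> carrier H \<Longrightarrow> \<beta> x (y [^]\<^bsub>H\<^esub> (k::nat)) = \<beta> x y [^]\<^bsub>V\<^esub> k"
  using group_hom.hom_nat_pow[OF group_hom_right] .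

lemma int_pow_left: "x \<in> carrier G \<Longrightarrow> y \<in> carrier H \<Longrightarrow> \<beta> (x [^]\<^bsub>G\<^esub> (k::int)) y = \<beta> x y [^]\<^bsub>V\<^esub> k"
  using group_hom.hom_int_pow[OF group_hom_left] .

lemma int_pow_right: "x \<in> carrier G \<Longrightarrow> y \<in> carrier H \<Longrightarrow> \<beta> x (y [^]\<^bsub>H\<^esub> (k::int)) = \<beta> x y [^]\<^bsub>V\<^esub> k"
  using group_hom.hom_int_pow[OF group_hom_right] .

lemma shear:
  fixes s :: int
  assumes "x \<in> carrier G" "x' \<in> carrier G" "y \<in> carrier H" "y' \<in> carrier H"
  shows "\<beta> x (y \<otimes>\<^bsub>H\<^esub> y' [^]\<^bsub>H\<^esub> s) \<otimes>\<^bsub>V\<^esub> \<beta> (x' \<otimes>\<^bsub>G\<^esub> x [^]\<^bsub>G\<^esub> (- s)) y'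
    = \<beta> x y \<otimes>\<^bsub>V\<^esub> \<beta> x' y'"
proof -
  have "\<beta> x (y \<otimes>\<^bsub>H\<^esub> y' [^]\<^bsub>H\<^esub> s) \<otimes>\<^bsub>V\<^esub> \<beta> (x' \<otimes>\<^bsub>G\<^esub> x [^]\<^bsub>G\<^esub> (- s)) y'
    = \<beta> x y \<otimes>\<^bsub>V\<^esub> \<beta> x' y' \<otimes>\<^bsub>V\<^esub> (\<beta> x y' [^]\<^bsub>V\<^esub> s \<otimes>\<^bsub>V\<^esub> \<beta> x y' [^]\<^bsub>V\<^esub> (- s))"
    using assms by (simp add: mult_left mult_right int_pow_left int_pow_right V.m_ac)
  also have "\<beta> x y' [^]\<^bsub>V\<^esub> s \<otimes>\<^bsub>V\<^esub> \<beta> x y' [^]\<^bsub>V\<^esub> (- s) = \<one>\<^bsub>V\<^esub>"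
    using assms by (simp flip: V.int_pow_mult)
  finally show ?thesis using assms by simp
qed

lemma flip: "bihom H G V (\<lambda>y x. \<beta> x y)"
  by unfold_locales (fact hom_right hom_left)+

lemma comp:
  assumes "group G'" "group H'" "comm_group V'"
    and f: "f \<in> hom G' G" and g: "g \<in> hom H' H" and h: "h \<in> hom V V'"
  shows "bihom G' H' V' (\<lambda>x y. h (\<beta> (f x) (g y)))"
proof -
  have "(\<lambda>x. h (\<beta> (f x) (g y))) \<in> hom G' V'" if "y \<in> carrier H'" for y
    using hom_compose[OF hom_compose[OF f hom_left[OF hom_in_carrier[OF g that]]] h]
    by (simp add: comp_def)
  moreover have "(\<lambda>y. h (\<beta> (f x) (g y))) \<in> hom H' V'" if "x \<in> carrier G'" for x
    using hom_compose[OF hom_compose[OF g hom_right[OF hom_in_carrier[OF f that]]] h]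
    by (simp add: comp_def)
  ultimately show ?thesis
    using assms by (intro bihom.intro bihom_axioms.intro)
qed

end

section \<open>Diagonalising integer matrices\<close>

definition subtract_row :: "int \<Rightarrow> 'i \<Rightarrow> 'i \<Rightarrow> ('i \<Rightarrow> 'j \<Rightarrow> int) \<Rightarrow> 'i \<Rightarrow> 'j \<Rightarrow> int" where
  "subtract_row s i k Q = Q(k := \<lambda>j. Q k j - s * Q i j)"

definition subtract_column :: "int \<Rightarrow> 'j \<Rightarrow> 'j \<Rightarrow> ('i \<Rightarrow> 'j \<Rightarrow> int) \<Rightarrow> 'i \<Rightarrow> 'j \<Rightarrow> int" where
  "subtract_column s j l Q = (\<lambda>i. (Q i)(l := Q i l - s * Q i j))"

lemma subtract_row_transpose:
  "(\<lambda>j i. subtract_row s i' k Q i j) = subtract_column s i' k (\<lambda>j i. Q i j)"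
  by (auto simp: subtract_row_def subtract_column_def fun_eq_iff)

definition off_pivot :: "'i set \<Rightarrow> 'j set \<Rightarrow> ('i \<Rightarrow> 'j \<Rightarrow> int) \<Rightarrow> 'i \<Rightarrow> 'j \<Rightarrow> nat" where
  "off_pivot I J Q i j = card {l \<in> J - {j}. Q i l \<noteq> 0} + card {k \<in> I - {i}. Q k j \<noteq> 0}"

lemma off_pivot_transpose: "off_pivot J I (\<lambda>j i. Q i j) j i = off_pivot I J Q i j"
  by (simp add: off_pivot_def)

definition pivot_order :: "'i set \<Rightarrow> 'j set \<Rightarrow> (('i \<Rightarrow> 'j \<Rightarrow> int) \<times> 'i \<times> 'j) rel" where
  "pivot_order I J = measures [\<lambda>(Q, i, j). nat \<bar>Q i j\<bar>, \<lambda>(Q, i, j). off_pivot I J Q i j]"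

lemma pivot_order_transpose:
  "((\<lambda>j i. Q i j, j, i), (\<lambda>j i. R i j, l, k)) \<in> pivot_order J I \<longleftrightarrow>
   ((Q, i, j), (R, k, l)) \<in> pivot_order I J"
  by (simp add: pivot_order_def off_pivot_transpose[of J I])

lemma subtract_column_descent:
  fixes Q :: "'i \<Rightarrow> 'j \<Rightarrow> int"
  assumes "finite J" "j \<in> J" "l \<in> J - {j}" "Q i j \<noteq> 0" "Q i l \<noteq> 0"
  defines "R \<equiv> subtract_column (Q i l div Q i j) j l Q"
  shows "\<exists>l'\<in>J. R i l' \<noteq> 0 \<and> ((R, i, l'), (Q, i, j)) \<in> pivot_order I J"
proof (cases "Q i l mod Q i j = 0")
  case True
  have R: "R i l = 0" "\<And>k. R k j = Q k j" "\<And>l'. l' \<noteq> l \<Longrightarrow> R i l' = Q i l'"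
    using assms(3) True by (auto simp: R_def subtract_column_def minus_div_mult_eq_mod)
  have "{l' \<in> J - {j}. R i l' \<noteq> 0} \<subset> {l' \<in> J - {j}. Q i l' \<noteq> 0}"
  proof
    show "{l' \<in> J - {j}. R i l' \<noteq> 0} \<subseteq> {l' \<in> J - {j}. Q i l' \<noteq> 0}"
      using R(1,3) by (intro Collect_mono impI) (metis (full_types))
    show "{l' \<in> J - {j}. R i l' \<noteq> 0} \<noteq> {l' \<in> J - {j}. Q i l' \<noteq> 0}"
      using assms(3,5) R(1) by blast
  qed
  then have "off_pivot I J R i j < off_pivot I J Q i j"
    using assms(1) R(2) by (simp add: off_pivot_def psubset_card_mono)
  then show ?thesis using assms(2,4) R(2) by (intro bexI[of _ j]) (simp_all add: pivot_order_def)
next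
  case False
  have "R i l = Q i l mod Q i j"
    by (simp add: R_def subtract_column_def minus_div_mult_eq_mod)
  then show ?thesis
    using assms(3,4) False abs_mod_less[of "Q i j" "Q i l"]
    by (intro bexI[of _ l]) (simp_all add: pivot_order_def)
qed

lemma subtract_row_descent:
  fixes Q :: "'i \<Rightarrow> 'j \<Rightarrow> int"
  assumes "finite I" "i \<in> I" "k \<in> I - {i}" "Q i j \<noteq> 0" "Q k j \<noteq> 0"
  defines "R \<equiv> subtract_row (Q k j div Q i j) i k Q"
  shows "\<exists>k'\<in>I. R k' j \<noteq> 0 \<and> ((R, k', j), (Q, i, j)) \<in> pivot_order I J"
proof -
  have transpose: "subtract_column (Q k j div Q i j) i k (\<lambda>j i. Q i j) = (\<lambda>j i. R i j)"
    unfolding R_def subtract_row_transpose ..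
  obtain k' where k': "k' \<in> I" "R k' j \<noteq> 0"
    and descent: "((\<lambda>j i. R i j, j, k'), (\<lambda>j i. Q i j, j, i)) \<in> pivot_order J I"
    using subtract_column_descent[of I i k "\<lambda>j i. Q i j" j J] assms(1-5)
    unfolding transpose by blast
  show ?thesis using k' descent[THEN iffD1[OF pivot_order_transpose]] by blast
qed

text \<open>Euclidean division by the pivot either clears another entry of its row or column or produces
  a smaller pivot.\<close>

lemma pivot_induct [consumes 5, case_names cleared row column]:
  fixes Q :: "'i \<Rightarrow> 'j \<Rightarrow> int"
  assumes "finite I" "finite J" "i \<in> I" "j \<in> J" "Q i j \<noteq> 0"
    and cleared: "\<And>Q i j. i \<in> I \<Longrightarrow> j \<in> J \<Longrightarrow> (\<And>l. l \<in> J - {j} \<Longrightarrow> Q i l = 0) \<Longrightarrow>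
      (\<And>k. k \<in> I - {i} \<Longrightarrow> Q k j = 0) \<Longrightarrow> P Q"
    and row: "\<And>Q i k s. i \<in> I \<Longrightarrow> k \<in> I \<Longrightarrow> i \<noteq> k \<Longrightarrow> P (subtract_row s i k Q) \<Longrightarrow> P Q"
    and column: "\<And>Q j l s. j \<in> J \<Longrightarrow> l \<in> J \<Longrightarrow> j \<noteq> l \<Longrightarrow> P (subtract_column s j l Q) \<Longrightarrow> P Q"
  shows "P Q"
proof -
  have "wf (pivot_order I J)" by (simp add: pivot_order_def)
  then show ?thesis
    using assms(3-5)
  proof (induction "(Q, i, j)" arbitrary: Q i j rule: wf_induct_rule)
    case (less Q i j)
    consider (in_row) l where "l \<in> J - {j}" "Q i l \<noteq> 0"
      | (in_column) k where "k \<in> I - {i}" "Q k j \<noteq> 0"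
      | (none) "\<And>l. l \<in> J - {j} \<Longrightarrow> Q i l = 0" "\<And>k. k \<in> I - {i} \<Longrightarrow> Q k j = 0" by blast
    then show ?case
    proof cases
      case in_row
      let ?R = "subtract_column (Q i l div Q i j) j l Q"
      obtain l' where "l' \<in> J" "?R i l' \<noteq> 0" "((?R, i, l'), (Q, i, j)) \<in> pivot_order I J"
        using subtract_column_descent[of J j l Q i I] assms(2) less.prems in_row by blast
      then have "P ?R" using less.hyps less.prems(1) by blast
      then show ?thesis using column[of j l] less.prems in_row by blast
    next
      case in_column
      let ?R = "subtract_row (Q k j div Q i j) i k Q"
      obtain k' where "k' \<in> I" "?R k' j \<noteq> 0" "((?R, k', j), (Q, i, j)) \<in> pivot_order I J"
        using subtract_row_descent[of I i k Q j J] assms(1) less.prems in_column by blast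
      then have "P ?R" using less.hyps less.prems(2) by blast
      then show ?thesis using row[of i k] less.prems in_column by blast
    next
      case none
      then show ?thesis using cleared less.prems by blast
    qed
  qed
qed

lemma diagonalisation_induct [consumes 2, case_names zero pivot row column]:
  fixes Q :: "'i \<Rightarrow> 'j \<Rightarrow> int"
  assumes "finite I" "finite J"
    and zero: "\<And>I J Q. finite I \<Longrightarrow> finite J \<Longrightarrow> (\<And>i j. i \<in> I \<Longrightarrow> j \<in> J \<Longrightarrow> Q i j = 0) \<Longrightarrow> P I J Q"
    and pivot: "\<And>I J Q i j. finite I \<Longrightarrow> finite J \<Longrightarrow> i \<in> I \<Longrightarrow> j \<in> J \<Longrightarrow>
      (\<And>l. l \<in> J - {j} \<Longrightarrow> Q i l = 0) \<Longrightarrow> (\<And>k. k \<in> I - {i} \<Longrightarrow> Q k j = 0) \<Longrightarrow>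
      P (I - {i}) (J - {j}) Q \<Longrightarrow> P I J Q"
    and subtract_row: "\<And>I J Q i k s. finite I \<Longrightarrow> finite J \<Longrightarrow> i \<in> I \<Longrightarrow> k \<in> I \<Longrightarrow> i \<noteq> k \<Longrightarrow>
      P I J (subtract_row s i k Q) \<Longrightarrow> P I J Q"
    and subtract_column: "\<And>I J Q j l s. finite I \<Longrightarrow> finite J \<Longrightarrow> j \<in> J \<Longrightarrow> l \<in> J \<Longrightarrow> j \<noteq> l \<Longrightarrow>
      P I J (subtract_column s j l Q) \<Longrightarrow> P I J Q"
  shows "P I J Q"
  using assms(1,2)
proof (induction "card I" arbitrary: I J Q rule: less_induct)
  case (less I J Q)
  show ?case
  proof (cases "\<exists>i\<in>I. \<exists>j\<in>J. Q i j \<noteq> 0")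
    case False
    then show ?thesis using less.prems by (intro zero) auto
  next
    case True
    then obtain i j where "i \<in> I" "j \<in> J" "Q i j \<noteq> 0" by blast
    with less.prems show ?thesis
    proof (induction Q rule: pivot_induct)
      case (cleared Q i j)
      have "card (I - {i}) < card I" using less.prems(1) cleared(1) by (rule card_Diff1_less)
      then have "P (I - {i}) (J - {j}) Q" using less.prems by (intro less.hyps) simp_all
      with less.prems cleared show ?case by (rule pivot)
    next
      case (row Q i k s)
      with less.prems show ?case by (rule subtract_row)
    next
      case (column Q j l s)
      with less.prems show ?case by (rule subtract_column)
    qed
  qed
qed

section \<open>Balanced pairings\<close>

locale linked_pairings =
  X: comm_group X + Y: comm_group Y + W: comm_group W + E: group E +
  \<alpha>: bihom X E W \<alpha> + \<gamma>: bihom E Y W \<gamma> + p: group_hom E X p + r: group_hom E Y r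
  for X :: "('x, 'xs) monoid_scheme" and Y :: "('y, 'ys) monoid_scheme"
    and W :: "('w, 'ws) monoid_scheme" and E :: "('e, 'es) monoid_scheme"
    and p :: "'e \<Rightarrow> 'x" and r :: "'e \<Rightarrow> 'y" and \<alpha> :: "'x \<Rightarrow> 'e \<Rightarrow> 'w" and \<gamma> :: "'e \<Rightarrow> 'y \<Rightarrow> 'w"
begin

lemma linked_pairings_flip: "linked_pairings Y X W E r p (\<lambda>y d. \<gamma> d y) (\<lambda>d x. \<alpha> x d)"
  by (intro linked_pairings.intro \<gamma>.flip \<alpha>.flip X.comm_group_axioms Y.comm_group_axioms
      W.comm_group_axioms E.group_axioms p.group_hom_axioms r.group_hom_axioms)

definition balanced_at :: "int \<Rightarrow> bool" where
  "balanced_at q \<longleftrightarrow> (\<forall>x\<in>carrier X. \<forall>y\<in>carrier Y. \<forall>d\<in>carrier E. \<forall>e\<in>carrier E.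
     p d = x [^]\<^bsub>X\<^esub> q \<longrightarrow> r e = y [^]\<^bsub>Y\<^esub> q \<longrightarrow> \<alpha> x e = \<gamma> d y)"

lemma balanced_atD:
  "balanced_at q \<Longrightarrow> x \<in> carrier X \<Longrightarrow> y \<in> carrier Y \<Longrightarrow> d \<in> carrier E \<Longrightarrow> e \<in> carrier E \<Longrightarrow>
   p d = x [^]\<^bsub>X\<^esub> q \<Longrightarrow> r e = y [^]\<^bsub>Y\<^esub> q \<Longrightarrow> \<alpha> x e = \<gamma> d y"
  unfolding balanced_at_def by blast

lemma \<alpha>_eq_one_if_balanced_at_0:
  assumes "balanced_at 0" "x \<in> carrier X" "e \<in> carrier E" "r e = \<one>\<^bsub>Y\<^esub>"
  shows "\<alpha> x e = \<one>\<^bsub>W\<^esub>"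
  using balanced_atD[OF assms(1), of x "\<one>\<^bsub>Y\<^esub>" "\<one>\<^bsub>E\<^esub>" e] assms by simp

lemma \<gamma>_eq_one_if_balanced_at_0:
  assumes "balanced_at 0" "d \<in> carrier E" "y \<in> carrier Y" "p d = \<one>\<^bsub>X\<^esub>"
  shows "\<gamma> d y = \<one>\<^bsub>W\<^esub>"
  using balanced_atD[OF assms(1), of "\<one>\<^bsub>X\<^esub>" y d "\<one>\<^bsub>E\<^esub>"] assms by simp

lemma \<gamma>_cong:
  assumes zero: "balanced_at 0" and d: "d \<in> carrier E" "d' \<in> carrier E" "p d = p d'"
    and y: "y \<in> carrier Y"
  shows "\<gamma> d y = \<gamma> d' y"
proof -
  have "\<gamma> (d \<otimes>\<^bsub>E\<^esub> inv\<^bsub>E\<^esub> d') y = \<one>\<^bsub>W\<^esub>"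
    using d y by (intro \<gamma>_eq_one_if_balanced_at_0[OF zero]) simp_all
  then have "\<gamma> d y \<otimes>\<^bsub>W\<^esub> inv\<^bsub>W\<^esub> \<gamma> d' y = \<one>\<^bsub>W\<^esub>" using d y by (simp add: \<gamma>.mult_left \<gamma>.inv_left)
  then show ?thesis using d y W.inv_equality[of "\<gamma> d y" "inv\<^bsub>W\<^esub> \<gamma> d' y"] by simp
qed

lemma \<alpha>_cong:
  assumes "balanced_at 0" "e \<in> carrier E" "e' \<in> carrier E" "r e = r e'" "x \<in> carrier X"
  shows "\<alpha> x e = \<alpha> x e'"
proof -
  interpret flip: linked_pairings Y X W E r p "\<lambda>y d. \<gamma> d y" "\<lambda>d x. \<alpha> x d"
    by (rule linked_pairings_flip)
  have "flip.balanced_at 0" using assms(1) unfolding balanced_at_def flip.balanced_at_def by metis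
  then show ?thesis using flip.\<gamma>_cong assms by blast
qed

text \<open>By Bezout, \<open>d\<close> and \<open>e\<close> have powers whose images are \<open>gcd q n\<close>-th powers.\<close>

lemma balanced_at_if_balanced_at_gcd:
  assumes zero: "balanced_at 0" and gcd: "balanced_at (gcd q n)"
    and X_exponent: "\<And>x. x \<in> carrier X \<Longrightarrow> x [^]\<^bsub>X\<^esub> n = \<one>\<^bsub>X\<^esub>"
    and Y_exponent: "\<And>y. y \<in> carrier Y \<Longrightarrow> y [^]\<^bsub>Y\<^esub> n = \<one>\<^bsub>Y\<^esub>"
  shows "balanced_at q"
  unfolding balanced_at_def
proof (intro ballI impI)
  fix x y d e
  assume x: "x \<in> carrier X" and y: "y \<in> carrier Y" and d: "d \<in> carrier E" and e: "e \<in> carrier E"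
    and p_d: "p d = x [^]\<^bsub>X\<^esub> q" and r_e: "r e = y [^]\<^bsub>Y\<^esub> q"
  obtain u v where bezout: "u * q + v * n = gcd q n" using bezout_int[of q n] by blast
  obtain k where k: "q = gcd q n * k" by (metis dvdE gcd_dvd1)
  have "x [^]\<^bsub>X\<^esub> gcd q n = (x [^]\<^bsub>X\<^esub> q) [^]\<^bsub>X\<^esub> u \<otimes>\<^bsub>X\<^esub> (x [^]\<^bsub>X\<^esub> n) [^]\<^bsub>X\<^esub> v"
    using x by (simp add: X.int_pow_pow X.int_pow_mult mult.commute flip: bezout)
  then have p_d': "p (d [^]\<^bsub>E\<^esub> u) = x [^]\<^bsub>X\<^esub> gcd q n"
    using d x by (simp add: p.hom_int_pow p_d X_exponent)
  have "y [^]\<^bsub>Y\<^esub> gcd q n = (y [^]\<^bsub>Y\<^esub> q) [^]\<^bsub>Y\<^esub> u \<otimes>\<^bsub>Y\<^esub> (y [^]\<^bsub>Y\<^esub> n) [^]\<^bsub>Y\<^esub> v"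
    using y by (simp add: Y.int_pow_pow Y.int_pow_mult mult.commute flip: bezout)
  then have r_e': "r (e [^]\<^bsub>E\<^esub> u) = y [^]\<^bsub>Y\<^esub> gcd q n"
    using e y by (simp add: r.hom_int_pow r_e Y_exponent)
  have "r e = r ((e [^]\<^bsub>E\<^esub> u) [^]\<^bsub>E\<^esub> k)"
    using e y by (simp add: r.hom_int_pow[of "e [^]\<^bsub>E\<^esub> u"] r_e r_e' Y.int_pow_pow flip: k)
  then have "\<alpha> x e = \<alpha> x (e [^]\<^bsub>E\<^esub> u) [^]\<^bsub>W\<^esub> k"
    using \<alpha>_cong[OF zero e, of "(e [^]\<^bsub>E\<^esub> u) [^]\<^bsub>E\<^esub> k" x] e x by (simp add: \<alpha>.int_pow_right)
  also have "\<alpha> x (e [^]\<^bsub>E\<^esub> u) = \<gamma> (d [^]\<^bsub>E\<^esub> u) y"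
    using x y d e by (intro balanced_atD[OF gcd] p_d' r_e') simp_all
  also have "p d = p ((d [^]\<^bsub>E\<^esub> u) [^]\<^bsub>E\<^esub> k)"
    using d x by (simp add: p.hom_int_pow[of "d [^]\<^bsub>E\<^esub> u"] p_d p_d' X.int_pow_pow flip: k)
  then have "\<gamma> (d [^]\<^bsub>E\<^esub> u) y [^]\<^bsub>W\<^esub> k = \<gamma> d y"
    using \<gamma>_cong[OF zero d, of "(d [^]\<^bsub>E\<^esub> u) [^]\<^bsub>E\<^esub> k" y] d y by (simp add: \<gamma>.int_pow_left)
  finally show "\<alpha> x e = \<gamma> d y" .
qed

text \<open>If \<open>Q\<close> expresses the images of the \<open>d j\<close> and \<open>e i\<close> through the \<open>x i\<close> and \<open>y j\<close>, then
  \<open>\<Sum>i. x i \<otimes> r (e i) = \<Sum>j. p (d j) \<otimes> y j\<close> in \<open>X \<otimes> Y\<close>.\<close>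

definition balanced :: "'i set \<Rightarrow> 'j set \<Rightarrow> ('i \<Rightarrow> 'j \<Rightarrow> int) \<Rightarrow> bool" where
  "balanced I J Q \<longleftrightarrow> (\<forall>x \<in> I \<rightarrow> carrier X. \<forall>y \<in> J \<rightarrow> carrier Y.
     \<forall>d \<in> J \<rightarrow> carrier E. \<forall>e \<in> I \<rightarrow> carrier E.
     (\<forall>j\<in>J. p (d j) = (\<Otimes>\<^bsub>X\<^esub>i\<in>I. x i [^]\<^bsub>X\<^esub> Q i j)) \<longrightarrow>
     (\<forall>i\<in>I. r (e i) = (\<Otimes>\<^bsub>Y\<^esub>j\<in>J. y j [^]\<^bsub>Y\<^esub> Q i j)) \<longrightarrow>
     (\<Otimes>\<^bsub>W\<^esub>i\<in>I. \<alpha> (x i) (e i)) = (\<Otimes>\<^bsub>W\<^esub>j\<in>J. \<gamma> (d j) (y j)))"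

lemma balancedI [case_names balanced]:
  assumes "\<And>x y d e. x \<in> I \<rightarrow> carrier X \<Longrightarrow> y \<in> J \<rightarrow> carrier Y \<Longrightarrow> d \<in> J \<rightarrow> carrier E \<Longrightarrow>
    e \<in> I \<rightarrow> carrier E \<Longrightarrow> (\<And>j. j \<in> J \<Longrightarrow> p (d j) = (\<Otimes>\<^bsub>X\<^esub>i\<in>I. x i [^]\<^bsub>X\<^esub> Q i j)) \<Longrightarrow>
    (\<And>i. i \<in> I \<Longrightarrow> r (e i) = (\<Otimes>\<^bsub>Y\<^esub>j\<in>J. y j [^]\<^bsub>Y\<^esub> Q i j)) \<Longrightarrow>
    (\<Otimes>\<^bsub>W\<^esub>i\<in>I. \<alpha> (x i) (e i)) = (\<Otimes>\<^bsub>W\<^esub>j\<in>J. \<gamma> (d j) (y j))"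
  shows "balanced I J Q"
  using assms unfolding balanced_def by blast

lemma balancedD:
  "balanced I J Q \<Longrightarrow> x \<in> I \<rightarrow> carrier X \<Longrightarrow> y \<in> J \<rightarrow> carrier Y \<Longrightarrow> d \<in> J \<rightarrow> carrier E \<Longrightarrow>
   e \<in> I \<rightarrow> carrier E \<Longrightarrow> (\<And>j. j \<in> J \<Longrightarrow> p (d j) = (\<Otimes>\<^bsub>X\<^esub>i\<in>I. x i [^]\<^bsub>X\<^esub> Q i j)) \<Longrightarrow>
   (\<And>i. i \<in> I \<Longrightarrow> r (e i) = (\<Otimes>\<^bsub>Y\<^esub>j\<in>J. y j [^]\<^bsub>Y\<^esub> Q i j)) \<Longrightarrow>
   (\<Otimes>\<^bsub>W\<^esub>i\<in>I. \<alpha> (x i) (e i)) = (\<Otimes>\<^bsub>W\<^esub>j\<in>J. \<gamma> (d j) (y j))"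
  unfolding balanced_def by blast

lemma balanced_flip:
  "linked_pairings.balanced Y X W E r p (\<lambda>y d. \<gamma> d y) (\<lambda>d x. \<alpha> x d) J I (\<lambda>j i. Q i j)
     \<longleftrightarrow> balanced I J Q"
  unfolding balanced_def linked_pairings.balanced_def[OF linked_pairings_flip]
  by (intro iffI ballI impI; rule sym; blast)

lemma balanced_subtract_column:
  assumes J: "finite J" "j \<in> J" "l \<in> J" "j \<noteq> l"
    and difference: "balanced I J (subtract_column s j l Q)"
  shows "balanced I J Q"
proof (rule balancedI)
  fix x y d e
  assume mem: "x \<in> I \<rightarrow> carrier X" "y \<in> J \<rightarrow> carrier Y" "d \<in> J \<rightarrow> carrier E" "e \<in> I \<rightarrow> carrier E"
    and p_d: "\<And>j. j \<in> J \<Longrightarrow> p (d j) = (\<Otimes>\<^bsub>X\<^esub>i\<in>I. x i [^]\<^bsub>X\<^esub> Q i j)"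
    and r_e: "\<And>i. i \<in> I \<Longrightarrow> r (e i) = (\<Otimes>\<^bsub>Y\<^esub>j\<in>J. y j [^]\<^bsub>Y\<^esub> Q i j)"
  let ?R = "subtract_column s j l Q"
  define y' where "y' = y(j := y j \<otimes>\<^bsub>Y\<^esub> y l [^]\<^bsub>Y\<^esub> s)"
  define d' where "d' = d(l := d l \<otimes>\<^bsub>E\<^esub> d j [^]\<^bsub>E\<^esub> (- s))"
  have [simp]: "\<And>i. i \<in> I \<Longrightarrow> x i \<in> carrier X" "\<And>j. j \<in> J \<Longrightarrow> y j \<in> carrier Y"
    "\<And>j. j \<in> J \<Longrightarrow> d j \<in> carrier E"
    using mem by auto
  have y': "y' \<in> J \<rightarrow> carrier Y" and d': "d' \<in> J \<rightarrow> carrier E"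
    using J by (auto simp: y'_def d'_def)
  have p_d': "p (d' k) = (\<Otimes>\<^bsub>X\<^esub>i\<in>I. x i [^]\<^bsub>X\<^esub> ?R i k)" if "k \<in> J" for k
    using that J mem(1)
    by (simp add: d'_def subtract_column_def p.hom_int_pow p_d X.finprod_int_pow_diff_mult)
  have r_e': "r (e i) = (\<Otimes>\<^bsub>Y\<^esub>k\<in>J. y' k [^]\<^bsub>Y\<^esub> ?R i k)" if "i \<in> I" for i
  proof -
    have "y j [^]\<^bsub>Y\<^esub> Q i j \<otimes>\<^bsub>Y\<^esub> y l [^]\<^bsub>Y\<^esub> Q i l
        = (y j \<otimes>\<^bsub>Y\<^esub> y l [^]\<^bsub>Y\<^esub> s) [^]\<^bsub>Y\<^esub> Q i j \<otimes>\<^bsub>Y\<^esub> y l [^]\<^bsub>Y\<^esub> (Q i l - s * Q i j)"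
      using J by (simp add: Y.int_pow_distrib Y.int_pow_pow Y.m_assoc flip: Y.int_pow_mult)
    then have "(\<Otimes>\<^bsub>Y\<^esub>k\<in>J. y k [^]\<^bsub>Y\<^esub> Q i k) = (\<Otimes>\<^bsub>Y\<^esub>k\<in>J. y' k [^]\<^bsub>Y\<^esub> ?R i k)"
      using J y' by (intro Y.finprod_cong_pair[of J j l])
        (auto simp: y'_def subtract_column_def Pi_iff)
    then show ?thesis using r_e that by simp
  qed
  have "(\<Otimes>\<^bsub>W\<^esub>i\<in>I. \<alpha> (x i) (e i)) = (\<Otimes>\<^bsub>W\<^esub>k\<in>J. \<gamma> (d' k) (y' k))"
    by (rule balancedD[OF difference]) (fact mem y' d' p_d' r_e')+
  also have "\<dots> = (\<Otimes>\<^bsub>W\<^esub>k\<in>J. \<gamma> (d k) (y k))"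
  proof (rule W.finprod_cong_pair[OF J])
    show "\<gamma> (d' j) (y' j) \<otimes>\<^bsub>W\<^esub> \<gamma> (d' l) (y' l) = \<gamma> (d j) (y j) \<otimes>\<^bsub>W\<^esub> \<gamma> (d l) (y l)"
      using J by (simp add: y'_def d'_def \<gamma>.shear)
  qed (use J in \<open>auto simp: y'_def d'_def\<close>)
  finally show "(\<Otimes>\<^bsub>W\<^esub>i\<in>I. \<alpha> (x i) (e i)) = (\<Otimes>\<^bsub>W\<^esub>j\<in>J. \<gamma> (d j) (y j))" .
qed

lemma balanced_subtract_row:
  assumes "finite I" "i \<in> I" "k \<in> I" "i \<noteq> k" "balanced I J (subtract_row s i k Q)"
  shows "balanced I J Q"
proof -
  interpret flip: linked_pairings Y X W E r p "\<lambda>y d. \<gamma> d y" "\<lambda>d x. \<alpha> x d"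
    by (rule linked_pairings_flip)
  have "flip.balanced J I (subtract_column s i k (\<lambda>j i. Q i j))"
    using assms(5) by (simp only: balanced_flip flip: subtract_row_transpose)
  with assms(1-4) have "flip.balanced J I (\<lambda>j i. Q i j)" by (rule flip.balanced_subtract_column)
  then show ?thesis by (simp only: balanced_flip)
qed

lemma balanced_zero:
  assumes "balanced_at 0" and zero: "\<And>i j. i \<in> I \<Longrightarrow> j \<in> J \<Longrightarrow> Q i j = 0"
  shows "balanced I J Q"
proof (rule balancedI)
  fix x y d e
  assume mem: "x \<in> I \<rightarrow> carrier X" "y \<in> J \<rightarrow> carrier Y" "d \<in> J \<rightarrow> carrier E" "e \<in> I \<rightarrow> carrier E"
    and p_d: "\<And>j. j \<in> J \<Longrightarrow> p (d j) = (\<Otimes>\<^bsub>X\<^esub>i\<in>I. x i [^]\<^bsub>X\<^esub> Q i j)"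
    and r_e: "\<And>i. i \<in> I \<Longrightarrow> r (e i) = (\<Otimes>\<^bsub>Y\<^esub>j\<in>J. y j [^]\<^bsub>Y\<^esub> Q i j)"
  have "\<alpha> (x i) (e i) = \<one>\<^bsub>W\<^esub>" if "i \<in> I" for i
  proof (rule \<alpha>_eq_one_if_balanced_at_0[OF assms(1)])
    show "r (e i) = \<one>\<^bsub>Y\<^esub>" using r_e that zero by (simp add: Y.finprod_one_eqI)
  qed (use mem that in auto)
  moreover have "\<gamma> (d j) (y j) = \<one>\<^bsub>W\<^esub>" if "j \<in> J" for j
  proof (rule \<gamma>_eq_one_if_balanced_at_0[OF assms(1)])
    show "p (d j) = \<one>\<^bsub>X\<^esub>" using p_d that zero by (simp add: X.finprod_one_eqI)
  qed (use mem that in auto)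
  ultimately show "(\<Otimes>\<^bsub>W\<^esub>i\<in>I. \<alpha> (x i) (e i)) = (\<Otimes>\<^bsub>W\<^esub>j\<in>J. \<gamma> (d j) (y j))"
    by (simp add: W.finprod_one_eqI)
qed

lemma balanced_pivot:
  assumes I: "finite I" "i \<in> I" and J: "finite J" "j \<in> J"
    and row: "\<And>l. l \<in> J - {j} \<Longrightarrow> Q i l = 0" and column: "\<And>k. k \<in> I - {i} \<Longrightarrow> Q k j = 0"
    and pivot: "balanced_at (Q i j)" and rest: "balanced (I - {i}) (J - {j}) Q"
  shows "balanced I J Q"
proof (rule balancedI)
  fix x y d e
  assume mem: "x \<in> I \<rightarrow> carrier X" "y \<in> J \<rightarrow> carrier Y" "d \<in> J \<rightarrow> carrier E" "e \<in> I \<rightarrow> carrier E"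
    and p_d: "\<And>j. j \<in> J \<Longrightarrow> p (d j) = (\<Otimes>\<^bsub>X\<^esub>i\<in>I. x i [^]\<^bsub>X\<^esub> Q i j)"
    and r_e: "\<And>i. i \<in> I \<Longrightarrow> r (e i) = (\<Otimes>\<^bsub>Y\<^esub>j\<in>J. y j [^]\<^bsub>Y\<^esub> Q i j)"
  have closed: "\<And>i. i \<in> I \<Longrightarrow> x i \<in> carrier X" "\<And>j. j \<in> J \<Longrightarrow> y j \<in> carrier Y"
    "\<And>j. j \<in> J \<Longrightarrow> d j \<in> carrier E" "\<And>i. i \<in> I \<Longrightarrow> e i \<in> carrier E"
    using mem by auto
  have p_d_split: "p (d l) = x i [^]\<^bsub>X\<^esub> Q i l \<otimes>\<^bsub>X\<^esub> (\<Otimes>\<^bsub>X\<^esub>k\<in>I - {i}. x k [^]\<^bsub>X\<^esub> Q k l)" if "l \<in> J" for l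
    using that by (subst p_d, simp, subst X.finprod_remove[OF I]) (simp_all add: closed)
  have r_e_split: "r (e k) = y j [^]\<^bsub>Y\<^esub> Q k j \<otimes>\<^bsub>Y\<^esub> (\<Otimes>\<^bsub>Y\<^esub>l\<in>J - {j}. y l [^]\<^bsub>Y\<^esub> Q k l)" if "k \<in> I" for k
    using that by (subst r_e, simp, subst Y.finprod_remove[OF J]) (simp_all add: closed)
  have "\<alpha> (x i) (e i) = \<gamma> (d j) (y j)"
  proof (rule balanced_atD[OF pivot])
    show "p (d j) = x i [^]\<^bsub>X\<^esub> Q i j"
      using J I X.finprod_one_eqI[of "I - {i}" "\<lambda>k. x k [^]\<^bsub>X\<^esub> Q k j"] column
      by (simp add: p_d_split closed)
    show "r (e i) = y j [^]\<^bsub>Y\<^esub> Q i j"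
      using J I Y.finprod_one_eqI[of "J - {j}" "\<lambda>l. y l [^]\<^bsub>Y\<^esub> Q i l"] row
      by (simp add: r_e_split closed)
  qed (use I J closed in auto)
  moreover have "(\<Otimes>\<^bsub>W\<^esub>i\<in>I - {i}. \<alpha> (x i) (e i)) = (\<Otimes>\<^bsub>W\<^esub>j\<in>J - {j}. \<gamma> (d j) (y j))"
  proof (rule balancedD[OF rest])
    show "p (d l) = (\<Otimes>\<^bsub>X\<^esub>i\<in>I - {i}. x i [^]\<^bsub>X\<^esub> Q i l)" if "l \<in> J - {j}" for l
      using that I row by (simp add: p_d_split closed)
    show "r (e k) = (\<Otimes>\<^bsub>Y\<^esub>j\<in>J - {j}. y j [^]\<^bsub>Y\<^esub> Q k j)" if "k \<in> I - {i}" for k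
      using that J column by (simp add: r_e_split closed)
  qed (use mem in auto)
  ultimately show "(\<Otimes>\<^bsub>W\<^esub>i\<in>I. \<alpha> (x i) (e i)) = (\<Otimes>\<^bsub>W\<^esub>j\<in>J. \<gamma> (d j) (y j))"
    using closed by (subst W.finprod_remove[OF I], simp, subst W.finprod_remove[OF J]) simp_all
qed

end

locale balanced_pairings = linked_pairings X Y W E p r \<alpha> \<gamma>
  for X :: "('x, 'xs) monoid_scheme" and Y :: "('y, 'ys) monoid_scheme"
    and W :: "('w, 'ws) monoid_scheme" and E :: "('e, 'es) monoid_scheme"
    and p :: "'e \<Rightarrow> 'x" and r :: "'e \<Rightarrow> 'y" and \<alpha> :: "'x \<Rightarrow> 'e \<Rightarrow> 'w" and \<gamma> :: "'e \<Rightarrow> 'y \<Rightarrow> 'w" +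
  assumes balanced_at: "\<And>q. balanced_at q"
begin

lemma balanced: "finite I \<Longrightarrow> finite J \<Longrightarrow> balanced I J Q"
proof (induction rule: diagonalisation_induct)
  case (zero I J Q)
  show ?case using balanced_at zero(3) by (rule balanced_zero)
next
  case (pivot I J Q i j)
  show ?case
    by (rule balanced_pivot[OF pivot(1,3,2,4,5,6) balanced_at pivot(7)])
next
  case (row I J Q i k s)
  show ?case by (rule balanced_subtract_row[OF row(1,3-6)])
next
  case (column I J Q j l s)
  show ?case by (rule balanced_subtract_column[OF column(2-6)])
qed

end

section \<open>The universal common extension of two pairings\<close>

context linked_pairings
begin

text \<open>A pair \<open>(w, g)\<close> stands for \<open>w + (\<Sum>x. x \<otimes> g x)\<close> in \<open>W \<oplus> (X \<otimes> Y)\<close>.\<close>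

definition ambient :: "('w \<times> ('x \<Rightarrow> 'y)) monoid" where
  "ambient = W \<times>\<times> product_group (carrier X) (\<lambda>_. Y)"

definition combinations :: "('x \<Rightarrow> int) monoid" where
  "combinations = sum_group (carrier X) (\<lambda>_. integer_group)"

definition evaluate :: "('x \<Rightarrow> int) \<Rightarrow> 'x" where
  "evaluate k = gfinprod X (\<lambda>x. x [^]\<^bsub>X\<^esub> k x) (carrier X)"

definition generator :: "'x \<Rightarrow> 'x \<Rightarrow> int" where
  "generator x = (\<lambda>z\<in>carrier X. if z = x then 1 else 0)"

definition spread :: "('x \<Rightarrow> int) \<Rightarrow> 'y \<Rightarrow> 'x \<Rightarrow> 'y" where
  "spread k y = (\<lambda>x\<in>carrier X. y [^]\<^bsub>Y\<^esub> k x)"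

sublocale ambient: comm_group ambient
  unfolding ambient_def
  by (intro comm_group_DirProd comm_group_product_group W.comm_group_axioms Y.comm_group_axioms)

lemma carrier_ambient: "carrier ambient = carrier W \<times> (carrier X \<rightarrow>\<^sub>E carrier Y)"
  and mult_ambient: "(w, g) \<otimes>\<^bsub>ambient\<^esub> (w', g') = (w \<otimes>\<^bsub>W\<^esub> w', \<lambda>x\<in>carrier X. g x \<otimes>\<^bsub>Y\<^esub> g' x)"
  by (simp_all add: ambient_def)

lemma fst_mult_ambient: "fst (u \<otimes>\<^bsub>ambient\<^esub> v) = fst u \<otimes>\<^bsub>W\<^esub> fst v"
  and snd_mult_ambient: "x \<in> carrier X \<Longrightarrow> snd (u \<otimes>\<^bsub>ambient\<^esub> v) x = snd u x \<otimes>\<^bsub>Y\<^esub> snd v x"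
  by (simp_all add: ambient_def mult_DirProd')

lemma hom_fst_ambient: "fst \<in> hom ambient W"
  by (auto simp: hom_def ambient_def)

lemma hom_snd_apply_ambient: "x \<in> carrier X \<Longrightarrow> (\<lambda>u. snd u x) \<in> hom ambient Y"
  by (auto simp: hom_def ambient_def PiE_iff)

sublocale combinations: group combinations
  by (simp add: combinations_def)

lemma carrier_combinations:
  "carrier combinations = {k \<in> extensional (carrier X). finite {x \<in> carrier X. k x \<noteq> 0}}"
  by (auto simp: combinations_def carrier_sum_group PiE_iff)

lemma evaluate_hom: "evaluate \<in> hom combinations X"
  unfolding evaluate_def combinations_def
  by (rule X.hom_group_sum) (auto intro: X.hom_integer_group_pow)

lemma generator_closed [simp]: "generator x \<in> carrier combinations"
  by (auto simp: carrier_combinations generator_def intro: finite_subset[of _ "{x}"])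

lemma evaluate_eq_finprod:
  assumes "finite I" "I \<subseteq> carrier X" "\<forall>x\<in>carrier X - I. k x = 0"
  shows "evaluate k = (\<Otimes>\<^bsub>X\<^esub>x\<in>I. x [^]\<^bsub>X\<^esub> k x)"
  unfolding evaluate_def using assms by (intro X.gfinprod_eq_finprod_superset) auto

lemma evaluate_generator [simp]: "x \<in> carrier X \<Longrightarrow> evaluate (generator x) = x"
  by (subst evaluate_eq_finprod[of "{x}"]) (simp_all add: generator_def)

sublocale spread: bihom combinations Y "product_group (carrier X) (\<lambda>_. Y)" spread
proof (intro bihom.intro bihom_axioms.intro combinations.group_axioms Y.group_axioms)
  show "comm_group (product_group (carrier X) (\<lambda>_. Y))"
    by (intro comm_group_product_group Y.comm_group_axioms)
  show "(\<lambda>k. spread k y) \<in> hom combinations (product_group (carrier X) (\<lambda>_. Y))"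
    if "y \<in> carrier Y" for y
    using that
    by (auto simp: hom_def spread_def combinations_def Y.int_pow_mult intro!: restrict_ext)
  show "spread k \<in> hom Y (product_group (carrier X) (\<lambda>_. Y))" if "k \<in> carrier combinations" for k
    by (auto simp: hom_def spread_def Y.int_pow_distrib intro!: restrict_ext)
qed

definition lifts :: "('e \<times> ('x \<Rightarrow> int)) monoid" where
  "lifts = (E \<times>\<times> combinations)
     \<lparr>carrier := {(d, k). d \<in> carrier E \<and> k \<in> carrier combinations \<and> p d = evaluate k}\<rparr>"

lemma group_lifts: "group lifts"
  unfolding lifts_def
proof (rule subgroup.subgroup_is_group)
  interpret evaluate: group_hom combinations X evaluate by unfold_locales (rule evaluate_hom)
  show "group (E \<times>\<times> combinations)" by (intro DirProd_group E.group_axioms combinations.group_axioms)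
  then interpret group "E \<times>\<times> combinations" .
  show "subgroup {(d, k). d \<in> carrier E \<and> k \<in> carrier combinations \<and> p d = evaluate k}
      (E \<times>\<times> combinations)"
    by (rule subgroupI) (auto simp: E.group_axioms combinations.group_axioms
        intro!: exI[of _ "\<one>\<^bsub>E\<^esub>"] exI[of _ "\<one>\<^bsub>combinations\<^esub>"])
qed

lemma liftsD:
  assumes "u \<in> carrier lifts"
  shows "fst u \<in> carrier E" "snd u \<in> carrier combinations" "p (fst u) = evaluate (snd u)"
  using assms by (simp_all add: lifts_def case_prod_beta)

definition left_relator :: "'x \<Rightarrow> 'e \<Rightarrow> 'w \<times> ('x \<Rightarrow> 'y)" where
  "left_relator x d = (inv\<^bsub>W\<^esub> \<alpha> x d, spread (generator x) (r d))"

definition right_relator :: "'y \<Rightarrow> 'e \<times> ('x \<Rightarrow> int) \<Rightarrow> 'w \<times> ('x \<Rightarrow> 'y)" where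
  "right_relator y = (\<lambda>(d, k). (\<gamma> d y, spread k (inv\<^bsub>Y\<^esub> y)))"

lemma left_relator_hom:
  assumes x: "x \<in> carrier X"
  shows "left_relator x \<in> hom E ambient"
proof -
  have "(\<lambda>d. inv\<^bsub>W\<^esub> \<alpha> x d) \<in> hom E W"
    using x by (auto simp: hom_def \<alpha>.mult_right W.inv_mult)
  moreover have "(\<lambda>d. spread (generator x) (r d)) \<in> hom E (product_group (carrier X) (\<lambda>_. Y))"
    using hom_compose[OF r.homh spread.hom_right[OF generator_closed]] by (simp add: comp_def)
  ultimately show ?thesis
    unfolding left_relator_def[abs_def] ambient_def hom_paired by blast
qed

lemma right_relator_hom:
  assumes y: "y \<in> carrier Y"
  shows "right_relator y \<in> hom lifts ambient"
  using y spread.closed[of _ "inv\<^bsub>Y\<^esub> y"]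
  by (auto simp: hom_def right_relator_def lifts_def carrier_ambient mult_ambient
      \<gamma>.mult_left spread.mult_left)

definition left_relations :: "('w \<times> ('x \<Rightarrow> 'y)) set" where
  "left_relations = (\<lambda>e. gfinprod ambient (\<lambda>x. left_relator x (e x)) (carrier X))
     ` carrier (sum_group (carrier X) (\<lambda>_. E))"

definition right_relations :: "('w \<times> ('x \<Rightarrow> 'y)) set" where
  "right_relations = (\<lambda>t. gfinprod ambient (\<lambda>y. right_relator y (t y)) (carrier Y))
     ` carrier (sum_group (carrier Y) (\<lambda>_. lifts))"

definition relations :: "('w \<times> ('x \<Rightarrow> 'y)) set" where
  "relations = left_relations <#>\<^bsub>ambient\<^esub> right_relations"

lemma subgroup_left_relations: "subgroup left_relations ambient"
  unfolding left_relations_def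
  by (intro group_hom.img_is_subgroup group_homI ambient.hom_group_sum)
    (simp_all add: left_relator_hom E.group_axioms ambient.group_axioms)

lemma subgroup_right_relations: "subgroup right_relations ambient"
  unfolding right_relations_def
  by (intro group_hom.img_is_subgroup group_homI ambient.hom_group_sum)
    (simp_all add: right_relator_hom group_lifts ambient.group_axioms)

lemma subgroup_relations: "subgroup relations ambient"
  unfolding relations_def
  by (rule ambient.mult_subgroups[OF subgroup_left_relations subgroup_right_relations])

sublocale relations: normal relations ambient
  using subgroup_relations by (rule ambient.subgroup_imp_normal)

lemma left_relator_in_relations:
  assumes "x \<in> carrier X" "d \<in> carrier E"
  shows "left_relator x d \<in> relations"
proof -
  have "left_relator x ` carrier E \<subseteq> left_relations"
    unfolding left_relations_def
    by (rule ambient.image_subset_hom_group_sum[where A = "\<lambda>_. E"])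
      (simp_all add: assms left_relator_hom)
  then have "left_relator x d \<otimes>\<^bsub>ambient\<^esub> \<one>\<^bsub>ambient\<^esub> \<in> relations"
    using assms(2) subgroup.one_closed[OF subgroup_right_relations]
    by (auto simp: relations_def set_mult_def)
  then show ?thesis using hom_in_carrier[OF left_relator_hom] assms by simp
qed

lemma right_relator_in_relations:
  assumes "y \<in> carrier Y" "d \<in> carrier E" "k \<in> carrier combinations" "p d = evaluate k"
  shows "(\<gamma> d y, spread k (inv\<^bsub>Y\<^esub> y)) \<in> relations"
proof -
  have dk: "(d, k) \<in> carrier lifts" using assms by (simp add: lifts_def)
  have "right_relator y ` carrier lifts \<subseteq> right_relations"
    unfolding right_relations_def
    by (rule ambient.image_subset_hom_group_sum[where A = "\<lambda>_. lifts"])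
      (simp_all add: assms right_relator_hom group_lifts)
  then have "\<one>\<^bsub>ambient\<^esub> \<otimes>\<^bsub>ambient\<^esub> right_relator y (d, k) \<in> relations"
    using dk subgroup.one_closed[OF subgroup_left_relations]
    by (auto simp: relations_def set_mult_def)
  then show ?thesis
    using hom_in_carrier[OF right_relator_hom dk] assms(1) by (simp add: right_relator_def)
qed

lemma gfinprod_ambient:
  assumes "f \<in> A \<rightarrow> carrier ambient" "finite S" "S \<subseteq> A" "\<forall>a\<in>A - S. f a = \<one>\<^bsub>ambient\<^esub>"
  shows "fst (gfinprod ambient f A) = (\<Otimes>\<^bsub>W\<^esub>a\<in>S. fst (f a))"
    and "x \<in> carrier X \<Longrightarrow> snd (gfinprod ambient f A) x = (\<Otimes>\<^bsub>Y\<^esub>a\<in>S. snd (f a) x)"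
proof -
  have f_on_S: "f \<in> S \<rightarrow> carrier ambient" using assms(1,3) by blast
  have gfinprod_eq: "gfinprod ambient f A = finprod ambient f S"
    using assms by (intro ambient.gfinprod_eq_finprod_superset) auto
  show "fst (gfinprod ambient f A) = (\<Otimes>\<^bsub>W\<^esub>a\<in>S. fst (f a))"
    unfolding gfinprod_eq
    using ambient.comm_group_axioms W.comm_group_axioms hom_fst_ambient f_on_S by (rule hom_finprod)
  show "snd (gfinprod ambient f A) x = (\<Otimes>\<^bsub>Y\<^esub>a\<in>S. snd (f a) x)" if "x \<in> carrier X"
    unfolding gfinprod_eq
    using ambient.comm_group_axioms Y.comm_group_axioms hom_snd_apply_ambient[OF that] f_on_S
    by (rule hom_finprod)
qed

lemma left_relation_components:
  assumes e: "e \<in> carrier (sum_group (carrier X) (\<lambda>_. E))"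
    and I: "finite I" "I \<subseteq> carrier X" "\<forall>x\<in>carrier X - I. e x = \<one>\<^bsub>E\<^esub>"
  defines "u \<equiv> gfinprod ambient (\<lambda>x. left_relator x (e x)) (carrier X)"
  shows "fst u = inv\<^bsub>W\<^esub> (\<Otimes>\<^bsub>W\<^esub>x\<in>I. \<alpha> x (e x))" and "x \<in> I \<Longrightarrow> snd u x = r (e x)"
proof -
  have e_closed: "e x \<in> carrier E" if "x \<in> carrier X" for x
    using e that by (auto simp: carrier_sum_group E.group_axioms)
  have relator_closed: "(\<lambda>x. left_relator x (e x)) \<in> carrier X \<rightarrow> carrier ambient"
    using hom_in_carrier[OF left_relator_hom] e_closed by blast
  have relator_one: "\<forall>x\<in>carrier X - I. left_relator x (e x) = \<one>\<^bsub>ambient\<^esub>"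
    using I(3) hom_one[OF left_relator_hom E.group_axioms ambient.group_axioms] by simp
  have fst_u: "fst u = (\<Otimes>\<^bsub>W\<^esub>x\<in>I. fst (left_relator x (e x)))"
    unfolding u_def by (rule gfinprod_ambient(1)[OF relator_closed I(1,2) relator_one])
  have snd_u: "snd u z = (\<Otimes>\<^bsub>Y\<^esub>x\<in>I. snd (left_relator x (e x)) z)" if "z \<in> carrier X" for z
    unfolding u_def by (rule gfinprod_ambient(2)[OF relator_closed I(1,2) relator_one that])
  show "fst u = inv\<^bsub>W\<^esub> (\<Otimes>\<^bsub>W\<^esub>x\<in>I. \<alpha> x (e x))"
    using I(2) e_closed by (subst W.finprod_inv) (auto simp: fst_u left_relator_def)
  show "snd u x = r (e x)" if x: "x \<in> I"
  proof -
    have "snd u x = (\<Otimes>\<^bsub>Y\<^esub>z\<in>I. if x = z then r (e z) else \<one>\<^bsub>Y\<^esub>)"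
      using x I(2) e_closed
      by (subst snd_u)
        (auto simp: left_relator_def spread_def generator_def intro!: Y.finprod_cong')
    moreover have "(\<lambda>z. r (e z)) \<in> I \<rightarrow> carrier Y" using I(2) e_closed by auto
    ultimately show ?thesis using Y.finprod_singleton[OF x I(1), of "\<lambda>z. r (e z)"] by simp
  qed
qed

lemma right_relation_components:
  assumes t: "t \<in> carrier (sum_group (carrier Y) (\<lambda>_. lifts))"
    and J: "finite J" "J \<subseteq> carrier Y" "\<forall>y\<in>carrier Y - J. t y = \<one>\<^bsub>lifts\<^esub>"
  defines "u \<equiv> gfinprod ambient (\<lambda>y. right_relator y (t y)) (carrier Y)"
  shows "fst u = (\<Otimes>\<^bsub>W\<^esub>y\<in>J. \<gamma> (fst (t y)) y)"
    and "x \<in> carrier X \<Longrightarrow> snd u x = inv\<^bsub>Y\<^esub> (\<Otimes>\<^bsub>Y\<^esub>y\<in>J. y [^]\<^bsub>Y\<^esub> snd (t y) x)"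
proof -
  have t_closed: "t y \<in> carrier lifts" if "y \<in> carrier Y" for y
    using t that by (auto simp: carrier_sum_group group_lifts)
  have relator_closed: "(\<lambda>y. right_relator y (t y)) \<in> carrier Y \<rightarrow> carrier ambient"
    using hom_in_carrier[OF right_relator_hom] t_closed by blast
  have relator_one: "\<forall>y\<in>carrier Y - J. right_relator y (t y) = \<one>\<^bsub>ambient\<^esub>"
    using J(3) hom_one[OF right_relator_hom group_lifts ambient.group_axioms] by simp
  have fst_u: "fst u = (\<Otimes>\<^bsub>W\<^esub>y\<in>J. fst (right_relator y (t y)))"
    unfolding u_def by (rule gfinprod_ambient(1)[OF relator_closed J(1,2) relator_one])
  have snd_u: "snd u z = (\<Otimes>\<^bsub>Y\<^esub>y\<in>J. snd (right_relator y (t y)) z)" if "z \<in> carrier X" for z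
    unfolding u_def by (rule gfinprod_ambient(2)[OF relator_closed J(1,2) relator_one that])
  show "fst u = (\<Otimes>\<^bsub>W\<^esub>y\<in>J. \<gamma> (fst (t y)) y)"
    by (simp add: fst_u right_relator_def case_prod_beta)
  show "snd u x = inv\<^bsub>Y\<^esub> (\<Otimes>\<^bsub>Y\<^esub>y\<in>J. y [^]\<^bsub>Y\<^esub> snd (t y) x)" if x: "x \<in> carrier X"
    using J(2) x by (subst Y.finprod_inv)
      (auto simp: snd_u right_relator_def case_prod_beta spread_def Y.int_pow_inv
        intro!: Y.finprod_cong')
qed

lemma relationsE:
  assumes "u \<in> relations"
  obtains I J e d and Q :: "'x \<Rightarrow> 'y \<Rightarrow> int"
  where "finite I" "I \<subseteq> carrier X" "finite J" "J \<subseteq> carrier Y"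
    "e \<in> I \<rightarrow> carrier E" "d \<in> J \<rightarrow> carrier E"
    "\<And>y. y \<in> J \<Longrightarrow> p (d y) = (\<Otimes>\<^bsub>X\<^esub>x\<in>I. x [^]\<^bsub>X\<^esub> Q x y)"
    "fst u = inv\<^bsub>W\<^esub> (\<Otimes>\<^bsub>W\<^esub>x\<in>I. \<alpha> x (e x)) \<otimes>\<^bsub>W\<^esub> (\<Otimes>\<^bsub>W\<^esub>y\<in>J. \<gamma> (d y) y)"
    "\<And>x. x \<in> I \<Longrightarrow> snd u x = r (e x) \<otimes>\<^bsub>Y\<^esub> inv\<^bsub>Y\<^esub> (\<Otimes>\<^bsub>Y\<^esub>y\<in>J. y [^]\<^bsub>Y\<^esub> Q x y)"
proof -
  obtain e t where e: "e \<in> carrier (sum_group (carrier X) (\<lambda>_. E))"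
    and t: "t \<in> carrier (sum_group (carrier Y) (\<lambda>_. lifts))"
    and u: "u = gfinprod ambient (\<lambda>x. left_relator x (e x)) (carrier X)
      \<otimes>\<^bsub>ambient\<^esub> gfinprod ambient (\<lambda>y. right_relator y (t y)) (carrier Y)"
    using assms by (auto simp: relations_def left_relations_def right_relations_def set_mult_def)
  have t_closed: "t y \<in> carrier lifts" if "y \<in> carrier Y" for y
    using t that by (auto simp: carrier_sum_group group_lifts)
  define J where "J = {y \<in> carrier Y. t y \<noteq> \<one>\<^bsub>lifts\<^esub>}"
  define I where "I = {x \<in> carrier X. e x \<noteq> \<one>\<^bsub>E\<^esub>} \<union> (\<Union>y\<in>J. {x \<in> carrier X. snd (t y) x \<noteq> 0})"
  have J: "finite J" "J \<subseteq> carrier Y" "\<forall>y\<in>carrier Y - J. t y = \<one>\<^bsub>lifts\<^esub>"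
    using t by (auto simp: J_def carrier_sum_group group_lifts)
  have "finite {x \<in> carrier X. snd (t y) x \<noteq> 0}" if "y \<in> J" for y
    using that J(2) liftsD(2)[OF t_closed] by (auto simp: carrier_combinations)
  then have I: "finite I" "I \<subseteq> carrier X" "\<forall>x\<in>carrier X - I. e x = \<one>\<^bsub>E\<^esub>"
    using e J(1) by (auto simp: I_def carrier_sum_group E.group_axioms)
  note components = left_relation_components[OF e I] right_relation_components[OF t J]
  show thesis
  proof (rule that[of I J e "\<lambda>y. fst (t y)" "\<lambda>x y. snd (t y) x"])
    show "e \<in> I \<rightarrow> carrier E" using e I(2) by (auto simp: carrier_sum_group E.group_axioms)
    show "p (fst (t y)) = (\<Otimes>\<^bsub>X\<^esub>x\<in>I. x [^]\<^bsub>X\<^esub> snd (t y) x)" if "y \<in> J" for y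
      using that I(1,2) J(2) liftsD(3)[OF t_closed]
      by (subst evaluate_eq_finprod[symmetric]) (auto simp: I_def)
    show "snd u x = r (e x) \<otimes>\<^bsub>Y\<^esub> inv\<^bsub>Y\<^esub> (\<Otimes>\<^bsub>Y\<^esub>y\<in>J. y [^]\<^bsub>Y\<^esub> snd (t y) x)" if "x \<in> I" for x
      using that I(2) by (auto simp: u snd_mult_ambient components(2,4))
  qed (use I J liftsD(1)[OF t_closed] in \<open>auto simp: u fst_mult_ambient components(1,3)\<close>)
qed

end

lemma (in balanced_pairings) relations_Int_W:
  assumes "(w, \<lambda>x\<in>carrier X. \<one>\<^bsub>Y\<^esub>) \<in> relations"
  shows "w = \<one>\<^bsub>W\<^esub>"
  using assms
proof (rule relationsE)
  fix I J e d and Q :: "'x \<Rightarrow> 'y \<Rightarrow> int"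
  assume I: "finite I" "I \<subseteq> carrier X" and J: "finite J" "J \<subseteq> carrier Y"
    and e: "e \<in> I \<rightarrow> carrier E" and d: "d \<in> J \<rightarrow> carrier E"
    and p_d: "\<And>y. y \<in> J \<Longrightarrow> p (d y) = (\<Otimes>\<^bsub>X\<^esub>x\<in>I. x [^]\<^bsub>X\<^esub> Q x y)"
    and w: "fst (w, \<lambda>x\<in>carrier X. \<one>\<^bsub>Y\<^esub>)
      = inv\<^bsub>W\<^esub> (\<Otimes>\<^bsub>W\<^esub>x\<in>I. \<alpha> x (e x)) \<otimes>\<^bsub>W\<^esub> (\<Otimes>\<^bsub>W\<^esub>y\<in>J. \<gamma> (d y) y)"
    and one: "\<And>x. x \<in> I \<Longrightarrow> snd (w, \<lambda>x\<in>carrier X. \<one>\<^bsub>Y\<^esub>) x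
      = r (e x) \<otimes>\<^bsub>Y\<^esub> inv\<^bsub>Y\<^esub> (\<Otimes>\<^bsub>Y\<^esub>y\<in>J. y [^]\<^bsub>Y\<^esub> Q x y)"
  have "(\<Otimes>\<^bsub>W\<^esub>x\<in>I. \<alpha> x (e x)) = (\<Otimes>\<^bsub>W\<^esub>y\<in>J. \<gamma> (d y) y)"
  proof (rule balancedD[OF balanced[OF I(1) J(1)] _ _ d e])
    show "r (e x) = (\<Otimes>\<^bsub>Y\<^esub>y\<in>J. y [^]\<^bsub>Y\<^esub> Q x y)" if x: "x \<in> I" for x
    proof -
      let ?y = "\<Otimes>\<^bsub>Y\<^esub>y\<in>J. y [^]\<^bsub>Y\<^esub> Q x y"
      have "r (e x) \<otimes>\<^bsub>Y\<^esub> inv\<^bsub>Y\<^esub> ?y = \<one>\<^bsub>Y\<^esub>" using one[OF x] x I(2) by auto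
      moreover have "?y \<in> carrier Y" using J(2) by (auto intro!: Y.finprod_closed)
      moreover have "r (e x) \<in> carrier Y" using r.hom_closed[OF funcset_mem[OF e x]] .
      ultimately show ?thesis using Y.inv_equality[of "r (e x)" "inv\<^bsub>Y\<^esub> ?y"] by simp
    qed
  qed (use I(2) J(2) p_d in auto)
  moreover have "(\<Otimes>\<^bsub>W\<^esub>x\<in>I. \<alpha> x (e x)) \<in> carrier W"
    using I(2) e by (intro W.finprod_closed) (auto simp: Pi_iff)
  ultimately show ?thesis using w by simp
qed

context linked_pairings
begin

definition extension :: "('w \<times> ('x \<Rightarrow> 'y)) set monoid" where
  "extension = ambient Mod relations"

definition embed :: "'w \<Rightarrow> ('w \<times> ('x \<Rightarrow> 'y)) set" where
  "embed w = relations #>\<^bsub>ambient\<^esub> (w, \<lambda>x\<in>carrier X. \<one>\<^bsub>Y\<^esub>)"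

definition tensor :: "('x \<Rightarrow> int) \<Rightarrow> 'y \<Rightarrow> ('w \<times> ('x \<Rightarrow> 'y)) set" where
  "tensor k y = relations #>\<^bsub>ambient\<^esub> (\<one>\<^bsub>W\<^esub>, spread k y)"

sublocale extension: comm_group extension
  unfolding extension_def by (rule ambient.abelian_FactGroup[OF subgroup_relations])

lemma coset_hom: "(\<lambda>u. relations #>\<^bsub>ambient\<^esub> u) \<in> hom ambient extension"
  unfolding extension_def by (rule relations.r_coset_hom_Mod)

lemma embed_hom: "embed \<in> hom W extension"
proof -
  have "(\<lambda>w. (w, \<lambda>x\<in>carrier X. \<one>\<^bsub>Y\<^esub>)) \<in> hom W ambient"
    by (auto simp: hom_def carrier_ambient mult_ambient intro!: restrict_ext)
  from hom_compose[OF this coset_hom] show ?thesis by (simp add: embed_def[abs_def] comp_def)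
qed

sublocale embed: group_hom W extension embed
  by unfold_locales (rule embed_hom)

sublocale tensor: bihom combinations Y extension tensor
proof -
  have inclusion: "(\<lambda>g. (\<one>\<^bsub>W\<^esub>, g)) \<in> hom (product_group (carrier X) (\<lambda>_. Y)) ambient"
    by (auto simp: hom_def ambient_def)
  have "(\<lambda>g. relations #>\<^bsub>ambient\<^esub> (\<one>\<^bsub>W\<^esub>, g)) \<in> hom (product_group (carrier X) (\<lambda>_. Y)) extension"
    using hom_compose[OF inclusion coset_hom] by (simp add: comp_def)
  from spread.comp[OF combinations.group_axioms Y.group_axioms extension.comm_group_axioms _ _ this,
      of "\<lambda>k. k" "\<lambda>y. y"]
  show "bihom combinations Y extension tensor"
    by (simp add: tensor_def[abs_def] hom_def)
qed

lemma embed_tensor_coset: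
  assumes "w \<in> carrier W" "k \<in> carrier combinations" "y \<in> carrier Y"
    and relation: "(inv\<^bsub>W\<^esub> w, spread k y) \<in> relations"
  shows "tensor k y = embed w"
proof -
  have "(inv\<^bsub>W\<^esub> w, spread k y) \<otimes>\<^bsub>ambient\<^esub> (w, \<lambda>x\<in>carrier X. \<one>\<^bsub>Y\<^esub>) = (\<one>\<^bsub>W\<^esub>, spread k y)"
    using assms(1-3) by (simp add: mult_ambient) (auto simp: spread_def)
  moreover have "(w, \<lambda>x\<in>carrier X. \<one>\<^bsub>Y\<^esub>) \<in> carrier ambient"
    using assms(1) by (simp add: carrier_ambient)
  ultimately show ?thesis
    using relations.coset_mult_absorb[OF relation] unfolding tensor_def embed_def by metis
qed

lemma tensor_generator:
  assumes "x \<in> carrier X" "d \<in> carrier E"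
  shows "tensor (generator x) (r d) = embed (\<alpha> x d)"
  using assms left_relator_in_relations[OF assms] unfolding left_relator_def
  by (intro embed_tensor_coset) simp_all

lemma tensor_eq_embed_if_evaluate:
  assumes "k \<in> carrier combinations" "y \<in> carrier Y" "d \<in> carrier E" "p d = evaluate k"
  shows "tensor k y = embed (\<gamma> d y)"
proof (rule embed_tensor_coset)
  show "(inv\<^bsub>W\<^esub> \<gamma> d y, spread k y) \<in> relations"
    using right_relator_in_relations[of "inv\<^bsub>Y\<^esub> y" d k] assms by (simp add: \<gamma>.inv_right)
qed (use assms in simp_all)

definition pairing :: "'x \<Rightarrow> 'y \<Rightarrow> ('w \<times> ('x \<Rightarrow> 'y)) set" where
  "pairing x y = tensor (generator x) y"

sublocale pairing: bihom X Y extension pairing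
proof (intro bihom.intro bihom_axioms.intro X.group_axioms Y.group_axioms
    extension.comm_group_axioms)
  show "pairing x \<in> hom Y extension" for x
    using tensor.hom_right by (simp add: pairing_def[abs_def])
next
  fix y assume y: "y \<in> carrier Y"
  interpret evaluate: group_hom combinations X evaluate by unfold_locales (rule evaluate_hom)
  show "(\<lambda>x. pairing x y) \<in> hom X extension"
  proof (rule homI)
    fix x x' assume x: "x \<in> carrier X" "x' \<in> carrier X"
    let ?k = "generator x \<otimes>\<^bsub>combinations\<^esub> generator x'" and ?l = "generator (x \<otimes>\<^bsub>X\<^esub> x')"
    have "evaluate (?k \<otimes>\<^bsub>combinations\<^esub> inv\<^bsub>combinations\<^esub> ?l) = p \<one>\<^bsub>E\<^esub>" using x by simp
    then have "tensor (?k \<otimes>\<^bsub>combinations\<^esub> inv\<^bsub>combinations\<^esub> ?l) y = embed (\<gamma> \<one>\<^bsub>E\<^esub> y)"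
      using y by (intro tensor_eq_embed_if_evaluate) simp_all
    then have "tensor ?k y \<otimes>\<^bsub>extension\<^esub> inv\<^bsub>extension\<^esub> tensor ?l y = \<one>\<^bsub>extension\<^esub>"
      using y by (simp add: tensor.mult_left[of ?k] tensor.inv_left)
    then have "tensor ?l y = tensor ?k y"
      using y extension.inv_equality[of "tensor ?k y" "inv\<^bsub>extension\<^esub> tensor ?l y"] by simp
    then show "pairing (x \<otimes>\<^bsub>X\<^esub> x') y = pairing x y \<otimes>\<^bsub>extension\<^esub> pairing x' y"
      using y by (simp add: pairing_def tensor.mult_left)
  qed (use y in \<open>simp add: pairing_def\<close>)
qed

lemma pairing_r: "x \<in> carrier X \<Longrightarrow> d \<in> carrier E \<Longrightarrow> pairing x (r d) = embed (\<alpha> x d)"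
  by (simp add: pairing_def tensor_generator)

lemma pairing_p: "d \<in> carrier E \<Longrightarrow> y \<in> carrier Y \<Longrightarrow> pairing (p d) y = embed (\<gamma> d y)"
  by (simp add: pairing_def tensor_eq_embed_if_evaluate)

lemma extension_pow_eq_one:
  fixes k :: nat
  assumes W: "\<And>w. w \<in> carrier W \<Longrightarrow> w [^]\<^bsub>W\<^esub> k = \<one>\<^bsub>W\<^esub>"
    and Y: "\<And>y. y \<in> carrier Y \<Longrightarrow> y [^]\<^bsub>Y\<^esub> k = \<one>\<^bsub>Y\<^esub>" and v: "v \<in> carrier extension"
  shows "v [^]\<^bsub>extension\<^esub> k = \<one>\<^bsub>extension\<^esub>"
proof -
  obtain w g where u: "(w, g) \<in> carrier ambient" and v: "v = relations #>\<^bsub>ambient\<^esub> (w, g)"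
    using v by (auto simp: extension_def carrier_FactGroup)
  have "(w, g) [^]\<^bsub>ambient\<^esub> k = \<one>\<^bsub>ambient\<^esub>"
    using u W Y
    by (auto simp: ambient_def pow_DirProd pow_product_group PiE_iff intro!: restrict_ext)
  then show ?thesis
    using hom_one[OF coset_hom] group_hom.hom_nat_pow[OF
        group_homI[OF ambient.group_axioms extension.group_axioms coset_hom] u, of k]
    by (simp add: v ambient.group_axioms extension.group_axioms)
qed

end

lemma (in balanced_pairings) embed_mon: "embed \<in> mon W extension"
proof -
  have "w = \<one>\<^bsub>W\<^esub>" if "w \<in> carrier W" "embed w = \<one>\<^bsub>extension\<^esub>" for w
    using that relations.coset_eq_self_iff[of "(w, \<lambda>x\<in>carrier X. \<one>\<^bsub>Y\<^esub>)"]
    by (intro relations_Int_W) (simp add: embed_def extension_def carrier_ambient)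
  then show ?thesis using embed_hom embed.inj_on_one_iff by (simp add: mon_def)
qed

section \<open>Groups of nilpotency class two\<close>

context group
begin

lemma centerD: "c \<in> center G \<Longrightarrow> x \<in> carrier G \<Longrightarrow> c \<otimes> x = x \<otimes> c"
  unfolding center_def by blast

lemma center_carrier: "c \<in> center G \<Longrightarrow> c \<in> carrier G"
  unfolding center_def by blast

lemma center_subgroup: "subgroup (center G) G"
proof (rule subgroupI)
  fix x assume x: "x \<in> center G"
  have "inv x \<otimes> y = y \<otimes> inv x" if y: "y \<in> carrier G" for y
  proof -
    have "x \<otimes> (y \<otimes> inv x) = y \<otimes> x \<otimes> inv x"
      using y center_carrier[OF x] by (simp add: m_assoc[symmetric] centerD[OF x y])
    also have "\<dots> = y" using y center_carrier[OF x] by (simp add: m_assoc)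
    finally show ?thesis using y center_carrier[OF x] by (simp add: inv_solve_left')
  qed
  then show "inv x \<in> center G" using center_carrier[OF x] by (simp add: center_def)
next
  fix x y assume x: "x \<in> center G" and y: "y \<in> center G"
  note closed = center_carrier[OF x] center_carrier[OF y]
  have "x \<otimes> y \<otimes> z = z \<otimes> (x \<otimes> y)" if z: "z \<in> carrier G" for z
  proof -
    have "x \<otimes> y \<otimes> z = x \<otimes> z \<otimes> y" using closed z by (simp add: m_assoc centerD[OF y z])
    also have "\<dots> = z \<otimes> (x \<otimes> y)" using closed z by (simp add: centerD[OF x z] m_assoc)
    finally show ?thesis .
  qed
  then show "x \<otimes> y \<in> center G" using closed by (simp add: center_def)
qed (auto simp: center_def)

lemma normal_if_central:
  assumes S: "subgroup S G" and central: "S \<subseteq> center G"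
  shows "S \<lhd> G"
proof -
  have "x \<otimes> h \<otimes> inv x = h" if "x \<in> carrier G" "h \<in> S" for x h
  proof -
    have "x \<otimes> h = h \<otimes> x" using that central by (intro centerD[symmetric]) auto
    then show ?thesis using that subgroup.mem_carrier[OF S] by (simp add: m_assoc)
  qed
  then show ?thesis using S by (simp add: normal_inv_iff)
qed

lemma commutator_closed [simp]:
  "x \<in> carrier G \<Longrightarrow> y \<in> carrier G \<Longrightarrow> commutator G x y \<in> carrier G"
  by (simp add: commutator_def)

lemma mult_commutator:
  "x \<in> carrier G \<Longrightarrow> y \<in> carrier G \<Longrightarrow> y \<otimes> x \<otimes> commutator G x y = x \<otimes> y"
  by (simp add: commutator_def m_assoc) (simp add: m_assoc[symmetric])

lemma commutator_eqI:
  assumes "x \<in> carrier G" "y \<in> carrier G" "c \<in> carrier G" "y \<otimes> x \<otimes> c = x \<otimes> y"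
  shows "commutator G x y = c"
  using assms mult_commutator[of x y] Units_l_cancel[of "y \<otimes> x" "commutator G x y" c]
  by (simp add: Units_eq)

lemma commutator_swap:
  "x \<in> carrier G \<Longrightarrow> y \<in> carrier G \<Longrightarrow> commutator G y x = inv (commutator G x y)"
  by (simp add: commutator_def inv_mult_group m_assoc)

lemma commutator_eq_one_iff:
  "x \<in> carrier G \<Longrightarrow> y \<in> carrier G \<Longrightarrow> commutator G x y = \<one> \<longleftrightarrow> x \<otimes> y = y \<otimes> x"
  using mult_commutator[of x y] commutator_eqI[of x y \<one>] by auto

lemma centerI:
  assumes "c \<in> carrier G" "\<And>x. x \<in> carrier G \<Longrightarrow> commutator G c x = \<one>"
  shows "c \<in> center G"
  using assms commutator_eq_one_iff[of c] by (simp add: center_def)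

lemma commutator_center_left: "c \<in> center G \<Longrightarrow> x \<in> carrier G \<Longrightarrow> commutator G c x = \<one>"
  using centerD[of c x] by (simp add: commutator_eq_one_iff center_carrier)

lemma commutator_center_right: "c \<in> center G \<Longrightarrow> x \<in> carrier G \<Longrightarrow> commutator G x c = \<one>"
  using centerD[of c x] by (simp add: commutator_eq_one_iff center_carrier)

lemma normal_if_commutators:
  assumes S: "subgroup S G"
    and commutators: "\<And>x y. x \<in> carrier G \<Longrightarrow> y \<in> carrier G \<Longrightarrow> commutator G x y \<in> S"
  shows "S \<lhd> G"
proof -
  have "x \<otimes> h \<otimes> inv x \<in> S" if x: "x \<in> carrier G" and h: "h \<in> S" for x h
  proof -
    have h': "h \<in> carrier G" using subgroup.mem_carrier[OF S h] .
    have "x \<otimes> h \<otimes> inv x = h \<otimes> commutator G h (inv x)"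
      using x h' by (simp add: commutator_def m_assoc) (simp add: m_assoc[symmetric])
    then show ?thesis using subgroup.m_closed[OF S h commutators[OF h' inv_closed[OF x]]] by simp
  qed
  then show ?thesis using S by (simp add: normal_inv_iff)
qed

lemma comm_group_Mod_if_commutators:
  assumes S: "subgroup S G"
    and commutators: "\<And>x y. x \<in> carrier G \<Longrightarrow> y \<in> carrier G \<Longrightarrow> commutator G x y \<in> S"
  shows "comm_group (G Mod S)"
proof -
  interpret S: normal S G using assms by (rule normal_if_commutators)
  show ?thesis
  proof (rule group.group_comm_groupI[OF S.factorgroup_is_group])
    fix u v assume "u \<in> carrier (G Mod S)" "v \<in> carrier (G Mod S)"
    then obtain x y where x: "x \<in> carrier G" "u = S #> x" and y: "y \<in> carrier G" "v = S #> y"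
      by (auto simp: carrier_FactGroup)
    have "x \<otimes> y = commutator G (inv x) (inv y) \<otimes> (y \<otimes> x)"
      using x(1) y(1) by (simp add: commutator_def m_assoc) (simp add: m_assoc[symmetric])
    then have "S #> (x \<otimes> y) = S #> (y \<otimes> x)"
      using x(1) y(1) S.coset_mult_absorb[of "commutator G (inv x) (inv y)" "y \<otimes> x"]
      by (simp add: commutators)
    then show "u \<otimes>\<^bsub>G Mod S\<^esub> v = v \<otimes>\<^bsub>G Mod S\<^esub> u" using x y by (simp add: S.rcos_sum)
  qed
qed

lemma central_quotient_hom:
  assumes f: "f \<in> hom D G" and g: "g \<in> hom D G"
    and central: "\<And>d. d \<in> carrier D \<Longrightarrow> f d \<otimes> inv (g d) \<in> center G"
  shows "(\<lambda>d. f d \<otimes> inv (g d)) \<in> hom D G"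
proof (rule homI)
  fix d e assume d: "d \<in> carrier D" and e: "e \<in> carrier D"
  note closed = hom_in_carrier[OF f d] hom_in_carrier[OF g d]
    hom_in_carrier[OF f e] hom_in_carrier[OF g e]
  have "f (d \<otimes>\<^bsub>D\<^esub> e) \<otimes> inv (g (d \<otimes>\<^bsub>D\<^esub> e)) = f d \<otimes> (f e \<otimes> inv (g e)) \<otimes> inv (g d)"
    using closed by (simp add: hom_mult[OF f d e] hom_mult[OF g d e] inv_mult_group m_assoc)
  also have "\<dots> = (f e \<otimes> inv (g e)) \<otimes> f d \<otimes> inv (g d)"
    using centerD[OF central[OF e] closed(1)] by simp
  also have "\<dots> = (f e \<otimes> inv (g e)) \<otimes> (f d \<otimes> inv (g d))" using closed by (simp add: m_assoc)
  also have "\<dots> = (f d \<otimes> inv (g d)) \<otimes> (f e \<otimes> inv (g e))"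
    using closed by (intro centerD[OF central[OF e]]) simp
  finally show "f (d \<otimes>\<^bsub>D\<^esub> e) \<otimes> inv (g (d \<otimes>\<^bsub>D\<^esub> e)) = (f d \<otimes> inv (g d)) \<otimes> (f e \<otimes> inv (g e))" .
qed (use hom_in_carrier[OF f] hom_in_carrier[OF g] in simp)

lemma power_subgroup_normal: "power_subgroup G k \<lhd> G"
proof (cases "k = 0")
  case True
  then show ?thesis using one_is_normal by (simp add: power_subgroup_def)
next
  case False
  have "generate G ((\<lambda>x. x [^] k) ` carrier G) \<lhd> G"
  proof (rule normal_generateI)
    fix h g assume "h \<in> (\<lambda>x. x [^] k) ` carrier G" and g: "g \<in> carrier G"
    then obtain x where x: "x \<in> carrier G" "h = x [^] k" by blast
    have "(\<lambda>x. g \<otimes> x \<otimes> inv g) \<in> hom G G"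
      using g by (intro homI) (simp_all add: m_assoc, simp add: m_assoc[symmetric])
    then have "g \<otimes> h \<otimes> inv g = (g \<otimes> x \<otimes> inv g) [^] k"
      using hom_nat_pow[of "\<lambda>x. g \<otimes> x \<otimes> inv g" G G x k] x by (simp add: group_axioms)
    then show "g \<otimes> h \<otimes> inv g \<in> (\<lambda>x. x [^] k) ` carrier G" using g x by blast
  qed auto
  then show ?thesis using False by (simp add: power_subgroup_def)
qed

lemma subgroup_power_derived: "subgroup (power_derived G k) G"
  unfolding power_derived_def
  by (intro second_isomorphism_grp.normal_set_mult_subgroup second_isomorphism_grp.intro
      second_isomorphism_grp_axioms.intro power_subgroup_normal derived_is_subgroup) simp

lemma pow_in_power_derived:
  assumes "x \<in> carrier G"
  shows "x [^] k \<in> power_derived G k"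
proof -
  have "x [^] k \<in> power_subgroup G k"
    using assms by (auto simp: power_subgroup_def intro: generate.incl)
  then show ?thesis
    using assms by (force simp: power_derived_def set_mult_def derived_def intro: generate.one)
qed

lemma commutator_in_power_derived:
  assumes "x \<in> carrier G" "y \<in> carrier G"
  shows "commutator G x y \<in> power_derived G k"
proof -
  have "inv x \<otimes> inv y \<otimes> inv (inv x) \<otimes> inv (inv y) \<in> derived_set G (carrier G)"
    using assms by blast
  then have "commutator G x y \<in> derived G (carrier G)"
    using assms by (simp add: commutator_def derived_def generate.incl)
  moreover have "\<one> \<in> power_subgroup G k"
    using subgroup.one_closed[OF normal_imp_subgroup[OF power_subgroup_normal]] .
  ultimately have "\<one> \<otimes> commutator G x y \<in> power_derived G k"
    unfolding power_derived_def set_mult_def by blast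
  then show ?thesis using assms by simp
qed

lemma power_derived_least:
  assumes S: "subgroup S G" and powers: "\<And>x. x \<in> carrier G \<Longrightarrow> x [^] k \<in> S"
    and commutators: "\<And>x y. x \<in> carrier G \<Longrightarrow> y \<in> carrier G \<Longrightarrow> commutator G x y \<in> S"
  shows "power_derived G k \<subseteq> S"
proof -
  have "power_subgroup G k \<subseteq> S"
    using generate_subgroup_incl[OF _ S, of "(\<lambda>x. x [^] k) ` carrier G"] powers
      subgroup.one_closed[OF S]
    by (auto simp: power_subgroup_def)
  moreover have "derived G (carrier G) \<subseteq> S"
    using S commutators normal_if_commutators comm_group_Mod_if_commutators
    by (intro derived_minimal) blast+
  ultimately show ?thesis
    unfolding power_derived_def set_mult_def using subgroup.m_closed[OF S] by blast
qed

lemma comm_group_Mod_power_derived: "comm_group (G Mod power_derived G k)"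
  by (intro comm_group_Mod_if_commutators subgroup_power_derived commutator_in_power_derived)

lemma pow_Mod_power_derived:
  assumes "u \<in> carrier (G Mod power_derived G k)"
  shows "u [^]\<^bsub>G Mod power_derived G k\<^esub> k = \<one>\<^bsub>G Mod power_derived G k\<^esub>"
proof -
  interpret normal "power_derived G k" G
    by (intro normal_if_commutators subgroup_power_derived commutator_in_power_derived)
  obtain x where "x \<in> carrier G" "u = power_derived G k #> x"
    using assms by (auto simp: carrier_FactGroup)
  then show ?thesis
    using coset_eq_self_iff[of "x [^] k"] by (simp add: FactGroup_pow pow_in_power_derived)
qed

end

lemma (in group_hom) hom_commutator:
  "x \<in> carrier G \<Longrightarrow> y \<in> carrier G \<Longrightarrow> h (commutator G x y) = commutator H (h x) (h y)"
  by (simp add: commutator_def)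

locale class_two_group = group +
  assumes commutator_central: "\<And>x y. x \<in> carrier G \<Longrightarrow> y \<in> carrier G \<Longrightarrow> commutator G x y \<in> center G"
begin

lemma commutator_mult_left:
  assumes [simp]: "x \<in> carrier G" "y \<in> carrier G" "z \<in> carrier G"
  shows "commutator G (x \<otimes> y) z = commutator G x z \<otimes> commutator G y z"
proof (rule commutator_eqI)
  have "z \<otimes> (x \<otimes> y) \<otimes> (commutator G x z \<otimes> commutator G y z)
    = z \<otimes> x \<otimes> (y \<otimes> commutator G x z) \<otimes> commutator G y z" by (simp add: m_assoc)
  also have "\<dots> = (z \<otimes> x \<otimes> commutator G x z) \<otimes> y \<otimes> commutator G y z"
    using centerD[OF commutator_central[of x z], of y] by (simp add: m_assoc)
  also have "\<dots> = x \<otimes> z \<otimes> y \<otimes> commutator G y z" by (simp add: mult_commutator)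
  also have "\<dots> = x \<otimes> (z \<otimes> y \<otimes> commutator G y z)" by (simp add: m_assoc)
  also have "\<dots> = x \<otimes> y \<otimes> z" by (simp add: mult_commutator m_assoc[of x y z])
  finally show "z \<otimes> (x \<otimes> y) \<otimes> (commutator G x z \<otimes> commutator G y z) = x \<otimes> y \<otimes> z" .
qed auto

lemma commutator_mult_right:
  assumes [simp]: "x \<in> carrier G" "y \<in> carrier G" "z \<in> carrier G"
  shows "commutator G z (x \<otimes> y) = commutator G z x \<otimes> commutator G z y"
proof -
  have "commutator G z (x \<otimes> y) = inv (commutator G x z \<otimes> commutator G y z)"
    using commutator_swap[of "x \<otimes> y" z] by (simp add: commutator_mult_left)
  also have "\<dots> = inv (commutator G y z \<otimes> commutator G x z)"
    using centerD[OF commutator_central[of x z], of "commutator G y z"] by simp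
  also have "\<dots> = commutator G z x \<otimes> commutator G z y"
    by (simp add: inv_mult_group commutator_swap[of x z] commutator_swap[of y z])
  finally show ?thesis .
qed

lemma group_hom_commutator_left: "y \<in> carrier G \<Longrightarrow> group_hom G G (\<lambda>x. commutator G x y)"
  by unfold_locales (simp add: hom_def commutator_mult_left)

lemma group_hom_commutator_right: "x \<in> carrier G \<Longrightarrow> group_hom G G (commutator G x)"
  by unfold_locales (simp add: hom_def commutator_mult_right)

lemma commutator_pow_left:
  "x \<in> carrier G \<Longrightarrow> y \<in> carrier G \<Longrightarrow> commutator G (x [^] (k::nat)) y = commutator G x y [^] k"
  using group_hom.hom_nat_pow[OF group_hom_commutator_left] .

lemma commutator_pow_right:
  "x \<in> carrier G \<Longrightarrow> y \<in> carrier G \<Longrightarrow> commutator G x (y [^] (k::nat)) = commutator G x y [^] k"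
  using group_hom.hom_nat_pow[OF group_hom_commutator_right] .

lemma commutator_pow_mult_central_left:
  assumes "x \<in> carrier G" "c \<in> center G" "y \<in> carrier G"
  shows "commutator G (x [^] (k::nat) \<otimes> c) y = commutator G x y [^] k"
  using assms
  by (simp add: commutator_mult_left commutator_pow_left commutator_center_left center_carrier)

lemma commutator_pow_mult_central_right:
  assumes "x \<in> carrier G" "y \<in> carrier G" "c \<in> center G"
  shows "commutator G x (y [^] (k::nat) \<otimes> c) = commutator G x y [^] k"
  using assms
  by (simp add: commutator_mult_right commutator_pow_right commutator_center_right center_carrier)

end

section \<open>The variety \<open>(m, n)\<close>\<close>

locale variety_group = group G for G (structure) +
  fixes m n :: nat
  assumes in_variety: "in_variety m n G"
begin

abbreviation PD where "PD \<equiv> power_derived G n"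
abbreviation quotient where "quotient \<equiv> G Mod PD"

lemma pow_exponent: "x \<in> carrier G \<Longrightarrow> x [^] m = \<one>"
  and commutator_pow: "x \<in> carrier G \<Longrightarrow> y \<in> carrier G \<Longrightarrow> commutator G x y [^] n = \<one>"
  and commutator_commutator: "x \<in> carrier G \<Longrightarrow> y \<in> carrier G \<Longrightarrow> z \<in> carrier G \<Longrightarrow>
    commutator G (commutator G x y) z = \<one>"
  using in_variety unfolding in_variety_def by blast+

sublocale class_two_group
  by unfold_locales (simp add: centerI commutator_commutator)

lemma pow_central: "x \<in> carrier G \<Longrightarrow> x [^] n \<in> center G"
  by (rule centerI) (auto simp: commutator_pow_left commutator_pow)

lemma PD_central: "PD \<subseteq> center G"
  by (rule power_derived_least[OF center_subgroup pow_central commutator_central])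

sublocale PD: normal PD G
  using subgroup_power_derived PD_central by (rule normal_if_central)

sublocale quotient: comm_group quotient
  by (rule comm_group_Mod_power_derived)

lemma PD_carrier [simp]: "x \<in> PD \<Longrightarrow> x \<in> carrier G"
  by (rule PD.mem_carrier)

lemma comm_group_PD: "comm_group (G\<lparr>carrier := PD\<rparr>)"
  using PD_central centerD
  by (intro group.group_comm_groupI subgroup_imp_group[OF subgroup_power_derived]) auto

lemma coset_in_quotient [simp]: "x \<in> carrier G \<Longrightarrow> PD #> x \<in> carrier quotient"
  by (auto simp: carrier_FactGroup)

lemma quotientE:
  assumes "u \<in> carrier quotient"
  obtains x where "x \<in> carrier G" "u = PD #> x"
  using assms by (auto simp: carrier_FactGroup)

lemma coset_eqE:
  assumes "x \<in> carrier G" "y \<in> carrier G" "PD #> y = PD #> x"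
  obtains c where "c \<in> PD" "y = x \<otimes> c"
proof -
  have "y \<in> PD #> x" using rcos_self[OF assms(2) PD.subgroup_axioms] assms(3) by simp
  then obtain c where c: "c \<in> PD" "y = c \<otimes> x" by (auto simp: r_coset_def)
  then show thesis using that[of c] centerD[of c x] PD_central assms by auto
qed

definition quotient_commutator :: "'a set \<Rightarrow> 'a set \<Rightarrow> 'a" where
  "quotient_commutator u v = commutator G (SOME x. x \<in> u) (SOME y. y \<in> v)"

lemma quotient_commutator_cosets:
  assumes x: "x \<in> carrier G" and y: "y \<in> carrier G"
  shows "quotient_commutator (PD #> x) (PD #> y) = commutator G x y"
proof -
  have representative: "\<exists>c\<in>PD. (SOME z'. z' \<in> PD #> z) = c \<otimes> z" if "z \<in> carrier G" for z
  proof -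
    have "(SOME z'. z' \<in> PD #> z) \<in> PD #> z"
      using rcos_self[OF that PD.subgroup_axioms] by (rule someI)
    then show ?thesis by (auto simp: r_coset_def)
  qed
  obtain c d where c: "c \<in> PD" "(SOME x'. x' \<in> PD #> x) = c \<otimes> x"
    and d: "d \<in> PD" "(SOME y'. y' \<in> PD #> y) = d \<otimes> y"
    using representative[OF x] representative[OF y] by blast
  have "c \<in> center G" "d \<in> center G" using c d PD_central by auto
  then show ?thesis
    using x y c d by (simp add: quotient_commutator_def commutator_mult_left commutator_mult_right
        commutator_center_left commutator_center_right)
qed

sublocale quotient_commutator: bihom quotient quotient "G\<lparr>carrier := PD\<rparr>" quotient_commutator
proof (intro bihom.intro bihom_axioms.intro quotient.group_axioms comm_group_PD)
  fix v assume "v \<in> carrier quotient"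
  then obtain y where y: "y \<in> carrier G" "v = PD #> y" by (rule quotientE)
  show "(\<lambda>u. quotient_commutator u v) \<in> hom quotient (G\<lparr>carrier := PD\<rparr>)"
    using y(1) by (intro homI; elim quotientE)
      (simp_all add: y(2) PD.rcos_sum quotient_commutator_cosets commutator_mult_left
        commutator_in_power_derived)
next
  fix u assume "u \<in> carrier quotient"
  then obtain x where x: "x \<in> carrier G" "u = PD #> x" by (rule quotientE)
  show "quotient_commutator u \<in> hom quotient (G\<lparr>carrier := PD\<rparr>)"
    using x(1) by (intro homI; elim quotientE)
      (simp_all add: x(2) PD.rcos_sum quotient_commutator_cosets commutator_mult_right
        commutator_in_power_derived)
qed

end

lemma variety_groupI: "in_variety m n G \<Longrightarrow> variety_group G m n"
  by (simp add: variety_group_def variety_group_axioms_def in_variety_def)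

lemma in_variety_hom_image:
  assumes G: "in_variety m n G" and H: "group H" and h: "h \<in> hom G H"
    and surj: "h ` carrier G = carrier H"
  shows "in_variety m n H"
proof -
  interpret G: variety_group G m n using G by (rule variety_groupI)
  interpret group_hom G H h using G.group_axioms H h by (rule group_homI)
  have preimage: "\<exists>x\<in>carrier G. y = h x" if "y \<in> carrier H" for y using that surj by blast
  show ?thesis
    unfolding in_variety_def
  proof (intro conjI ballI)
    fix y assume "y \<in> carrier H"
    then show "y [^]\<^bsub>H\<^esub> m = \<one>\<^bsub>H\<^esub>"
      using preimage[of y] by (auto simp: G.pow_exponent simp flip: hom_nat_pow)
  next
    fix y z assume "y \<in> carrier H" "z \<in> carrier H"
    then show "commutator H y z [^]\<^bsub>H\<^esub> n = \<one>\<^bsub>H\<^esub>"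
      using preimage[of y] preimage[of z]
      by (auto simp: G.commutator_pow simp flip: hom_nat_pow hom_commutator)
  next
    fix y z t assume "y \<in> carrier H" "z \<in> carrier H" "t \<in> carrier H"
    then show "commutator H (commutator H y z) t = \<one>\<^bsub>H\<^esub>"
      using preimage[of y] preimage[of z] preimage[of t]
      by (auto simp: G.commutator_commutator simp flip: hom_commutator)
  qed (rule H)
qed

lemma in_variety_Mod:
  assumes G: "in_variety m n G" and N: "N \<lhd> G"
  shows "in_variety m n (G Mod N)"
  using G normal.factorgroup_is_group[OF N] normal.r_coset_hom_Mod[OF N]
  by (rule in_variety_hom_image) (simp add: carrier_FactGroup)

lemma hom_power_derived_central:
  assumes "group G" "in_variety m n M" and h: "h \<in> hom G M" and x: "x \<in> power_derived G n"
  shows "h x \<in> center M"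
proof -
  interpret M: variety_group M m n using assms(2) by (rule variety_groupI)
  interpret group_hom G M h using assms(1) M.group_axioms h by (rule group_homI)
  have "subgroup {x \<in> carrier G. h x \<in> center M} G"
    using M.center_subgroup by unfold_locales
      (auto simp: subgroup.m_closed subgroup.one_closed subgroup.m_inv_closed)
  then have "power_derived G n \<subseteq> {x \<in> carrier G. h x \<in> center M}"
    by (rule G.power_derived_least)
      (auto simp: hom_nat_pow hom_commutator M.pow_central M.commutator_central)
  then show ?thesis using x by blast
qed

section \<open>Amalgamating along a pairing\<close>

context bihom
begin

lemma commutator_left [simp]:
  assumes "x \<in> carrier G" "x' \<in> carrier G" "y \<in> carrier H"
  shows "\<beta> (commutator G x x') y = \<one>\<^bsub>V\<^esub>"
  using assms group_hom.hom_commutator[OF group_hom_left, of y x x']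
  by (simp add: V.commutator_eq_one_iff V.m_comm)

lemma commutator_right [simp]:
  assumes "x \<in> carrier G" "y \<in> carrier H" "y' \<in> carrier H"
  shows "\<beta> x (commutator H y y') = \<one>\<^bsub>V\<^esub>"
  using assms group_hom.hom_commutator[OF group_hom_right, of x y y']
  by (simp add: V.commutator_eq_one_iff V.m_comm)

text \<open>The triple \<open>(x, y, v)\<close> stands for the product \<open>x y v\<close> with \<open>v\<close> central and
  \<open>[x, y] = \<beta> x y\<close>.\<close>

definition twisted_product :: "('g \<times> 'h \<times> 'v) monoid" where
  "twisted_product = \<lparr>carrier = carrier G \<times> carrier H \<times> carrier V,
    mult = (\<lambda>(x, y, v) (x', y', v').
      (x \<otimes>\<^bsub>G\<^esub> x', y \<otimes>\<^bsub>H\<^esub> y', v \<otimes>\<^bsub>V\<^esub> v' \<otimes>\<^bsub>V\<^esub> inv\<^bsub>V\<^esub> \<beta> x' y)),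
    one = (\<one>\<^bsub>G\<^esub>, \<one>\<^bsub>H\<^esub>, \<one>\<^bsub>V\<^esub>)\<rparr>"

lemma carrier_twisted_product: "carrier twisted_product = carrier G \<times> carrier H \<times> carrier V"
  and mult_twisted_product: "(x, y, v) \<otimes>\<^bsub>twisted_product\<^esub> (x', y', v')
    = (x \<otimes>\<^bsub>G\<^esub> x', y \<otimes>\<^bsub>H\<^esub> y', v \<otimes>\<^bsub>V\<^esub> v' \<otimes>\<^bsub>V\<^esub> inv\<^bsub>V\<^esub> \<beta> x' y)"
  and one_twisted_product: "\<one>\<^bsub>twisted_product\<^esub> = (\<one>\<^bsub>G\<^esub>, \<one>\<^bsub>H\<^esub>, \<one>\<^bsub>V\<^esub>)"
  by (simp_all add: twisted_product_def)

lemma twisted_productE: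
  assumes "u \<in> carrier twisted_product"
  obtains x y v where "x \<in> carrier G" "y \<in> carrier H" "v \<in> carrier V" "u = (x, y, v)"
  using assms by (auto simp: carrier_twisted_product)

sublocale twisted_product: group twisted_product
proof (rule groupI)
  fix s t u
  assume "s \<in> carrier twisted_product" "t \<in> carrier twisted_product" "u \<in> carrier twisted_product"
  then show "s \<otimes>\<^bsub>twisted_product\<^esub> t \<otimes>\<^bsub>twisted_product\<^esub> u
      = s \<otimes>\<^bsub>twisted_product\<^esub> (t \<otimes>\<^bsub>twisted_product\<^esub> u)"
    by (auto simp: carrier_twisted_product mult_twisted_product G.m_assoc H.m_assoc
        mult_left mult_right V.inv_mult V.m_ac)
next
  fix u assume "u \<in> carrier twisted_product"
  then obtain x y v where u: "u = (x, y, v)" "x \<in> carrier G" "y \<in> carrier H" "v \<in> carrier V"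
    by (rule twisted_productE)
  let ?w = "inv\<^bsub>V\<^esub> v \<otimes>\<^bsub>V\<^esub> inv\<^bsub>V\<^esub> \<beta> x y"
  have "?w \<otimes>\<^bsub>V\<^esub> v \<otimes>\<^bsub>V\<^esub> \<beta> x y = ?w \<otimes>\<^bsub>V\<^esub> (\<beta> x y \<otimes>\<^bsub>V\<^esub> v)"
    using u by (simp add: V.m_assoc V.m_comm[of v "\<beta> x y"])
  also have "\<dots> = \<one>\<^bsub>V\<^esub>" using u by (simp flip: V.inv_mult_group)
  finally show "\<exists>s\<in>carrier twisted_product. s \<otimes>\<^bsub>twisted_product\<^esub> u = \<one>\<^bsub>twisted_product\<^esub>"
    using u by (intro bexI[of _ "(inv\<^bsub>G\<^esub> x, inv\<^bsub>H\<^esub> y, ?w)"])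
      (simp_all add: carrier_twisted_product mult_twisted_product one_twisted_product inv_right)
qed (auto simp: carrier_twisted_product mult_twisted_product one_twisted_product)

lemma commutator_twisted_product:
  assumes "x \<in> carrier G" "y \<in> carrier H" "v \<in> carrier V"
    and "x' \<in> carrier G" "y' \<in> carrier H" "v' \<in> carrier V"
  shows "commutator twisted_product (x, y, v) (x', y', v')
    = (commutator G x x', commutator H y y', \<beta> x y' \<otimes>\<^bsub>V\<^esub> inv\<^bsub>V\<^esub> \<beta> x' y)"
proof (rule twisted_product.commutator_eqI)
  have "v' \<otimes>\<^bsub>V\<^esub> v \<otimes>\<^bsub>V\<^esub> i \<otimes>\<^bsub>V\<^esub> k = v \<otimes>\<^bsub>V\<^esub> v' \<otimes>\<^bsub>V\<^esub> (i \<otimes>\<^bsub>V\<^esub> k)" if "i \<in> carrier V" "k \<in> carrier V" for i k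
    using that assms by (simp add: V.m_ac)
  moreover have "inv\<^bsub>V\<^esub> \<beta> x y' \<otimes>\<^bsub>V\<^esub> (\<beta> x y' \<otimes>\<^bsub>V\<^esub> inv\<^bsub>V\<^esub> \<beta> x' y) = inv\<^bsub>V\<^esub> \<beta> x' y"
    using assms by (simp flip: V.m_assoc)
  ultimately show "(x', y', v') \<otimes>\<^bsub>twisted_product\<^esub> (x, y, v) \<otimes>\<^bsub>twisted_product\<^esub>
      (commutator G x x', commutator H y y', \<beta> x y' \<otimes>\<^bsub>V\<^esub> inv\<^bsub>V\<^esub> \<beta> x' y)
    = (x, y, v) \<otimes>\<^bsub>twisted_product\<^esub> (x', y', v')"
    using assms by (simp add: mult_twisted_product G.mult_commutator H.mult_commutator)
qed (use assms in \<open>auto simp: carrier_twisted_product\<close>)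

lemma pow_twisted_product:
  assumes "x \<in> carrier G" "y \<in> carrier H" "v \<in> carrier V"
  shows "(x, y, v) [^]\<^bsub>twisted_product\<^esub> (k::nat)
    = (x [^]\<^bsub>G\<^esub> k, y [^]\<^bsub>H\<^esub> k, v [^]\<^bsub>V\<^esub> k \<otimes>\<^bsub>V\<^esub> inv\<^bsub>V\<^esub> (\<beta> x y [^]\<^bsub>V\<^esub> (k choose 2)))"
proof (induction k)
  case 0
  then show ?case using assms by (simp add: one_twisted_product numeral_2_eq_2)
next
  case (Suc k)
  have "Suc k choose 2 = (k choose 2) + k" by (simp add: numeral_2_eq_2)
  then show ?case
    using assms Suc
    by (simp add: mult_twisted_product pow_right V.inv_mult V.m_ac flip: V.nat_pow_mult)
qed

lemma in_variety_twisted_product: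
  assumes G: "in_variety m n G" and H: "in_variety m n H" and n: "n dvd m choose 2"
    and V: "\<And>v. v \<in> carrier V \<Longrightarrow> v [^]\<^bsub>V\<^esub> m = \<one>\<^bsub>V\<^esub>"
    and \<beta>: "\<And>x y. x \<in> carrier G \<Longrightarrow> y \<in> carrier H \<Longrightarrow> \<beta> x y [^]\<^bsub>V\<^esub> n = \<one>\<^bsub>V\<^esub>"
  shows "in_variety m n twisted_product"
  unfolding in_variety_def
proof (intro conjI ballI twisted_product.group_axioms; elim twisted_productE)
  interpret G: variety_group G m n using G by (rule variety_groupI)
  interpret H: variety_group H m n using H by (rule variety_groupI)
  fix u x y v assume u: "u = (x, y, v)" "x \<in> carrier G" "y \<in> carrier H" "v \<in> carrier V"
  obtain k where k: "m choose 2 = n * k" using n by blast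
  have "\<beta> x y [^]\<^bsub>V\<^esub> (m choose 2) = \<one>\<^bsub>V\<^esub>" using u \<beta> by (simp add: k flip: V.nat_pow_pow)
  then show "u [^]\<^bsub>twisted_product\<^esub> m = \<one>\<^bsub>twisted_product\<^esub>"
    using u V by (simp add: pow_twisted_product one_twisted_product G.pow_exponent H.pow_exponent)
  fix u' x' y' v' assume u': "u' = (x', y', v')" "x' \<in> carrier G" "y' \<in> carrier H" "v' \<in> carrier V"
  show "commutator twisted_product u u' [^]\<^bsub>twisted_product\<^esub> n = \<one>\<^bsub>twisted_product\<^esub>"
    using u u' \<beta> by (simp add: commutator_twisted_product pow_twisted_product one_twisted_product
        G.commutator_pow H.commutator_pow V.nat_pow_distrib V.nat_pow_inv)
  fix u'' x'' y'' v''
  assume u'': "u'' = (x'', y'', v'')" "x'' \<in> carrier G" "y'' \<in> carrier H" "v'' \<in> carrier V"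
  show "commutator twisted_product (commutator twisted_product u u') u'' = \<one>\<^bsub>twisted_product\<^esub>"
    using u u' u'' by (simp add: commutator_twisted_product one_twisted_product
        G.commutator_commutator H.commutator_commutator)
qed

end

lemma dvd_if_dvd_div_gcd_2:
  fixes m n :: nat
  assumes "n dvd m div gcd 2 m"
  shows "n dvd m"
  using assms by (metis dvd_div_mult_self dvd_mult2 gcd_dvd2)

lemma dvd_choose_two_if_dvd_div_gcd_2:
  fixes m n :: nat
  assumes "n dvd m div gcd 2 m"
  shows "n dvd m choose 2"
proof (cases "even m")
  case True
  then obtain t where t: "m = 2 * t" by blast
  then have "m choose 2 = t * (m - 1)" by (simp add: choose_two)
  then show ?thesis using assms t by simp
next
  case False
  then obtain t where "m = 2 * t + 1" by (rule oddE)
  then have "m choose 2 = m * t" by (simp add: choose_two)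
  then show ?thesis using dvd_if_dvd_div_gcd_2[OF assms] by simp
qed

section \<open>Strong embeddings\<close>

definition intersection_central ::
  "nat \<Rightarrow> ('a, 'x) monoid_scheme \<Rightarrow> ('b, 'y) monoid_scheme \<Rightarrow> ('d, 'z) monoid_scheme \<Rightarrow>
   ('d \<Rightarrow> 'a) \<Rightarrow> ('d \<Rightarrow> 'b) \<Rightarrow> bool" where
  "intersection_central n A B D \<iota>\<^sub>A \<iota>\<^sub>B \<longleftrightarrow>
     (\<forall>d \<in> carrier D. \<iota>\<^sub>A d \<in> power_derived A n \<longrightarrow> \<iota>\<^sub>B d \<in> center B)"

definition commutators_agree ::
  "nat \<Rightarrow> nat \<Rightarrow> ('a, 'x) monoid_scheme \<Rightarrow> ('b, 'y) monoid_scheme \<Rightarrow> ('d, 'z) monoid_scheme \<Rightarrow>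
   ('d \<Rightarrow> 'a) \<Rightarrow> ('d \<Rightarrow> 'b) \<Rightarrow> bool" where
  "commutators_agree n q A B D \<iota>\<^sub>A \<iota>\<^sub>B \<longleftrightarrow>
     (\<forall>a \<in> carrier A. \<forall>a' \<in> power_derived A n. \<forall>b \<in> carrier B. \<forall>b' \<in> power_derived B n.
      \<forall>d\<^sub>1 \<in> carrier D. \<forall>d\<^sub>2 \<in> carrier D.
        \<iota>\<^sub>A d\<^sub>1 = a [^]\<^bsub>A\<^esub> q \<otimes>\<^bsub>A\<^esub> a' \<longrightarrow> \<iota>\<^sub>B d\<^sub>2 = b [^]\<^bsub>B\<^esub> q \<otimes>\<^bsub>B\<^esub> b' \<longrightarrow>
        (\<exists>d \<in> carrier D. \<iota>\<^sub>B d = commutator B (\<iota>\<^sub>B d\<^sub>1) b \<and> \<iota>\<^sub>A d = commutator A a (\<iota>\<^sub>A d\<^sub>2)))"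

locale variety_amalgam =
  fixes m n :: nat
    and A :: "('a, 'as) monoid_scheme" and B :: "('b, 'bs) monoid_scheme"
    and D :: "('d, 'ds) monoid_scheme"
    and \<iota>\<^sub>A :: "'d \<Rightarrow> 'a" and \<iota>\<^sub>B :: "'d \<Rightarrow> 'b"
  assumes amalgam: "amalgam m n A B D \<iota>\<^sub>A \<iota>\<^sub>B"
begin

sublocale A: variety_group A m n using amalgam by (simp add: amalgam_def variety_groupI)
sublocale B: variety_group B m n using amalgam by (simp add: amalgam_def variety_groupI)
sublocale D: group D using amalgam by (simp add: amalgam_def in_variety_def)
sublocale \<iota>\<^sub>A: group_hom D A \<iota>\<^sub>A using amalgam by unfold_locales (simp add: amalgam_def mon_def)
sublocale \<iota>\<^sub>B: group_hom D B \<iota>\<^sub>B using amalgam by unfold_locales (simp add: amalgam_def mon_def)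

lemma \<iota>\<^sub>A_eq_one_iff [simp]: "d \<in> carrier D \<Longrightarrow> \<iota>\<^sub>A d = \<one>\<^bsub>A\<^esub> \<longleftrightarrow> d = \<one>\<^bsub>D\<^esub>"
  and \<iota>\<^sub>B_eq_one_iff [simp]: "d \<in> carrier D \<Longrightarrow> \<iota>\<^sub>B d = \<one>\<^bsub>B\<^esub> \<longleftrightarrow> d = \<one>\<^bsub>D\<^esub>"
  using amalgam \<iota>\<^sub>A.inj_on_one_iff \<iota>\<^sub>B.inj_on_one_iff by (auto simp: amalgam_def mon_def)

lemma swap: "variety_amalgam m n B A D \<iota>\<^sub>B \<iota>\<^sub>A"
  using amalgam by (simp add: variety_amalgam_def amalgam_def)

lemma strong_embedding_swap:
  assumes "strong_embedding m n A B D \<iota>\<^sub>A \<iota>\<^sub>B M \<phi>\<^sub>A \<phi>\<^sub>B"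
  shows "strong_embedding m n B A D \<iota>\<^sub>B \<iota>\<^sub>A M \<phi>\<^sub>B \<phi>\<^sub>A"
proof -
  have "\<phi>\<^sub>A ` \<iota>\<^sub>A ` carrier D = \<phi>\<^sub>B ` \<iota>\<^sub>B ` carrier D"
    using assms by (auto simp: strong_embedding_def image_image)
  then show ?thesis using assms by (auto simp: strong_embedding_def Int_commute)
qed

lemma intersection_central_if_strong_embedding:
  assumes "strong_embedding m n A B D \<iota>\<^sub>A \<iota>\<^sub>B M \<phi>\<^sub>A \<phi>\<^sub>B"
  shows "intersection_central n A B D \<iota>\<^sub>A \<iota>\<^sub>B"
  unfolding intersection_central_def
proof (intro ballI impI)
  fix d assume d: "d \<in> carrier D" and PD: "\<iota>\<^sub>A d \<in> A.PD"
  have M: "in_variety m n M" and \<phi>\<^sub>A: "\<phi>\<^sub>A \<in> hom A M" and \<phi>\<^sub>B: "\<phi>\<^sub>B \<in> hom B M" "inj_on \<phi>\<^sub>B (carrier B)"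
    and agree: "\<phi>\<^sub>A (\<iota>\<^sub>A d) = \<phi>\<^sub>B (\<iota>\<^sub>B d)"
    using assms d by (auto simp: strong_embedding_def mon_def)
  interpret M: variety_group M m n using M by (rule variety_groupI)
  interpret \<phi>\<^sub>B: group_hom B M \<phi>\<^sub>B by unfold_locales (rule \<phi>\<^sub>B(1))
  have "\<phi>\<^sub>B (\<iota>\<^sub>B d) \<in> center M"
    using hom_power_derived_central[OF A.group_axioms M \<phi>\<^sub>A PD] by (simp add: agree)
  then have "commutator B (\<iota>\<^sub>B d) b = \<one>\<^bsub>B\<^esub>" if "b \<in> carrier B" for b
    using that d inj_onD[OF \<phi>\<^sub>B(2), of "commutator B (\<iota>\<^sub>B d) b" "\<one>\<^bsub>B\<^esub>"]
    by (simp add: \<phi>\<^sub>B.hom_commutator M.commutator_center_left)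
  then show "\<iota>\<^sub>B d \<in> center B" using d by (intro B.centerI) simp_all
qed

lemma strong_embedding_meetE:
  assumes emb: "strong_embedding m n A B D \<iota>\<^sub>A \<iota>\<^sub>B M \<phi>\<^sub>A \<phi>\<^sub>B"
    and a: "a \<in> carrier A" and b: "b \<in> carrier B" and meet: "\<phi>\<^sub>A a = \<phi>\<^sub>B b"
  obtains d where "d \<in> carrier D" "\<iota>\<^sub>A d = a" "\<iota>\<^sub>B d = b"
proof -
  have "\<phi>\<^sub>A a \<in> \<phi>\<^sub>A ` carrier A \<inter> \<phi>\<^sub>B ` carrier B"
    using imageI[OF a, of \<phi>\<^sub>A] imageI[OF b, of \<phi>\<^sub>B] meet by simp
  then obtain d where d: "d \<in> carrier D" "\<phi>\<^sub>A a = \<phi>\<^sub>A (\<iota>\<^sub>A d)"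
    using emb unfolding strong_embedding_def by blast
  then have "\<phi>\<^sub>B b = \<phi>\<^sub>B (\<iota>\<^sub>B d)" using emb meet by (simp add: strong_embedding_def)
  then have "\<iota>\<^sub>A d = a" "\<iota>\<^sub>B d = b"
    using emb a b d inj_onD[of \<phi>\<^sub>A "carrier A" a "\<iota>\<^sub>A d"] inj_onD[of \<phi>\<^sub>B "carrier B" b "\<iota>\<^sub>B d"]
    by (simp_all add: strong_embedding_def mon_def)
  with d(1) show thesis by (rule that)
qed

lemma commutators_agree_if_strong_embedding:
  assumes "strong_embedding m n A B D \<iota>\<^sub>A \<iota>\<^sub>B M \<phi>\<^sub>A \<phi>\<^sub>B"
  shows "commutators_agree n q A B D \<iota>\<^sub>A \<iota>\<^sub>B"
  unfolding commutators_agree_def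
proof (intro ballI impI)
  fix a a' b b' d e
  assume a: "a \<in> carrier A" "a' \<in> A.PD" and b: "b \<in> carrier B" "b' \<in> B.PD"
    and d: "d \<in> carrier D" "\<iota>\<^sub>A d = a [^]\<^bsub>A\<^esub> q \<otimes>\<^bsub>A\<^esub> a'" and e: "e \<in> carrier D" "\<iota>\<^sub>B e = b [^]\<^bsub>B\<^esub> q \<otimes>\<^bsub>B\<^esub> b'"
  have M: "in_variety m n M" and \<phi>\<^sub>A: "\<phi>\<^sub>A \<in> hom A M" and \<phi>\<^sub>B: "\<phi>\<^sub>B \<in> hom B M"
    and agree: "\<And>d. d \<in> carrier D \<Longrightarrow> \<phi>\<^sub>A (\<iota>\<^sub>A d) = \<phi>\<^sub>B (\<iota>\<^sub>B d)"
    using assms by (auto simp: strong_embedding_def mon_def)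
  interpret M: variety_group M m n using M by (rule variety_groupI)
  interpret \<phi>\<^sub>A: group_hom A M \<phi>\<^sub>A by unfold_locales (rule \<phi>\<^sub>A)
  interpret \<phi>\<^sub>B: group_hom B M \<phi>\<^sub>B by unfold_locales (rule \<phi>\<^sub>B)
  let ?b = "commutator B (\<iota>\<^sub>B d) b" and ?a = "commutator A a (\<iota>\<^sub>A e)"
  have central: "\<phi>\<^sub>A a' \<in> center M" "\<phi>\<^sub>B b' \<in> center M"
    using hom_power_derived_central[OF A.group_axioms M \<phi>\<^sub>A a(2)]
      hom_power_derived_central[OF B.group_axioms M \<phi>\<^sub>B b(2)] .
  have d_image: "\<phi>\<^sub>B (\<iota>\<^sub>B d) = \<phi>\<^sub>A a [^]\<^bsub>M\<^esub> q \<otimes>\<^bsub>M\<^esub> \<phi>\<^sub>A a'"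
    using a agree[OF d(1)] by (simp add: d(2) \<phi>\<^sub>A.hom_nat_pow)
  have e_image: "\<phi>\<^sub>A (\<iota>\<^sub>A e) = \<phi>\<^sub>B b [^]\<^bsub>M\<^esub> q \<otimes>\<^bsub>M\<^esub> \<phi>\<^sub>B b'"
    using b agree[OF e(1)] by (simp add: e(2) \<phi>\<^sub>B.hom_nat_pow)
  have "\<phi>\<^sub>B ?b = commutator M (\<phi>\<^sub>A a) (\<phi>\<^sub>B b) [^]\<^bsub>M\<^esub> q"
    using a(1) b(1) d(1) central(1)
    by (simp add: \<phi>\<^sub>B.hom_commutator d_image M.commutator_pow_mult_central_left)
  also have "\<dots> = \<phi>\<^sub>A ?a"
    using a(1) b(1) e(1) central(2)
    by (simp add: \<phi>\<^sub>A.hom_commutator e_image M.commutator_pow_mult_central_right)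
  finally have "\<phi>\<^sub>A ?a = \<phi>\<^sub>B ?b" ..
  then obtain f where "f \<in> carrier D" "\<iota>\<^sub>A f = ?a" "\<iota>\<^sub>B f = ?b"
    using a(1) b(1) d(1) e(1) by (elim strong_embedding_meetE[OF assms, rotated 2]) simp_all
  then show "\<exists>f\<in>carrier D. \<iota>\<^sub>B f = ?b \<and> \<iota>\<^sub>A f = ?a" by blast
qed

lemma strong_embedding_Mod:
  fixes K :: "('k, 'ks) monoid_scheme"
  assumes K: "in_variety m n K" and f: "f \<in> hom A K" and g: "g \<in> hom B K" and N: "N \<lhd> K"
    and meet: "\<And>a b. a \<in> carrier A \<Longrightarrow> b \<in> carrier B \<Longrightarrow>
      N #>\<^bsub>K\<^esub> f a = N #>\<^bsub>K\<^esub> g b \<longleftrightarrow> (\<exists>d\<in>carrier D. a = \<iota>\<^sub>A d \<and> b = \<iota>\<^sub>B d)"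
  shows "strong_embedding m n A B D \<iota>\<^sub>A \<iota>\<^sub>B (K Mod N) (\<lambda>a. N #>\<^bsub>K\<^esub> f a) (\<lambda>b. N #>\<^bsub>K\<^esub> g b)"
proof -
  interpret N: normal N K by (rule N)
  interpret f: group_hom A "K Mod N" "\<lambda>a. N #>\<^bsub>K\<^esub> f a"
    using hom_compose[OF f N.r_coset_hom_Mod]
    by (intro group_homI A.group_axioms N.factorgroup_is_group) (simp add: comp_def)
  interpret g: group_hom B "K Mod N" "\<lambda>b. N #>\<^bsub>K\<^esub> g b"
    using hom_compose[OF g N.r_coset_hom_Mod]
    by (intro group_homI B.group_axioms N.factorgroup_is_group) (simp add: comp_def)
  have "a = \<one>\<^bsub>A\<^esub>" if "a \<in> carrier A" "N #>\<^bsub>K\<^esub> f a = \<one>\<^bsub>K Mod N\<^esub>" for a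
    using that meet[of a "\<one>\<^bsub>B\<^esub>"] g.hom_one by (auto simp: eq_commute[of "\<one>\<^bsub>B\<^esub>"])
  then have "(\<lambda>a. N #>\<^bsub>K\<^esub> f a) \<in> mon A (K Mod N)"
    using f.homh f.inj_on_one_iff by (simp add: mon_def)
  moreover have "b = \<one>\<^bsub>B\<^esub>" if "b \<in> carrier B" "N #>\<^bsub>K\<^esub> g b = \<one>\<^bsub>K Mod N\<^esub>" for b
    using that meet[of "\<one>\<^bsub>A\<^esub>" b] f.hom_one by (auto simp: eq_commute[of "\<one>\<^bsub>A\<^esub>"])
  then have "(\<lambda>b. N #>\<^bsub>K\<^esub> g b) \<in> mon B (K Mod N)"
    using g.homh g.inj_on_one_iff by (simp add: mon_def)
  moreover have "in_variety m n (K Mod N)"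
    using K N by (rule in_variety_Mod)
  moreover have agree: "N #>\<^bsub>K\<^esub> f (\<iota>\<^sub>A d) = N #>\<^bsub>K\<^esub> g (\<iota>\<^sub>B d)" if "d \<in> carrier D" for d
    using that meet[of "\<iota>\<^sub>A d" "\<iota>\<^sub>B d"] by auto
  moreover have "(\<lambda>a. N #>\<^bsub>K\<^esub> f a) ` carrier A \<inter> (\<lambda>b. N #>\<^bsub>K\<^esub> g b) ` carrier B
      = (\<lambda>a. N #>\<^bsub>K\<^esub> f a) ` \<iota>\<^sub>A ` carrier D"
  proof (intro equalityI subsetI)
    fix u assume "u \<in> (\<lambda>a. N #>\<^bsub>K\<^esub> f a) ` carrier A \<inter> (\<lambda>b. N #>\<^bsub>K\<^esub> g b) ` carrier B"
    then show "u \<in> (\<lambda>a. N #>\<^bsub>K\<^esub> f a) ` \<iota>\<^sub>A ` carrier D" using meet by auto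
  next
    fix u assume "u \<in> (\<lambda>a. N #>\<^bsub>K\<^esub> f a) ` \<iota>\<^sub>A ` carrier D"
    then obtain d where "d \<in> carrier D" "u = N #>\<^bsub>K\<^esub> f (\<iota>\<^sub>A d)" by blast
    then show "u \<in> (\<lambda>a. N #>\<^bsub>K\<^esub> f a) ` carrier A \<inter> (\<lambda>b. N #>\<^bsub>K\<^esub> g b) ` carrier B"
      using agree[of d] by auto
  qed
  ultimately show ?thesis by (simp add: strong_embedding_def)
qed

lemma strongly_embeddable_if_central_quotient:
  fixes K :: "('k, 'ks) monoid_scheme"
  assumes K: "in_variety m n K" and f: "f \<in> hom A K" and g: "g \<in> hom B K"
    and central: "\<And>d. d \<in> carrier D \<Longrightarrow> f (\<iota>\<^sub>A d) \<otimes>\<^bsub>K\<^esub> inv\<^bsub>K\<^esub> g (\<iota>\<^sub>B d) \<in> center K"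
    and separate: "\<And>a b d. a \<in> carrier A \<Longrightarrow> b \<in> carrier B \<Longrightarrow> d \<in> carrier D \<Longrightarrow>
      f a \<otimes>\<^bsub>K\<^esub> inv\<^bsub>K\<^esub> g b = f (\<iota>\<^sub>A d) \<otimes>\<^bsub>K\<^esub> inv\<^bsub>K\<^esub> g (\<iota>\<^sub>B d) \<Longrightarrow>
      \<exists>e\<in>carrier D. a = \<iota>\<^sub>A e \<and> b = \<iota>\<^sub>B e"
  shows "strongly_embeddable m n A B D \<iota>\<^sub>A \<iota>\<^sub>B"
proof -
  interpret K: variety_group K m n using K by (rule variety_groupI)
  interpret f: group_hom A K f by unfold_locales (rule f)
  interpret g: group_hom B K g by unfold_locales (rule g)
  define c where "c = (\<lambda>d. f (\<iota>\<^sub>A d) \<otimes>\<^bsub>K\<^esub> inv\<^bsub>K\<^esub> g (\<iota>\<^sub>B d))"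
  define N where "N = c ` carrier D"
  have "(\<lambda>d. f (\<iota>\<^sub>A d)) \<in> hom D K" "(\<lambda>d. g (\<iota>\<^sub>B d)) \<in> hom D K"
    using hom_compose[OF \<iota>\<^sub>A.homh f] hom_compose[OF \<iota>\<^sub>B.homh g] by (simp_all add: comp_def)
  then have "c \<in> hom D K" unfolding c_def using central by (rule K.central_quotient_hom)
  then interpret c: group_hom D K c by unfold_locales
  have "subgroup N K" unfolding N_def by (rule c.img_is_subgroup)
  moreover have "N \<subseteq> center K" using central by (auto simp: N_def c_def)
  ultimately interpret N: normal N K by (rule K.normal_if_central)
  have "N #>\<^bsub>K\<^esub> f a = N #>\<^bsub>K\<^esub> g b \<longleftrightarrow> (\<exists>d\<in>carrier D. a = \<iota>\<^sub>A d \<and> b = \<iota>\<^sub>B d)"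
    if a: "a \<in> carrier A" and b: "b \<in> carrier B" for a b
  proof
    assume "N #>\<^bsub>K\<^esub> f a = N #>\<^bsub>K\<^esub> g b"
    then have "f a \<in> N #>\<^bsub>K\<^esub> g b" using K.rcos_self[OF f.hom_closed[OF a] N.subgroup_axioms] by simp
    then obtain d where "d \<in> carrier D" "f a = c d \<otimes>\<^bsub>K\<^esub> g b" by (auto simp: r_coset_def N_def)
    then show "\<exists>d\<in>carrier D. a = \<iota>\<^sub>A d \<and> b = \<iota>\<^sub>B d"
      using a b by (intro separate[of a b d]) (simp_all add: c_def K.m_assoc)
  next
    assume "\<exists>d\<in>carrier D. a = \<iota>\<^sub>A d \<and> b = \<iota>\<^sub>B d"
    then obtain d where d: "d \<in> carrier D" "a = \<iota>\<^sub>A d" "b = \<iota>\<^sub>B d" by blast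
    then show "N #>\<^bsub>K\<^esub> f a = N #>\<^bsub>K\<^esub> g b"
      using N.coset_mult_absorb[of "c d" "g b"] by (simp add: N_def c_def K.m_assoc)
  qed
  then show ?thesis
    by (rule strongly_embeddableI[OF amalgam strong_embedding_Mod[OF K f g N.normal_axioms]])
qed

end

locale amalgam_pairing =
  variety_amalgam m n A B D \<iota>\<^sub>A \<iota>\<^sub>B + bihom A B V \<beta>
  for m n :: nat and A :: "('a, 'as) monoid_scheme" and B :: "('b, 'bs) monoid_scheme"
    and D :: "('d, 'ds) monoid_scheme" and \<iota>\<^sub>A :: "'d \<Rightarrow> 'a" and \<iota>\<^sub>B :: "'d \<Rightarrow> 'b"
    and V :: "('v, 'vs) monoid_scheme" and \<beta> :: "'a \<Rightarrow> 'b \<Rightarrow> 'v" +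
  fixes z\<^sub>A :: "'a \<Rightarrow> 'v" and z\<^sub>B :: "'b \<Rightarrow> 'v"
  assumes n_dvd: "n dvd m choose 2"
    and V_exponent: "\<And>v. v \<in> carrier V \<Longrightarrow> v [^]\<^bsub>V\<^esub> m = \<one>\<^bsub>V\<^esub>"
    and z\<^sub>A: "z\<^sub>A \<in> hom (A\<lparr>carrier := A.PD\<rparr>) V" and z\<^sub>B: "z\<^sub>B \<in> hom (B\<lparr>carrier := B.PD\<rparr>) V"
    and separate: "\<And>x y. x \<in> A.PD \<Longrightarrow> y \<in> B.PD \<Longrightarrow> z\<^sub>A x \<otimes>\<^bsub>V\<^esub> z\<^sub>B y = \<one>\<^bsub>V\<^esub> \<Longrightarrow>
      \<exists>e\<in>carrier D. x = \<iota>\<^sub>A e \<and> y = inv\<^bsub>B\<^esub> \<iota>\<^sub>B e"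
    and \<beta>_PD_left: "\<And>a b. a \<in> A.PD \<Longrightarrow> b \<in> carrier B \<Longrightarrow> \<beta> a b = \<one>\<^bsub>V\<^esub>"
    and \<beta>_PD_right: "\<And>a b. a \<in> carrier A \<Longrightarrow> b \<in> B.PD \<Longrightarrow> \<beta> a b = \<one>\<^bsub>V\<^esub>"
    and \<beta>_D_right: "\<And>a d. a \<in> carrier A \<Longrightarrow> d \<in> carrier D \<Longrightarrow>
      \<beta> a (\<iota>\<^sub>B d) = z\<^sub>A (commutator A a (\<iota>\<^sub>A d))"
    and \<beta>_D_left: "\<And>b d. b \<in> carrier B \<Longrightarrow> d \<in> carrier D \<Longrightarrow>
      \<beta> (\<iota>\<^sub>A d) b = z\<^sub>B (commutator B (\<iota>\<^sub>B d) b)"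
begin

abbreviation K where "K \<equiv> twisted_product"

sublocale z\<^sub>A: group_hom "A\<lparr>carrier := A.PD\<rparr>" V z\<^sub>A
  using comm_group.axioms(2)[OF A.comm_group_PD] V.group_axioms z\<^sub>A by (rule group_homI)

sublocale z\<^sub>B: group_hom "B\<lparr>carrier := B.PD\<rparr>" V z\<^sub>B
  using comm_group.axioms(2)[OF B.comm_group_PD] V.group_axioms z\<^sub>B by (rule group_homI)

lemma z\<^sub>A_closed [simp]: "x \<in> A.PD \<Longrightarrow> z\<^sub>A x \<in> carrier V"
  and z\<^sub>B_closed [simp]: "y \<in> B.PD \<Longrightarrow> z\<^sub>B y \<in> carrier V"
  using z\<^sub>A.hom_closed z\<^sub>B.hom_closed by simp_all

lemma z\<^sub>A_inv: "x \<in> A.PD \<Longrightarrow> z\<^sub>A (inv\<^bsub>A\<^esub> x) = inv\<^bsub>V\<^esub> z\<^sub>A x"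
  and z\<^sub>B_inv: "y \<in> B.PD \<Longrightarrow> z\<^sub>B (inv\<^bsub>B\<^esub> y) = inv\<^bsub>V\<^esub> z\<^sub>B y"
  using z\<^sub>A.hom_inv[of x] z\<^sub>B.hom_inv[of y]
  by (simp_all add: A.m_inv_consistent[OF A.subgroup_power_derived]
      B.m_inv_consistent[OF B.subgroup_power_derived])

lemma in_variety_K: "in_variety m n K"
proof (rule in_variety_twisted_product[OF A.in_variety B.in_variety n_dvd V_exponent])
  show "\<beta> a b [^]\<^bsub>V\<^esub> n = \<one>\<^bsub>V\<^esub>" if "a \<in> carrier A" "b \<in> carrier B" for a b
    using that \<beta>_PD_left[of "a [^]\<^bsub>A\<^esub> n" b] by (simp add: A.pow_in_power_derived pow_left)
qed

text \<open>In \<open>K\<close> the subgroups \<open>A\<^sup>n A'\<close> and \<open>B\<^sup>n B'\<close> still have to be identified with their images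
  in \<open>V\<close>.\<close>

definition graph :: "'a \<times> 'b \<Rightarrow> 'a \<times> 'b \<times> 'v" where
  "graph = (\<lambda>(x, y). (x, y, inv\<^bsub>V\<^esub> (z\<^sub>A x \<otimes>\<^bsub>V\<^esub> z\<^sub>B y)))"

definition graph_group :: "('a \<times> 'b \<times> 'v) set" where
  "graph_group = graph ` (A.PD \<times> B.PD)"

lemma subgroup_graph_group: "subgroup graph_group K"
proof -
  let ?PD = "A\<lparr>carrier := A.PD\<rparr> \<times>\<times> B\<lparr>carrier := B.PD\<rparr>"
  have "graph \<in> hom ?PD K"
    using z\<^sub>A.hom_mult z\<^sub>B.hom_mult
    by (auto simp: hom_def graph_def carrier_twisted_product mult_twisted_product \<beta>_PD_left
        V.inv_mult V.m_ac)
  moreover have "group ?PD"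
    by (intro DirProd_group comm_group.axioms(2)[OF A.comm_group_PD]
        comm_group.axioms(2)[OF B.comm_group_PD])
  ultimately have "group_hom ?PD K graph" by (intro group_homI twisted_product.group_axioms)
  from group_hom.img_is_subgroup[OF this] show ?thesis by (simp add: graph_group_def)
qed

lemma graph_group_central: "graph_group \<subseteq> center K"
proof
  fix u assume "u \<in> graph_group"
  then obtain x y v where u: "u = (x, y, v)" "x \<in> A.PD" "y \<in> B.PD" "v \<in> carrier V"
    by (auto simp: graph_group_def graph_def)
  then have center: "x \<in> center A" "y \<in> center B" using A.PD_central B.PD_central by auto
  show "u \<in> center K"
  proof (rule twisted_product.centerI)
    show "u \<in> carrier K" using u by (simp add: carrier_twisted_product)
    fix t assume "t \<in> carrier K"
    then obtain a b w where "a \<in> carrier A" "b \<in> carrier B" "w \<in> carrier V" "t = (a, b, w)"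
      by (rule twisted_productE)
    then show "commutator K u t = \<one>\<^bsub>K\<^esub>"
      using u center by (simp add: commutator_twisted_product one_twisted_product \<beta>_PD_left
          \<beta>_PD_right A.commutator_center_left B.commutator_center_left)
  qed
qed

sublocale graph_group: normal graph_group K
  using subgroup_graph_group graph_group_central by (rule twisted_product.normal_if_central)

abbreviation L where "L \<equiv> K Mod graph_group"

lemma in_variety_L: "in_variety m n L"
  using in_variety_K graph_group.normal_axioms by (rule in_variety_Mod)

sublocale L: group L by (rule graph_group.factorgroup_is_group)

sublocale coset: group_hom K L "\<lambda>u. graph_group #>\<^bsub>K\<^esub> u"
  by unfold_locales (rule graph_group.r_coset_hom_Mod)

definition left :: "'a \<Rightarrow> ('a \<times> 'b \<times> 'v) set" where
  "left a = graph_group #>\<^bsub>K\<^esub> (a, \<one>\<^bsub>B\<^esub>, \<one>\<^bsub>V\<^esub>)"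

definition right :: "'b \<Rightarrow> ('a \<times> 'b \<times> 'v) set" where
  "right b = graph_group #>\<^bsub>K\<^esub> (\<one>\<^bsub>A\<^esub>, b, \<one>\<^bsub>V\<^esub>)"

lemma left_hom: "left \<in> hom A L"
proof -
  have "(\<lambda>a. (a, \<one>\<^bsub>B\<^esub>, \<one>\<^bsub>V\<^esub>)) \<in> hom A K"
    by (auto simp: hom_def carrier_twisted_product mult_twisted_product)
  from hom_compose[OF this coset.homh] show ?thesis by (simp add: left_def[abs_def] comp_def)
qed

lemma right_hom: "right \<in> hom B L"
proof -
  have "(\<lambda>b. (\<one>\<^bsub>A\<^esub>, b, \<one>\<^bsub>V\<^esub>)) \<in> hom B K"
    by (auto simp: hom_def carrier_twisted_product mult_twisted_product)
  from hom_compose[OF this coset.homh] show ?thesis by (simp add: right_def[abs_def] comp_def)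
qed

sublocale left: group_hom A L left by unfold_locales (rule left_hom)
sublocale right: group_hom B L right by unfold_locales (rule right_hom)

lemma left_mult_inv_right:
  assumes "a \<in> carrier A" "b \<in> carrier B"
  shows "left a \<otimes>\<^bsub>L\<^esub> inv\<^bsub>L\<^esub> right b = graph_group #>\<^bsub>K\<^esub> (a, inv\<^bsub>B\<^esub> b, \<one>\<^bsub>V\<^esub>)"
proof -
  have "left a \<otimes>\<^bsub>L\<^esub> inv\<^bsub>L\<^esub> right b = left a \<otimes>\<^bsub>L\<^esub> right (inv\<^bsub>B\<^esub> b)"
    using assms(2) by (simp only: right.hom_inv)
  also have "\<dots> = graph_group #>\<^bsub>K\<^esub> ((a, \<one>\<^bsub>B\<^esub>, \<one>\<^bsub>V\<^esub>) \<otimes>\<^bsub>K\<^esub> (\<one>\<^bsub>A\<^esub>, inv\<^bsub>B\<^esub> b, \<one>\<^bsub>V\<^esub>))"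
    using assms unfolding left_def right_def
    by (intro coset.hom_mult[symmetric]) (simp_all add: carrier_twisted_product)
  finally show ?thesis using assms by (simp add: mult_twisted_product)
qed

lemma commutator_in_graph_group:
  assumes "d \<in> carrier D" "u \<in> carrier K"
  shows "commutator K (\<iota>\<^sub>A d, inv\<^bsub>B\<^esub> \<iota>\<^sub>B d, \<one>\<^bsub>V\<^esub>) u \<in> graph_group"
proof -
  obtain a b v where u: "u = (a, b, v)" "a \<in> carrier A" "b \<in> carrier B" "v \<in> carrier V"
    using assms(2) by (rule twisted_productE)
  let ?x = "commutator A a (\<iota>\<^sub>A d)" and ?y = "commutator B (\<iota>\<^sub>B d) b"
  have PD: "?x \<in> A.PD" "?y \<in> B.PD"
    using u assms(1) by (simp_all add: A.commutator_in_power_derived B.commutator_in_power_derived)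
  have "commutator B (inv\<^bsub>B\<^esub> \<iota>\<^sub>B d) b = inv\<^bsub>B\<^esub> ?y"
    using u assms(1) group_hom.hom_inv[OF B.group_hom_commutator_left] by simp
  moreover have "commutator A (\<iota>\<^sub>A d) a = inv\<^bsub>A\<^esub> ?x"
    using u(2) \<iota>\<^sub>A.hom_closed[OF assms(1)] by (rule A.commutator_swap)
  ultimately have "commutator K (\<iota>\<^sub>A d, inv\<^bsub>B\<^esub> \<iota>\<^sub>B d, \<one>\<^bsub>V\<^esub>) u
      = (inv\<^bsub>A\<^esub> ?x, inv\<^bsub>B\<^esub> ?y, z\<^sub>B ?y \<otimes>\<^bsub>V\<^esub> z\<^sub>A ?x)"
    using u assms(1) PD by (simp add: commutator_twisted_product inv_right \<beta>_D_left \<beta>_D_right)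
  also have "\<dots> = graph (inv\<^bsub>A\<^esub> ?x, inv\<^bsub>B\<^esub> ?y)"
    using PD by (simp add: graph_def z\<^sub>A_inv z\<^sub>B_inv V.inv_mult V.m_comm)
  finally show ?thesis using PD by (simp add: graph_group_def)
qed

lemma left_inv_right_central:
  assumes "d \<in> carrier D"
  shows "left (\<iota>\<^sub>A d) \<otimes>\<^bsub>L\<^esub> inv\<^bsub>L\<^esub> right (\<iota>\<^sub>B d) \<in> center L"
proof (rule L.centerI)
  show "left (\<iota>\<^sub>A d) \<otimes>\<^bsub>L\<^esub> inv\<^bsub>L\<^esub> right (\<iota>\<^sub>B d) \<in> carrier L"
    using assms by (intro L.m_closed L.inv_closed left.hom_closed right.hom_closed) simp_all
next
  fix w assume "w \<in> carrier L"
  then obtain u where u: "u \<in> carrier K" "w = graph_group #>\<^bsub>K\<^esub> u" by (auto simp: carrier_FactGroup)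
  let ?d = "(\<iota>\<^sub>A d, inv\<^bsub>B\<^esub> \<iota>\<^sub>B d, \<one>\<^bsub>V\<^esub>)"
  have d: "?d \<in> carrier K" using assms by (simp add: carrier_twisted_product)
  have "commutator L (left (\<iota>\<^sub>A d) \<otimes>\<^bsub>L\<^esub> inv\<^bsub>L\<^esub> right (\<iota>\<^sub>B d)) w = graph_group #>\<^bsub>K\<^esub> commutator K ?d u"
    using assms u coset.hom_commutator[OF d u(1)]
    by (simp only: left_mult_inv_right \<iota>\<^sub>A.hom_closed \<iota>\<^sub>B.hom_closed)
  also have "\<dots> = \<one>\<^bsub>L\<^esub>"
    using commutator_in_graph_group[OF assms u(1)] graph_group.coset_eq_self_iff
      twisted_product.commutator_closed[OF d u(1)]
    by simp
  finally show "commutator L (left (\<iota>\<^sub>A d) \<otimes>\<^bsub>L\<^esub> inv\<^bsub>L\<^esub> right (\<iota>\<^sub>B d)) w = \<one>\<^bsub>L\<^esub>" .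
qed

lemma left_inv_right_separate:
  assumes a: "a \<in> carrier A" and b: "b \<in> carrier B" and d: "d \<in> carrier D"
    and quotients_eq: "left a \<otimes>\<^bsub>L\<^esub> inv\<^bsub>L\<^esub> right b = left (\<iota>\<^sub>A d) \<otimes>\<^bsub>L\<^esub> inv\<^bsub>L\<^esub> right (\<iota>\<^sub>B d)"
  shows "\<exists>e\<in>carrier D. a = \<iota>\<^sub>A e \<and> b = \<iota>\<^sub>B e"
proof -
  have "(a, inv\<^bsub>B\<^esub> b, \<one>\<^bsub>V\<^esub>) \<in> graph_group #>\<^bsub>K\<^esub> (\<iota>\<^sub>A d, inv\<^bsub>B\<^esub> \<iota>\<^sub>B d, \<one>\<^bsub>V\<^esub>)"
    using twisted_product.rcos_self[OF _ graph_group.subgroup_axioms, of "(a, inv\<^bsub>B\<^esub> b, \<one>\<^bsub>V\<^esub>)"]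
      quotients_eq a b d
    by (simp only: left_mult_inv_right \<iota>\<^sub>A.hom_closed \<iota>\<^sub>B.hom_closed)
      (simp add: carrier_twisted_product)
  then obtain x y where xy: "x \<in> A.PD" "y \<in> B.PD"
    and graph_eq: "(a, inv\<^bsub>B\<^esub> b, \<one>\<^bsub>V\<^esub>) = graph (x, y) \<otimes>\<^bsub>K\<^esub> (\<iota>\<^sub>A d, inv\<^bsub>B\<^esub> \<iota>\<^sub>B d, \<one>\<^bsub>V\<^esub>)"
    unfolding r_coset_def graph_group_def by blast
  have a_eq: "a = x \<otimes>\<^bsub>A\<^esub> \<iota>\<^sub>A d" and b_eq: "inv\<^bsub>B\<^esub> b = y \<otimes>\<^bsub>B\<^esub> inv\<^bsub>B\<^esub> \<iota>\<^sub>B d"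
    and z_eq: "inv\<^bsub>V\<^esub> (z\<^sub>A x \<otimes>\<^bsub>V\<^esub> z\<^sub>B y) = \<one>\<^bsub>V\<^esub>"
    using graph_eq xy d by (simp_all add: graph_def mult_twisted_product \<beta>_PD_right)
  have "z\<^sub>A x \<otimes>\<^bsub>V\<^esub> z\<^sub>B y = \<one>\<^bsub>V\<^esub>"
    using xy z_eq V.inv_eq_1_iff[of "z\<^sub>A x \<otimes>\<^bsub>V\<^esub> z\<^sub>B y"] by simp
  then obtain e where e: "e \<in> carrier D" "x = \<iota>\<^sub>A e" "y = inv\<^bsub>B\<^esub> \<iota>\<^sub>B e" using separate xy by blast
  have "inv\<^bsub>B\<^esub> b = inv\<^bsub>B\<^esub> \<iota>\<^sub>B d \<otimes>\<^bsub>B\<^esub> inv\<^bsub>B\<^esub> \<iota>\<^sub>B e"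
    unfolding b_eq e(3)[symmetric] using xy(2) B.PD_central d by (intro B.centerD) auto
  also have "\<dots> = inv\<^bsub>B\<^esub> \<iota>\<^sub>B (e \<otimes>\<^bsub>D\<^esub> d)" using d e(1) by (simp add: B.inv_mult_group)
  finally have "b = \<iota>\<^sub>B (e \<otimes>\<^bsub>D\<^esub> d)"
    using b d e(1) inj_onD[OF B.inv_inj, of b "\<iota>\<^sub>B (e \<otimes>\<^bsub>D\<^esub> d)"] by simp
  moreover have "a = \<iota>\<^sub>A (e \<otimes>\<^bsub>D\<^esub> d)" using a_eq d e(1) by (simp add: e(2))
  ultimately show ?thesis using d e(1) by blast
qed

theorem strongly_embeddable: "strongly_embeddable m n A B D \<iota>\<^sub>A \<iota>\<^sub>B"
  by (rule strongly_embeddable_if_central_quotient[OF in_variety_L left_hom right_hom])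
    (fact left_inv_right_central left_inv_right_separate)+

end

section \<open>Pushouts of abelian groups\<close>

locale abelian_pushout =
  S: comm_group S + T: comm_group T + f: group_hom C S f + g: group_hom C T g
  for S :: "('s, 'ss) monoid_scheme" and T :: "('t, 'ts) monoid_scheme"
    and C :: "('c, 'cs) monoid_scheme" and f :: "'c \<Rightarrow> 's" and g :: "'c \<Rightarrow> 't"
begin

definition gluing :: "('s \<times> 't) set" where
  "gluing = (\<lambda>c. (f c, inv\<^bsub>T\<^esub> g c)) ` carrier C"

definition pushout :: "('s \<times> 't) set monoid" where
  "pushout = (S \<times>\<times> T) Mod gluing"

definition inl :: "'s \<Rightarrow> ('s \<times> 't) set" where
  "inl s = gluing #>\<^bsub>S \<times>\<times> T\<^esub> (s, \<one>\<^bsub>T\<^esub>)"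

definition inr :: "'t \<Rightarrow> ('s \<times> 't) set" where
  "inr t = gluing #>\<^bsub>S \<times>\<times> T\<^esub> (\<one>\<^bsub>S\<^esub>, t)"

sublocale sum: comm_group "S \<times>\<times> T"
  by (intro comm_group_DirProd S.comm_group_axioms T.comm_group_axioms)

lemma subgroup_gluing: "subgroup gluing (S \<times>\<times> T)"
proof -
  have "(\<lambda>c. inv\<^bsub>T\<^esub> g c) \<in> hom C T" by (simp add: hom_def T.inv_mult)
  then have "group_hom C (S \<times>\<times> T) (\<lambda>c. (f c, inv\<^bsub>T\<^esub> g c))"
    using f.homh by (intro group_homI f.G.group_axioms sum.group_axioms) (simp add: hom_paired)
  from group_hom.img_is_subgroup[OF this] show ?thesis by (simp only: gluing_def)
qed

sublocale gluing: normal gluing "S \<times>\<times> T"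
  using subgroup_gluing by (rule sum.subgroup_imp_normal)

sublocale pushout: comm_group pushout
  unfolding pushout_def by (rule sum.abelian_FactGroup[OF subgroup_gluing])

lemma coset_hom: "(\<lambda>u. gluing #>\<^bsub>S \<times>\<times> T\<^esub> u) \<in> hom (S \<times>\<times> T) pushout"
  unfolding pushout_def by (rule gluing.r_coset_hom_Mod)

lemma inl_hom: "inl \<in> hom S pushout"
proof -
  have "(\<lambda>s. (s, \<one>\<^bsub>T\<^esub>)) \<in> hom S (S \<times>\<times> T)" by (simp add: hom_def)
  from hom_compose[OF this coset_hom] show ?thesis by (simp add: inl_def[abs_def] comp_def)
qed

lemma inr_hom: "inr \<in> hom T pushout"
proof -
  have "(\<lambda>t. (\<one>\<^bsub>S\<^esub>, t)) \<in> hom T (S \<times>\<times> T)" by (simp add: hom_def)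
  from hom_compose[OF this coset_hom] show ?thesis by (simp add: inr_def[abs_def] comp_def)
qed

sublocale inl: group_hom S pushout inl by unfold_locales (rule inl_hom)
sublocale inr: group_hom T pushout inr by unfold_locales (rule inr_hom)

lemma inl_mult_inr:
  assumes "s \<in> carrier S" "t \<in> carrier T"
  shows "inl s \<otimes>\<^bsub>pushout\<^esub> inr t = gluing #>\<^bsub>S \<times>\<times> T\<^esub> (s, t)"
  using hom_mult[OF coset_hom, of "(s, \<one>\<^bsub>T\<^esub>)" "(\<one>\<^bsub>S\<^esub>, t)"] assms by (simp add: inl_def inr_def)

lemma inl_f_eq_inr_g:
  assumes "c \<in> carrier C"
  shows "inl (f c) = inr (g c)"
  using assms gluing.coset_mult_absorb[of "(f c, inv\<^bsub>T\<^esub> g c)" "(\<one>\<^bsub>S\<^esub>, g c)"]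
  by (simp add: inl_def inr_def gluing_def)

lemma inl_mult_inr_eq_oneE:
  assumes "s \<in> carrier S" "t \<in> carrier T" "inl s \<otimes>\<^bsub>pushout\<^esub> inr t = \<one>\<^bsub>pushout\<^esub>"
  obtains c where "c \<in> carrier C" "s = f c" "t = inv\<^bsub>T\<^esub> g c"
proof -
  have "(s, t) \<in> gluing"
    using assms gluing.coset_eq_self_iff[of "(s, t)"]
    by (simp add: inl_mult_inr) (simp add: pushout_def)
  then show thesis using that by (auto simp: gluing_def)
qed

lemma pushout_pow_eq_one:
  fixes k :: nat
  assumes "\<And>s. s \<in> carrier S \<Longrightarrow> s [^]\<^bsub>S\<^esub> k = \<one>\<^bsub>S\<^esub>" "\<And>t. t \<in> carrier T \<Longrightarrow> t [^]\<^bsub>T\<^esub> k = \<one>\<^bsub>T\<^esub>"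
    and "w \<in> carrier pushout"
  shows "w [^]\<^bsub>pushout\<^esub> k = \<one>\<^bsub>pushout\<^esub>"
proof -
  obtain s t where "s \<in> carrier S" "t \<in> carrier T" "w = gluing #>\<^bsub>S \<times>\<times> T\<^esub> (s, t)"
    using assms(3) by (auto simp: pushout_def carrier_FactGroup)
  then show ?thesis
    using assms(1,2) gluing.coset_eq_self_iff[of "(\<one>\<^bsub>S\<^esub>, \<one>\<^bsub>T\<^esub>)"] gluing.one_closed
    by (simp add: pushout_def gluing.FactGroup_pow pow_DirProd)
qed

end

section \<open>Compatible amalgams\<close>

locale compatible_amalgam = variety_amalgam m n A B D \<iota>\<^sub>A \<iota>\<^sub>B
  for m n :: nat and A :: "('a, 'as) monoid_scheme" and B :: "('b, 'bs) monoid_scheme"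
    and D :: "('d, 'ds) monoid_scheme" and \<iota>\<^sub>A :: "'d \<Rightarrow> 'a" and \<iota>\<^sub>B :: "'d \<Rightarrow> 'b" +
  assumes n_dvd: "n dvd m div gcd 2 m"
    and central_B: "intersection_central n A B D \<iota>\<^sub>A \<iota>\<^sub>B"
    and central_A: "intersection_central n B A D \<iota>\<^sub>B \<iota>\<^sub>A"
    and commutators_agree: "\<And>q. q > 0 \<Longrightarrow> q dvd n \<Longrightarrow> commutators_agree n q A B D \<iota>\<^sub>A \<iota>\<^sub>B"
begin

abbreviation X where "X \<equiv> A.quotient"
abbreviation Y where "Y \<equiv> B.quotient"
abbreviation common where "common \<equiv> {d \<in> carrier D. \<iota>\<^sub>A d \<in> A.PD \<and> \<iota>\<^sub>B d \<in> B.PD}"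

lemma subgroup_common: "subgroup common D"
  by (rule D.subgroupI) (auto intro: exI[of _ "\<one>\<^bsub>D\<^esub>"])

sublocale amalgamated: abelian_pushout "A\<lparr>carrier := A.PD\<rparr>" "B\<lparr>carrier := B.PD\<rparr>"
  "D\<lparr>carrier := common\<rparr>" \<iota>\<^sub>A \<iota>\<^sub>B
  by (intro abelian_pushout.intro group_homI A.comm_group_PD B.comm_group_PD
      comm_group.axioms(2)[OF A.comm_group_PD] comm_group.axioms(2)[OF B.comm_group_PD]
      D.subgroup_imp_group[OF subgroup_common])
    (simp_all add: hom_def)

abbreviation W where "W \<equiv> amalgamated.pushout"

definition p :: "'d \<Rightarrow> 'a set" where "p d = A.PD #>\<^bsub>A\<^esub> \<iota>\<^sub>A d"
definition r :: "'d \<Rightarrow> 'b set" where "r d = B.PD #>\<^bsub>B\<^esub> \<iota>\<^sub>B d"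

sublocale p: group_hom D X p
  using hom_compose[OF \<iota>\<^sub>A.homh A.PD.r_coset_hom_Mod]
  by unfold_locales (simp add: p_def[abs_def] comp_def)

sublocale r: group_hom D Y r
  using hom_compose[OF \<iota>\<^sub>B.homh B.PD.r_coset_hom_Mod]
  by unfold_locales (simp add: r_def[abs_def] comp_def)

definition \<alpha> :: "'a set \<Rightarrow> 'd \<Rightarrow> ('a \<times> 'b) set" where
  "\<alpha> u d = amalgamated.inl (A.quotient_commutator u (p d))"

definition \<gamma> :: "'d \<Rightarrow> 'b set \<Rightarrow> ('a \<times> 'b) set" where
  "\<gamma> d v = amalgamated.inr (B.quotient_commutator (r d) v)"

lemma \<alpha>_coset: "a \<in> carrier A \<Longrightarrow> d \<in> carrier D \<Longrightarrow>
    \<alpha> (A.PD #>\<^bsub>A\<^esub> a) d = amalgamated.inl (commutator A a (\<iota>\<^sub>A d))"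
  by (simp add: \<alpha>_def p_def A.quotient_commutator_cosets)

lemma \<gamma>_coset: "b \<in> carrier B \<Longrightarrow> d \<in> carrier D \<Longrightarrow>
    \<gamma> d (B.PD #>\<^bsub>B\<^esub> b) = amalgamated.inr (commutator B (\<iota>\<^sub>B d) b)"
  by (simp add: \<gamma>_def r_def B.quotient_commutator_cosets)

sublocale linked: linked_pairings X Y W D p r \<alpha> \<gamma>
proof (intro linked_pairings.intro A.quotient.comm_group_axioms B.quotient.comm_group_axioms
    amalgamated.pushout.comm_group_axioms D.group_axioms p.group_hom_axioms r.group_hom_axioms)
  have id: "(\<lambda>u. u) \<in> hom G G" for G :: "('g, 'gs) monoid_scheme" by (simp add: hom_def)
  show "bihom X D W \<alpha>"
    unfolding \<alpha>_def[abs_def]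
    by (rule A.quotient_commutator.comp[OF A.quotient.group_axioms D.group_axioms
          amalgamated.pushout.comm_group_axioms id p.homh amalgamated.inl_hom])
  show "bihom D Y W \<gamma>"
    unfolding \<gamma>_def[abs_def]
    by (rule B.quotient_commutator.comp[OF D.group_axioms B.quotient.group_axioms
          amalgamated.pushout.comm_group_axioms r.homh id amalgamated.inr_hom])
qed

lemma \<iota>\<^sub>A_in_PD_iff: "d \<in> carrier D \<Longrightarrow> \<iota>\<^sub>A d \<in> A.PD \<longleftrightarrow> p d = \<one>\<^bsub>X\<^esub>"
  and \<iota>\<^sub>B_in_PD_iff: "d \<in> carrier D \<Longrightarrow> \<iota>\<^sub>B d \<in> B.PD \<longleftrightarrow> r d = \<one>\<^bsub>Y\<^esub>"
  by (simp_all add: p_def r_def A.PD.coset_eq_self_iff B.PD.coset_eq_self_iff)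

lemma balanced_at_0: "linked.balanced_at 0"
  unfolding linked.balanced_at_def
proof (intro ballI impI)
  fix u v d e
  assume u: "u \<in> carrier X" and v: "v \<in> carrier Y" and d: "d \<in> carrier D" and e: "e \<in> carrier D"
    and "p d = u [^]\<^bsub>X\<^esub> (0::int)" "r e = v [^]\<^bsub>Y\<^esub> (0::int)"
  then have "\<iota>\<^sub>A d \<in> A.PD" "\<iota>\<^sub>B e \<in> B.PD" by (simp_all add: \<iota>\<^sub>A_in_PD_iff \<iota>\<^sub>B_in_PD_iff)
  then have "\<iota>\<^sub>B d \<in> center B" "\<iota>\<^sub>A e \<in> center A"
    using d e central_A central_B by (simp_all add: intersection_central_def)
  moreover obtain a where a: "a \<in> carrier A" "u = A.PD #>\<^bsub>A\<^esub> a" using u by (rule A.quotientE)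
  moreover obtain b where b: "b \<in> carrier B" "v = B.PD #>\<^bsub>B\<^esub> b" using v by (rule B.quotientE)
  ultimately have "\<alpha> u e = \<one>\<^bsub>W\<^esub>" "\<gamma> d v = \<one>\<^bsub>W\<^esub>"
    using d e amalgamated.inl.hom_one amalgamated.inr.hom_one
    by (simp_all add: \<alpha>_coset \<gamma>_coset A.commutator_center_right B.commutator_center_left)
  then show "\<alpha> u e = \<gamma> d v" by simp
qed

lemma balanced_at_divisor:
  assumes q: "q > 0" "q dvd n"
  shows "linked.balanced_at (int q)"
  unfolding linked.balanced_at_def
proof (intro ballI impI)
  fix u v d e
  assume u: "u \<in> carrier X" and v: "v \<in> carrier Y" and d: "d \<in> carrier D" and e: "e \<in> carrier D"
    and p_d: "p d = u [^]\<^bsub>X\<^esub> int q" and r_e: "r e = v [^]\<^bsub>Y\<^esub> int q"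
  obtain a where a: "a \<in> carrier A" "u = A.PD #>\<^bsub>A\<^esub> a" using u by (rule A.quotientE)
  obtain b where b: "b \<in> carrier B" "v = B.PD #>\<^bsub>B\<^esub> b" using v by (rule B.quotientE)
  have "A.PD #>\<^bsub>A\<^esub> \<iota>\<^sub>A d = A.PD #>\<^bsub>A\<^esub> (a [^]\<^bsub>A\<^esub> q)"
    using p_d a by (simp add: p_def int_pow_int A.PD.FactGroup_pow)
  then obtain a' where a': "a' \<in> A.PD" "\<iota>\<^sub>A d = a [^]\<^bsub>A\<^esub> q \<otimes>\<^bsub>A\<^esub> a'"
    using a(1) d by (elim A.coset_eqE[rotated 2]) simp_all
  have "B.PD #>\<^bsub>B\<^esub> \<iota>\<^sub>B e = B.PD #>\<^bsub>B\<^esub> (b [^]\<^bsub>B\<^esub> q)"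
    using r_e b by (simp add: r_def int_pow_int B.PD.FactGroup_pow)
  then obtain b' where b': "b' \<in> B.PD" "\<iota>\<^sub>B e = b [^]\<^bsub>B\<^esub> q \<otimes>\<^bsub>B\<^esub> b'"
    using b(1) e by (elim B.coset_eqE[rotated 2]) simp_all
  obtain f where f: "f \<in> carrier D" "\<iota>\<^sub>B f = commutator B (\<iota>\<^sub>B d) b" "\<iota>\<^sub>A f = commutator A a (\<iota>\<^sub>A e)"
    using commutators_agree[OF q] a(1) a' b(1) b' d e unfolding commutators_agree_def by blast
  then have "f \<in> common"
    using a b d e by (simp add: A.commutator_in_power_derived B.commutator_in_power_derived)
  then have "amalgamated.inl (\<iota>\<^sub>A f) = amalgamated.inr (\<iota>\<^sub>B f)"
    by (intro amalgamated.inl_f_eq_inr_g) simp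
  then show "\<alpha> u e = \<gamma> d v" using a b d e f by (simp add: \<alpha>_coset \<gamma>_coset)
qed

lemma balanced_at: "linked.balanced_at q"
proof (rule linked.balanced_at_if_balanced_at_gcd[OF balanced_at_0])
  define g where "g = gcd (nat \<bar>q\<bar>) n"
  have "linked.balanced_at (int g)"
  proof (cases "g = 0")
    case True
    then show ?thesis using balanced_at_0 by simp
  next
    case False
    moreover have "g dvd n" unfolding g_def by (rule gcd_dvd2)
    ultimately show ?thesis by (intro balanced_at_divisor) simp_all
  qed
  moreover have "int g = gcd q (int n)" by (simp add: g_def flip: gcd_int_int_eq)
  ultimately show "linked.balanced_at (gcd q (int n))" by simp
qed (simp_all add: int_pow_int A.pow_Mod_power_derived B.pow_Mod_power_derived)

sublocale linked: balanced_pairings X Y W D p r \<alpha> \<gamma>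
  by (intro balanced_pairings.intro balanced_pairings_axioms.intro linked.linked_pairings_axioms
      balanced_at)

abbreviation V where "V \<equiv> linked.extension"

lemma V_exponent:
  assumes "v \<in> carrier V"
  shows "v [^]\<^bsub>V\<^esub> m = \<one>\<^bsub>V\<^esub>"
proof (rule linked.extension_pow_eq_one[OF _ _ assms])
  show "w [^]\<^bsub>W\<^esub> m = \<one>\<^bsub>W\<^esub>" if "w \<in> carrier W" for w
    by (rule amalgamated.pushout_pow_eq_one[OF _ _ that])
      (simp_all add: A.pow_exponent B.pow_exponent flip: A.nat_pow_consistent B.nat_pow_consistent)
  obtain k where k: "m = n * k" using dvd_if_dvd_div_gcd_2[OF n_dvd] by blast
  show "y [^]\<^bsub>Y\<^esub> m = \<one>\<^bsub>Y\<^esub>" if "y \<in> carrier Y" for y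
    unfolding k B.quotient.nat_pow_pow[OF that, symmetric] B.pow_Mod_power_derived[OF that]
    by (rule B.quotient.nat_pow_one)
qed

definition \<beta> where "\<beta> a b = linked.pairing (A.PD #>\<^bsub>A\<^esub> a) (B.PD #>\<^bsub>B\<^esub> b)"

sublocale \<beta>: bihom A B V \<beta>
proof -
  have "(\<lambda>v. v) \<in> hom V V" by (simp add: hom_def)
  from linked.pairing.comp[OF A.group_axioms B.group_axioms linked.extension.comm_group_axioms
      A.PD.r_coset_hom_Mod B.PD.r_coset_hom_Mod this]
  show "bihom A B V \<beta>" by (simp only: \<beta>_def[abs_def])
qed

sublocale amalgam_pairing m n A B D \<iota>\<^sub>A \<iota>\<^sub>B V \<beta>
  "\<lambda>x. linked.embed (amalgamated.inl x)" "\<lambda>y. linked.embed (amalgamated.inr y)"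
proof (intro amalgam_pairing.intro amalgam_pairing_axioms.intro variety_amalgam_axioms
    \<beta>.bihom_axioms dvd_choose_two_if_dvd_div_gcd_2[OF n_dvd] V_exponent)
  show "(\<lambda>x. linked.embed (amalgamated.inl x)) \<in> hom (A\<lparr>carrier := A.PD\<rparr>) V"
    using hom_compose[OF amalgamated.inl_hom linked.embed_hom] by (simp add: comp_def)
  show "(\<lambda>y. linked.embed (amalgamated.inr y)) \<in> hom (B\<lparr>carrier := B.PD\<rparr>) V"
    using hom_compose[OF amalgamated.inr_hom linked.embed_hom] by (simp add: comp_def)
next
  fix x y
  assume x: "x \<in> A.PD" and y: "y \<in> B.PD"
    and product_one: "linked.embed (amalgamated.inl x) \<otimes>\<^bsub>V\<^esub> linked.embed (amalgamated.inr y) = \<one>\<^bsub>V\<^esub>"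
  have closed: "amalgamated.inl x \<in> carrier W" "amalgamated.inr y \<in> carrier W"
    using x y amalgamated.inl.hom_closed amalgamated.inr.hom_closed by simp_all
  then have "linked.embed (amalgamated.inl x \<otimes>\<^bsub>W\<^esub> amalgamated.inr y) = \<one>\<^bsub>V\<^esub>" using product_one by simp
  then have "amalgamated.inl x \<otimes>\<^bsub>W\<^esub> amalgamated.inr y = \<one>\<^bsub>W\<^esub>"
    using closed linked.embed_mon linked.embed.inj_on_one_iff by (simp add: mon_def)
  then show "\<exists>e\<in>carrier D. x = \<iota>\<^sub>A e \<and> y = inv\<^bsub>B\<^esub> \<iota>\<^sub>B e"
    using x y by (elim amalgamated.inl_mult_inr_eq_oneE[rotated 2])
      (auto simp: B.m_inv_consistent[OF B.subgroup_power_derived])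
next
  show "\<beta> a b = \<one>\<^bsub>V\<^esub>" if "a \<in> A.PD" "b \<in> carrier B" for a b
    using that A.PD.coset_eq_self_iff[of a] linked.pairing.one_left by (simp add: \<beta>_def)
  show "\<beta> a b = \<one>\<^bsub>V\<^esub>" if "a \<in> carrier A" "b \<in> B.PD" for a b
    using that B.PD.coset_eq_self_iff[of b] linked.pairing.one_right by (simp add: \<beta>_def)
  show "\<beta> a (\<iota>\<^sub>B d) = linked.embed (amalgamated.inl (commutator A a (\<iota>\<^sub>A d)))"
    if "a \<in> carrier A" "d \<in> carrier D" for a d
    using that linked.pairing_r[of "A.PD #>\<^bsub>A\<^esub> a" d] by (simp add: \<beta>_def r_def \<alpha>_coset)
  show "\<beta> (\<iota>\<^sub>A d) b = linked.embed (amalgamated.inr (commutator B (\<iota>\<^sub>B d) b))"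
    if "b \<in> carrier B" "d \<in> carrier D" for b d
    using that linked.pairing_p[of d "B.PD #>\<^bsub>B\<^esub> b"] by (simp add: \<beta>_def p_def \<gamma>_coset)
qed

end

theorem (in variety_amalgam) strongly_embeddable_iff:
  assumes "n dvd m div gcd 2 m"
  shows "strongly_embeddable m n A B D \<iota>\<^sub>A \<iota>\<^sub>B \<longleftrightarrow>
    (intersection_central n A B D \<iota>\<^sub>A \<iota>\<^sub>B \<and> intersection_central n B A D \<iota>\<^sub>B \<iota>\<^sub>A) \<and>
    (\<forall>q>0. q dvd n \<longrightarrow> commutators_agree n q A B D \<iota>\<^sub>A \<iota>\<^sub>B)" (is "_ \<longleftrightarrow> ?compatible")
proof
  assume "strongly_embeddable m n A B D \<iota>\<^sub>A \<iota>\<^sub>B"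
  then obtain M :: "('a + 'b) list monoid" and \<phi>\<^sub>A \<phi>\<^sub>B
    where embedding: "strong_embedding m n A B D \<iota>\<^sub>A \<iota>\<^sub>B M \<phi>\<^sub>A \<phi>\<^sub>B"
    unfolding strongly_embeddable_def by blast
  interpret swapped: variety_amalgam m n B A D \<iota>\<^sub>B \<iota>\<^sub>A by (rule swap)
  show ?compatible
    using intersection_central_if_strong_embedding[OF embedding]
      swapped.intersection_central_if_strong_embedding[OF strong_embedding_swap[OF embedding]]
      commutators_agree_if_strong_embedding[OF embedding] by blast
next
  assume ?compatible
  then interpret compatible_amalgam m n A B D \<iota>\<^sub>A \<iota>\<^sub>B using assms by unfold_locales simp_all
  show "strongly_embeddable m n A B D \<iota>\<^sub>A \<iota>\<^sub>B" by (rule strongly_embeddable)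
qed

theorem theorem2p3:
  fixes m n :: nat
    and A :: "('a, 'x) monoid_scheme" and B :: "('b, 'y) monoid_scheme"
    and D :: "('d, 'z) monoid_scheme"
    and \<iota>\<^sub>A :: "'d \<Rightarrow> 'a" and \<iota>\<^sub>B :: "'d \<Rightarrow> 'b"
  assumes "n dvd m div gcd 2 m"
    and "amalgam m n A B D \<iota>\<^sub>A \<iota>\<^sub>B"
  shows "strongly_embeddable m n A B D \<iota>\<^sub>A \<iota>\<^sub>B \<longleftrightarrow>
    ((\<forall>d \<in> carrier D. \<iota>\<^sub>A d \<in> power_derived A n \<longrightarrow> \<iota>\<^sub>B d \<in> center B) \<and>
     (\<forall>d \<in> carrier D. \<iota>\<^sub>B d \<in> power_derived B n \<longrightarrow> \<iota>\<^sub>A d \<in> center A)) \<and>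
    (\<forall>q :: nat. q > 0 \<longrightarrow> q dvd n \<longrightarrow>
      (\<forall>a \<in> carrier A. \<forall>a' \<in> power_derived A n. \<forall>b \<in> carrier B. \<forall>b' \<in> power_derived B n.
       \<forall>d\<^sub>1 \<in> carrier D. \<forall>d\<^sub>2 \<in> carrier D.
         \<iota>\<^sub>A d\<^sub>1 = a [^]\<^bsub>A\<^esub> q \<otimes>\<^bsub>A\<^esub> a' \<longrightarrow> \<iota>\<^sub>B d\<^sub>2 = b [^]\<^bsub>B\<^esub> q \<otimes>\<^bsub>B\<^esub> b' \<longrightarrow>
         (\<exists>d \<in> carrier D. \<iota>\<^sub>B d = commutator B (\<iota>\<^sub>B d\<^sub>1) b \<and> \<iota>\<^sub>A d = commutator A a (\<iota>\<^sub>A d\<^sub>2))))"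
proof -
  interpret variety_amalgam m n A B D \<iota>\<^sub>A \<iota>\<^sub>B by unfold_locales (rule assms(2))
  show ?thesis
    using strongly_embeddable_iff[OF assms(1)]
    unfolding intersection_central_def commutators_agree_def .
qed

end
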